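(* Let $k\ge 3$ and $m\ge 8$. Then (i) $\rho(U_2(m-4,2))\le\rho(U_3^2(m-4,0;1))<\rho(U_3^1(m-3,0;1))<\rho(U_2(m-3,1))<\rho(U_2(m-2,0))$, where equality in the first inequality holds only if $m=8$; (ii) if $H\in\mathbb U^m$ and $H\notin\{U_2(m-2,0),U_2(m-3,1),U_2(m-4,2),U_3^1(m-3,0;1),U_3^2(m-4,0;1)\}$, then $\rho(H)<\rho(U_2(m-4,2))$.
   Context: A $k$-graph is a pair $H=(V,E)$ with $V$ a nonempty finite set and $E$ a set of $k$-element subsets of $V$ (edges). With $V=\{1,\dots,n\}$, the adjacency tensor $\mathcal A(H)$ is the order-$k$ dimension-$n$ tensor with $\mathcal A_{i_1\cdots i_k}=1/(k-1)!$ if $\{i_1,\dots,i_k\}\in E$ and $0$ otherwise. $\lambda\in\mathbb C$ is an eigenvalue if there is a nonzero $x\in\mathbb C^n$ with $\sum_{i_2,\dots,i_k}\mathcal A_{ii_2\cdots i_k}x_{i_2}\cdots x_{i_k}=\lambda x_i^{k-1}$ for all $i$; $\rho(H)$ is the maximum modulus of the eigenvalues. A path is an alternating sequence $v_0e_1v_1\cdots e_sv_s$ of distinct vertices and edges with $v_{j-1},v_j\in e_j$; $H$ is connected if any two vertices lie on a common path. A connected $k$-graph with $n$ vertices and $m$ edges is unicyclic if $n=m(k-1)$. $\mathbb U^m$ is the set of connected unicyclic $k$-graphs with $m$ edges. A vertex is pendent if it lies in exactly one edge; attaching a pendent edge at a vertex $x$ means adding a new edge consisting of $x$ and $k-1$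 new vertices. For integers $a,b\ge0$, $U_2(a,b)$ consists of two edges $e_1,e_2$ with $e_1\cap e_2=\{u,v\}$ (their other vertices lying in no other edge) together with $a$ pendent edges attached at $u$ and $b$ pendent edges attached at $v$. For $c\ge 1$, $U_3^1(a,b;c)$ is obtained from $U_2(a,b)$ by attaching $c$ pendent edges at a vertex $w\in e_1\setminus\{u,v\}$; $U_3^2(a,b;c)$ is obtained from $U_2(a+1,b)$ by attaching $c$ pendent edges at a vertex $w\ne u$ of one of the pendent edges attached at $u$. *)

theory Defs
  imports "HOL-Analysis.Analysis"
begin

type_synonym 'a hgraph = "'a set \<times> 'a set set"

abbreviation verts :: "'a hgraph \<Rightarrow> 'a set" where
  "verts H \<equiv> fst H"

abbreviation edges :: "'a hgraph \<Rightarrow> 'a set set" where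
  "edges H \<equiv> snd H"

definition kgraph :: "nat \<Rightarrow> 'a hgraph \<Rightarrow> bool" where
  "kgraph k H \<longleftrightarrow> finite (verts H) \<and> verts H \<noteq> {} \<and>
     (\<forall>e\<in>edges H. e \<subseteq> verts H \<and> card e = k)"

text \<open>A tensor of order \<open>k\<close> whose dimensions are indexed by a finite set \<open>V\<close> is a function on
  lists over \<open>V\<close> of length \<open>k\<close>.\<close>

definition tuples :: "'a set \<Rightarrow> nat \<Rightarrow> 'a list set" where
  "tuples V r = {is. set is \<subseteq> V \<and> length is = r}"

definition tensor_eigenvalue ::
    "nat \<Rightarrow> 'a set \<Rightarrow> ('a list \<Rightarrow> complex) \<Rightarrow> complex \<Rightarrow> bool" where
  "tensor_eigenvalue k V A c \<longleftrightarrow>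
     (\<exists>x :: 'a \<Rightarrow> complex. (\<exists>i\<in>V. x i \<noteq> 0) \<and>
        (\<forall>i\<in>V. (\<Sum>is\<in>tuples V (k - 1). A (i # is) * prod_list (map x is)) = c * x i ^ (k - 1)))"

definition adj_tensor :: "nat \<Rightarrow> 'a hgraph \<Rightarrow> 'a list \<Rightarrow> complex" where
  "adj_tensor k H is = (if set is \<in> edges H then 1 / fact (k - 1) else 0)"

definition spectral_radius :: "nat \<Rightarrow> 'a hgraph \<Rightarrow> real" where
  "spectral_radius k H =
     (GREATEST r. r \<in> cmod ` {c. tensor_eigenvalue k (verts H) (adj_tensor k H) c})"

text \<open>The path \<open>v\<^sub>0 e\<^sub>1 v\<^sub>1 \<dots> e\<^sub>s v\<^sub>s\<close> is given by the lists
  \<open>vs = [v\<^sub>0, \<dots>, v\<^sub>s]\<close> and \<open>es = [e\<^sub>1, \<dots>, e\<^sub>s]\<close>.\<close>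

definition hpath :: "'a hgraph \<Rightarrow> 'a list \<Rightarrow> 'a set list \<Rightarrow> bool" where
  "hpath H vs es \<longleftrightarrow> length vs = Suc (length es) \<and> distinct vs \<and> distinct es \<and>
     set vs \<subseteq> verts H \<and> set es \<subseteq> edges H \<and>
     (\<forall>j<length es. vs ! j \<in> es ! j \<and> vs ! Suc j \<in> es ! j)"

definition connected_hgraph :: "'a hgraph \<Rightarrow> bool" where
  "connected_hgraph H \<longleftrightarrow>
     (\<forall>x\<in>verts H. \<forall>y\<in>verts H. \<exists>vs es. hpath H vs es \<and> x \<in> set vs \<and> y \<in> set vs)"

definition unicyclic :: "nat \<Rightarrow> 'a hgraph \<Rightarrow> bool" where
  "unicyclic k H \<longleftrightarrow> kgraph k H \<and> connected_hgraph H \<and>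
     card (verts H) = card (edges H) * (k - 1)"

definition unicyclics :: "nat \<Rightarrow> nat \<Rightarrow> 'a hgraph set" where
  "unicyclics k m = {H. unicyclic k H \<and> card (edges H) = m}"

definition attach_pendent :: "nat \<Rightarrow> 'a \<Rightarrow> 'a hgraph \<Rightarrow> 'a hgraph \<Rightarrow> bool" where
  "attach_pendent k x H H' \<longleftrightarrow> x \<in> verts H \<and>
     (\<exists>N. finite N \<and> card N = k - 1 \<and> N \<inter> verts H = {} \<and>
        H' = (verts H \<union> N, insert (insert x N) (edges H)))"

text \<open>\<open>U2\<close>, \<open>U3_1\<close> and \<open>U3_2\<close> below are the sets of all graphs on vertices of type \<open>'a\<close> that are
  copies of the respective graph. The choice of fresh vertices in \<open>attach_pendent\<close> is
  unconstrained, so these sets are closed under isomorphism, and for \<open>k \<ge> 3\<close> any two members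
  are isomorphic.\<close>

definition U2_at ::
    "nat \<Rightarrow> nat \<Rightarrow> nat \<Rightarrow> 'a \<Rightarrow> 'a \<Rightarrow> 'a set \<Rightarrow> 'a set \<Rightarrow> 'a hgraph \<Rightarrow> bool" where
  "U2_at k a b u v e1 e2 H \<longleftrightarrow>
     finite e1 \<and> finite e2 \<and> card e1 = k \<and> card e2 = k \<and> e1 \<noteq> e2 \<and>
     u \<noteq> v \<and> e1 \<inter> e2 = {u, v} \<and>
     (\<exists>H1. (attach_pendent k u ^^ a) (e1 \<union> e2, {e1, e2}) H1 \<and> (attach_pendent k v ^^ b) H1 H)"

definition U2 :: "nat \<Rightarrow> nat \<Rightarrow> nat \<Rightarrow> 'a hgraph set" where
  "U2 k a b = {H. \<exists>u v e1 e2. U2_at k a b u v e1 e2 H}"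

definition U3_1 :: "nat \<Rightarrow> nat \<Rightarrow> nat \<Rightarrow> nat \<Rightarrow> 'a hgraph set" where
  "U3_1 k a b c = {H. \<exists>u v e1 e2 H0 w. U2_at k a b u v e1 e2 H0 \<and>
     w \<in> e1 - {u, v} \<and> (attach_pendent k w ^^ c) H0 H}"

text \<open>The edges of \<open>U\<^sub>2(a + 1, b)\<close> that contain \<open>u\<close> and differ from \<open>e1\<close> and \<open>e2\<close> are exactly the
  pendent edges attached at \<open>u\<close>.\<close>

definition U3_2 :: "nat \<Rightarrow> nat \<Rightarrow> nat \<Rightarrow> nat \<Rightarrow> 'a hgraph set" where
  "U3_2 k a b c = {H. \<exists>u v e1 e2 H0 f w. U2_at k (a + 1) b u v e1 e2 H0 \<and>
     f \<in> edges H0 - {e1, e2} \<and> u \<in> f \<and> w \<in> f - {u} \<and> (attach_pendent k w ^^ c) H0 H}"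

text \<open>Copies exist on every infinite vertex type.\<close>

lemma attach_pendent_pow_ex:
  assumes "infinite (UNIV :: 'a set)" "finite (verts H)" "x \<in> verts (H :: 'a hgraph)"
  shows "\<exists>H'. (attach_pendent k x ^^ c) H H' \<and> finite (verts H') \<and>
           verts H \<subseteq> verts H' \<and> edges H \<subseteq> edges H'"
proof (induction c)
  case 0
  then show ?case using assms by auto
next
  case (Suc c)
  then obtain H' where H': "(attach_pendent k x ^^ c) H H'" "finite (verts H')"
    "verts H \<subseteq> verts H'" "edges H \<subseteq> edges H'" by blast
  have "infinite (- verts H')"
    using assms(1) H'(2) by (simp add: Compl_eq_Diff_UNIV)
  then obtain N where N: "finite N" "card N = k - 1" "N \<subseteq> - verts H'"
    using infinite_arbitrarily_large by blast
  let ?G = "(verts H' \<union> N, insert (insert x N) (edges H'))"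
  have "N \<inter> verts H' = {}" "x \<in> verts H'"
    using N(3) H'(3) assms(3) by auto
  then have "attach_pendent k x H' ?G"
    unfolding attach_pendent_def using N by blast
  then have "(attach_pendent k x ^^ Suc c) H ?G"
    using H'(1) by auto
  then show ?case
    using N H' by (intro exI[of _ ?G]) auto
qed

lemma U2_at_ex:
  assumes "infinite (UNIV :: 'a set)" "k \<ge> 3"
  shows "\<exists>u v e1 e2 (H :: 'a hgraph). U2_at k a b u v e1 e2 H \<and> finite (verts H) \<and>
    e1 \<union> e2 \<subseteq> verts H \<and>
    (a > 0 \<longrightarrow> (\<exists>f w. f \<in> edges H - {e1, e2} \<and> u \<in> f \<and> w \<in> f - {u} \<and> w \<in> verts H))"
proof -
  obtain A :: "'a set" where A: "finite A" "card A = k"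
    using assms(1) infinite_arbitrarily_large by blast
  have "card A = Suc (k - 1)" using A assms(2) by simp
  then obtain u A' where uA: "A = insert u A'" "u \<notin> A'" "card A' = k - 1"
    by (auto simp: card_Suc_eq)
  have "card A' = Suc (k - 2)" using uA(3) assms(2) by simp
  then obtain v A'' where vA: "A' = insert v A''" "v \<notin> A''"
    by (auto simp: card_Suc_eq)
  have "infinite (- A)"
    using assms(1) A(1) by (simp add: Compl_eq_Diff_UNIV)
  then obtain B where B: "finite B" "card B = k - 2" "B \<subseteq> - A"
    using infinite_arbitrarily_large by blast
  let ?e2 = "insert u (insert v B)"
  have uv: "u \<noteq> v" using uA vA by auto
  have "u \<notin> B" "v \<notin> B" using B(3) uA vA by auto
  then have c2: "card ?e2 = k" using B uv assms(2) by auto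
  have int: "A \<inter> ?e2 = {u, v}" using B(3) uA vA by auto
  have ne: "A \<noteq> ?e2"
  proof
    assume "A = ?e2"
    then have "A = {u, v}" using int by auto
    then show False using A(2) assms(2) uv by auto
  qed
  define G0 where "G0 = (A \<union> ?e2, {A, ?e2})"
  have vG0: "verts G0 = A \<union> ?e2" by (simp add: G0_def)
  have H0: "finite (verts G0)" "u \<in> verts G0" "v \<in> verts G0"
    using A B vG0 by auto
  have "\<exists>H1. (attach_pendent k u ^^ a) G0 H1 \<and> finite (verts H1) \<and>
      verts G0 \<subseteq> verts H1 \<and>
      (a > 0 \<longrightarrow> (\<exists>f w. f \<in> edges H1 - {A, ?e2} \<and> u \<in> f \<and> w \<in> f - {u} \<and> w \<in> verts H1))"
  proof (cases a)
    case 0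
    then show ?thesis using H0 by auto
  next
    case (Suc a')
    obtain H' where H': "(attach_pendent k u ^^ a') G0 H'" "finite (verts H')"
      "verts G0 \<subseteq> verts H'" "edges G0 \<subseteq> edges H'"
      using attach_pendent_pow_ex[OF assms(1) H0(1,2), of a' k] by blast
    have "\<exists>H1. (attach_pendent k u ^^ 1) H' H1 \<and> finite (verts H1)"
      using attach_pendent_pow_ex[OF assms(1) H'(2), of u 1 k] H'(3) H0(2) by blast
    then obtain H1 where H1: "attach_pendent k u H' H1" "finite (verts H1)" by auto
    then obtain N where N: "finite N" "card N = k - 1" "N \<inter> verts H' = {}"
      "H1 = (verts H' \<union> N, insert (insert u N) (edges H'))"
      unfolding attach_pendent_def by blast
    obtain w where w: "w \<in> N" using N(2) assms(2) by fastforce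
    have "w \<notin> A \<union> ?e2" using w N(3) H'(3) vG0 by blast
    then have "insert u N \<notin> {A, ?e2}" "w \<noteq> u" using w uA by auto
    then have "insert u N \<in> edges H1 - {A, ?e2} \<and> u \<in> insert u N \<and> w \<in> insert u N - {u} \<and>
        w \<in> verts H1"
      using N(4) w by auto
    moreover have "(attach_pendent k u ^^ a) G0 H1"
      using Suc H'(1) H1(1) by auto
    moreover have "verts G0 \<subseteq> verts H1" using N(4) H'(3) by auto
    ultimately show ?thesis using H1(2) by blast
  qed
  then obtain H1 where H1: "(attach_pendent k u ^^ a) G0 H1" "finite (verts H1)"
      "verts G0 \<subseteq> verts H1"
      "a > 0 \<longrightarrow> (\<exists>f w. f \<in> edges H1 - {A, ?e2} \<and> u \<in> f \<and> w \<in> f - {u} \<and> w \<in> verts H1)"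
    by blast
  have "v \<in> verts H1" using H1(3) H0(3) by blast
  then obtain H where H: "(attach_pendent k v ^^ b) H1 H" "finite (verts H)"
      "verts H1 \<subseteq> verts H" "edges H1 \<subseteq> edges H"
    using attach_pendent_pow_ex[OF assms(1) H1(2)] by blast
  have "U2_at k a b u v A ?e2 H"
    unfolding U2_at_def using A B c2 int ne uv H1(1) H(1)
    by (intro conjI exI[of _ H1]) (simp_all add: G0_def)
  moreover have "A \<union> ?e2 \<subseteq> verts H" using H1(3) H(3) vG0 by blast
  moreover have "a > 0 \<longrightarrow>
      (\<exists>f w. f \<in> edges H - {A, ?e2} \<and> u \<in> f \<and> w \<in> f - {u} \<and> w \<in> verts H)"
    using H1(4) H(3,4) by blast
  ultimately show ?thesis using H(2) by blast
qed

lemma U2_nonempty: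
  assumes "infinite (UNIV :: 'a set)" "k \<ge> 3"
  shows "(U2 k a b :: 'a hgraph set) \<noteq> {}"
  using U2_at_ex[OF assms, of a b] unfolding U2_def by blast

lemma U3_1_nonempty:
  assumes "infinite (UNIV :: 'a set)" "k \<ge> 3"
  shows "(U3_1 k a b c :: 'a hgraph set) \<noteq> {}"
proof -
  obtain u v e1 e2 and H0 :: "'a hgraph" where H0: "U2_at k a b u v e1 e2 H0"
    "finite (verts H0)" "e1 \<union> e2 \<subseteq> verts H0"
    using U2_at_ex[OF assms, of a b] by blast
  have "card {u, v} < card e1" "finite {u, v}"
    using H0(1) assms(2) unfolding U2_at_def by auto
  then have "\<not> e1 \<subseteq> {u, v}" by (meson card_mono not_le)
  then obtain w where w: "w \<in> e1 - {u, v}" by blast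
  then have "w \<in> verts H0" using H0(3) by blast
  then obtain H where "(attach_pendent k w ^^ c) H0 H"
    using attach_pendent_pow_ex[OF assms(1) H0(2)] by blast
  then show ?thesis unfolding U3_1_def using H0(1) w by blast
qed

lemma U3_2_nonempty:
  assumes "infinite (UNIV :: 'a set)" "k \<ge> 3"
  shows "(U3_2 k a b c :: 'a hgraph set) \<noteq> {}"
proof -
  obtain u v e1 e2 f w and H0 :: "'a hgraph" where H0: "U2_at k (a + 1) b u v e1 e2 H0"
    "finite (verts H0)" "f \<in> edges H0 - {e1, e2}" "u \<in> f" "w \<in> f - {u}" "w \<in> verts H0"
    using U2_at_ex[OF assms, of "a + 1" b] by (metis add_gr_0 zero_less_one)
  obtain H where "(attach_pendent k w ^^ c) H0 H"
    using attach_pendent_pow_ex[OF assms(1) H0(2,6)] by blast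
  then show ?thesis unfolding U3_2_def using H0 by blast
qed

end

theory Submission
  imports Defs "HOL-Combinatorics.Multiset_Permutations"
begin

text \<open>The spectral radius \<open>\<rho>\<close> is the maximum of \<open>k \<Sum>\<^sub>e \<Prod>\<^sub>v\<^sub>\<in>\<^sub>e x\<^sub>v\<close> over nonnegative \<open>x\<close> with
  \<open>\<Sum>\<^sub>v x\<^sub>v\<^sup>k = 1\<close>. By the AM-GM inequality, a positive labelling \<open>B v e\<close> of the incidences whose sum at
  every vertex is at most \<open>1\<close> and whose product over every edge is at least \<open>1 / r\<close> shows
  \<open>\<rho>\<^sup>k \<le> r\<close>; a labelling that comes from a weighting of the edges and satisfies both conditions with
  equality shows \<open>\<rho>\<^sup>k = r\<close>. In this way \<open>\<rho>\<^sup>k\<close> of the five extremal graphs is a root of an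
  explicit equation; for \<open>U\<^sub>2(m-4,2)\<close> it is the root \<open>r > m\<close> of \<open>(r - m)(r - 2) = 8\<close>.

  For an arbitrary unicyclic graph, an edge that is attached to the rest at a single vertex can be
  contracted into that vertex at the price of a weight there, since \<open>\<Prod>(1 - X\<^sub>v) \<ge> 1 - \<Sum>X\<^sub>v\<close>, and
  so can an edge of a cycle of length at least three. This leaves a weighted cycle with two or three
  edges. A two-edge cycle with weights \<open>A\<close>, \<open>B\<close> at the common vertices and total weight \<open>s\<close> elsewhere
  admits a labelling as soon as \<open>2r(2 + s/(r - s)) \<le> (r - A)(r - B)\<close>, which is strict at the root \<open>r\<close>
  above except for the listed graphs, and hence still holds slightly to the left of \<open>r\<close>.\<close>

section \<open>Variational characterisation of the spectral radius\<close>

text \<open>Strictness in (ii) does not come from uniqueness of a positive eigenvector: the cycle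
  condition is strict at the root r of U2(m-4,2), so it persists for some x < r, and a labelling at
  x gives \<rho>^k \<le> x < r. The price is that contractions are only inequalities. The five
  listed graphs therefore need exact labellings, and a three-edge cycle may contract to parameters
  of a listed graph, where the condition is not strict. This is why contraction of long cycles stops
  at three edges, and why triangles whose weight sits almost entirely at one vertex, or is light at
  every vertex, get explicit labels.

  The bound 2r(2 + s/(r - s)) comes from the requirement r(g1 + g2)^2 \<le> (r - A)(r - B) with gi^2
  = r/(r - si), where si is the weight on the i-th edge off the common vertices, through (g1 + g2)^2
  \<le> 2(g1^2 + g2^2) and superadditivity of s/(r - s). For U2(m-4,2) the exact equation (r - m +
  4)(r - 2) = 4r rearranges to (r - m)(r - 2) = 8.\<close>

definition incident :: "'a hgraph \<Rightarrow> 'a \<Rightarrow> 'a set set" where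
  "incident H v = {e \<in> edges H. v \<in> e}"

text \<open>The form of the adjacency tensor is \<open>k * edge_form H x\<close>: every edge occurs
  once for each choice of its first vertex.\<close>

definition edge_form :: "'a hgraph \<Rightarrow> ('a \<Rightarrow> real) \<Rightarrow> real" where
  "edge_form H x = (\<Sum>e\<in>edges H. \<Prod>v\<in>e. x v)"

lemma kgraphD:
  assumes "kgraph k H"
  shows "finite (verts H)" "finite (edges H)" "verts H \<noteq> {}"
    and "e \<in> edges H \<Longrightarrow> finite e" "e \<in> edges H \<Longrightarrow> e \<subseteq> verts H"
    and "e \<in> edges H \<Longrightarrow> card e = k" "finite (incident H v)"
proof -
  show 1: "finite (verts H)" "verts H \<noteq> {}" using assms by (auto simp: kgraph_def)
  have "edges H \<subseteq> Pow (verts H)" using assms by (auto simp: kgraph_def)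
  then show "finite (edges H)" using 1 finite_subset by blast
  then show "finite (incident H v)" by (auto simp: incident_def)
  show "e \<in> edges H \<Longrightarrow> finite e" using assms 1 finite_subset unfolding kgraph_def by blast
qed (use assms in \<open>auto simp: kgraph_def\<close>)

lemma sum_incidences:
  assumes "kgraph k H"
  shows "(\<Sum>e\<in>edges H. \<Sum>v\<in>e. g v e) = (\<Sum>v\<in>verts H. \<Sum>e\<in>incident H v. g v e)"
proof -
  have "(\<Sum>e\<in>edges H. \<Sum>v\<in>e. g v e) = (\<Sum>e\<in>edges H. \<Sum>v | v \<in> verts H \<and> v \<in> e. g v e)"
    using kgraphD(5)[OF assms] by (intro sum.cong) auto
  also have "\<dots> = (\<Sum>v\<in>verts H. \<Sum>e | e \<in> edges H \<and> v \<in> e. g v e)"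
    by (rule sum.swap_restrict) (use kgraphD[OF assms] in auto)
  finally show ?thesis by (simp add: incident_def)
qed

text \<open>A tuple contributes only if its entries together with \<open>i\<close> form an edge; as
  an edge has \<open>k\<close> elements, the \<open>k - 1\<close> entries must be an arrangement of
  \<open>e - {i}\<close>. There are \<open>(k - 1)!\<close> of these, which cancels the factor in
  the tensor.\<close>

lemma adj_tensor_sum:
  assumes H: "kgraph k H" and i: "i \<in> verts H" and k: "k \<ge> 1"
  shows "(\<Sum>is\<in>tuples (verts H) (k - 1). adj_tensor k H (i # is) * prod_list (map x is)) =
    (\<Sum>e\<in>incident H i. \<Prod>j\<in>e - {i}. x j)"
proof -
  note D = kgraphD[OF H]
  have fin: "finite (tuples (verts H) (k - 1))"
    unfolding tuples_def using finite_lists_length_eq[OF D(1)] by simp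
  let ?S = "\<lambda>e. permutations_of_set (e - {i})"
  have eq: "{is \<in> tuples (verts H) (k - 1). insert i (set is) \<in> edges H} = (\<Union>e\<in>incident H i. ?S e)"
  proof (intro equalityI subsetI)
    fix xs assume xs: "xs \<in> {is \<in> tuples (verts H) (k - 1). insert i (set is) \<in> edges H}"
    then have e: "insert i (set xs) \<in> edges H" and l: "length xs = k - 1" by (auto simp: tuples_def)
    have c: "card (insert i (set xs)) = k" using D(6) e by blast
    have "card (set xs) \<le> k - 1" using l card_length by metis
    then have ni: "i \<notin> set xs" using c k by (auto simp: insert_absorb)
    then have "card (set xs) = length xs" using c l by simp
    then have "distinct xs" by (rule card_distinct)
    then have "xs \<in> ?S (insert i (set xs))" using ni by (auto simp: permutations_of_set_def)
    then show "xs \<in> (\<Union>e\<in>incident H i. ?S e)" using e by (auto simp: incident_def)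
  next
    fix xs assume "xs \<in> (\<Union>e\<in>incident H i. ?S e)"
    then obtain e where e: "e \<in> edges H" "i \<in> e" "set xs = e - {i}" "distinct xs"
      by (auto simp: incident_def permutations_of_set_def)
    have "length xs = card (e - {i})" using e distinct_card by metis
    also have "\<dots> = k - 1" using D(4,6) e by simp
    finally show "xs \<in> {is \<in> tuples (verts H) (k - 1). insert i (set is) \<in> edges H}"
      using e D(5) by (auto simp: tuples_def insert_absorb)
  qed
  have "(\<Sum>is\<in>tuples (verts H) (k - 1). adj_tensor k H (i # is) * prod_list (map x is)) =
    (\<Sum>is\<in>{is \<in> tuples (verts H) (k - 1). insert i (set is) \<in> edges H}.
       1 / fact (k - 1) * prod_list (map x is))"
    using fin by (intro sum.mono_neutral_cong_right) (auto simp: adj_tensor_def)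
  also have "\<dots> = (\<Sum>e\<in>incident H i. \<Sum>is\<in>?S e. 1 / fact (k - 1) * prod_list (map x is))"
    unfolding eq
  proof (rule sum.UNION_disjoint)
    show "finite (incident H i)" using D(7) .
    show "\<forall>e\<in>incident H i. finite (?S e)" by simp
    show "\<forall>e\<in>incident H i. \<forall>f\<in>incident H i. e \<noteq> f \<longrightarrow> ?S e \<inter> ?S f = {}"
      by (auto simp: incident_def permutations_of_set_def)
  qed
  also have "\<dots> = (\<Sum>e\<in>incident H i. \<Prod>j\<in>e - {i}. x j)"
  proof (rule sum.cong[OF refl])
    fix e assume "e \<in> incident H i"
    then have e: "e \<in> edges H" "i \<in> e" by (auto simp: incident_def)
    have "(\<Sum>is\<in>?S e. 1 / fact (k - 1) * prod_list (map x is)) =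
      (\<Sum>is\<in>?S e. 1 / fact (k - 1) * (\<Prod>j\<in>e - {i}. x j))"
      by (intro sum.cong refl) (auto simp: permutations_of_set_def prod.distinct_set_conv_list[symmetric])
    also have "\<dots> = (\<Prod>j\<in>e - {i}. x j)"
      using D(4,6) e by (simp add: card_permutations_of_set)
    finally show "(\<Sum>is\<in>?S e. 1 / fact (k - 1) * prod_list (map x is)) = (\<Prod>j\<in>e - {i}. x j)" .
  qed
  finally show ?thesis .
qed

lemma sum_incident_edge_form:
  assumes "kgraph k H"
  shows "(\<Sum>v\<in>verts H. \<Sum>e\<in>incident H v. \<Prod>j\<in>e. x j) = k * edge_form H x"
proof -
  have "(\<Sum>v\<in>verts H. \<Sum>e\<in>incident H v. \<Prod>j\<in>e. x j) = (\<Sum>e\<in>edges H. \<Sum>v\<in>e. \<Prod>j\<in>e. x j)"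
    using sum_incidences[OF assms, of "\<lambda>v e. \<Prod>j\<in>e. x j"] by simp
  also have "\<dots> = k * edge_form H x"
    using kgraphD(6)[OF assms] by (simp add: edge_form_def sum_distrib_left)
  finally show ?thesis .
qed

text \<open>Multiplying the eigenequation at \<open>i\<close> by \<open>x i\<close>, taking moduli
  and summing over \<open>i\<close> makes the vector of moduli a test vector for the form.\<close>

lemma eigenvalue_le:
  assumes H: "kgraph k H" and k: "k \<ge> 1"
    and L: "\<And>x. (\<And>v. x v \<ge> 0) \<Longrightarrow> k * edge_form H x \<le> L * (\<Sum>v\<in>verts H. x v ^ k)"
    and c: "tensor_eigenvalue k (verts H) (adj_tensor k H) c"
  shows "cmod c \<le> L"
proof -
  note D = kgraphD[OF H]
  obtain x where x: "\<exists>i\<in>verts H. x i \<noteq> 0"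
    and x_eq: "\<forall>i\<in>verts H. (\<Sum>is\<in>tuples (verts H) (k - 1).
      adj_tensor k H (i # is) * prod_list (map x is)) = c * x i ^ (k - 1)"
    using c unfolding tensor_eigenvalue_def by blast
  have eq: "(\<Sum>e\<in>incident H i. \<Prod>j\<in>e - {i}. x j) = c * x i ^ (k - 1)" if "i \<in> verts H" for i
    using adj_tensor_sum[OF H that k, of x] x_eq that by simp
  define y where "y v = cmod (x v)" for v
  have "cmod c * y i ^ k \<le> (\<Sum>e\<in>incident H i. \<Prod>j\<in>e. y j)" if i: "i \<in> verts H" for i
  proof -
    have "cmod c * y i ^ k = cmod (c * x i ^ (k - 1)) * y i"
      using k by (simp add: y_def norm_mult norm_power power_eq_if[of _ k])
    also have "\<dots> \<le> (\<Sum>e\<in>incident H i. \<Prod>j\<in>e - {i}. y j) * y i"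
      unfolding eq[OF i, symmetric]
      by (intro mult_right_mono order.trans[OF norm_sum]) (auto simp: y_def prod_norm)
    also have "\<dots> = (\<Sum>e\<in>incident H i. \<Prod>j\<in>e. y j)"
      unfolding sum_distrib_right
      by (intro sum.cong refl) (use D(4) in \<open>auto simp: incident_def prod.remove mult.commute\<close>)
    finally show ?thesis .
  qed
  then have "(\<Sum>i\<in>verts H. cmod c * y i ^ k) \<le> k * edge_form H y"
    unfolding sum_incident_edge_form[OF H, symmetric] by (rule sum_mono)
  also have "\<dots> \<le> L * (\<Sum>v\<in>verts H. y v ^ k)" by (rule L) (simp add: y_def)
  finally have "cmod c * (\<Sum>v\<in>verts H. y v ^ k) \<le> L * (\<Sum>v\<in>verts H. y v ^ k)"
    by (simp add: sum_distrib_left)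
  moreover have "(\<Sum>v\<in>verts H. y v ^ k) > 0"
  proof -
    obtain i where i: "i \<in> verts H" "x i \<noteq> 0" using x by blast
    show ?thesis by (rule sum_pos2[OF D(1) i(1)]) (use i in \<open>auto simp: y_def\<close>)
  qed
  ultimately show ?thesis by simp
qed

lemma edge_form_upd:
  assumes H: "kgraph k H"
  shows "edge_form H (x(i := s)) =
    s * (\<Sum>e\<in>incident H i. \<Prod>j\<in>e - {i}. x j) + (\<Sum>e\<in>edges H - incident H i. \<Prod>j\<in>e. x j)"
proof -
  note D = kgraphD[OF H]
  have "edge_form H (x(i := s)) = (\<Sum>e\<in>incident H i. \<Prod>v\<in>e. (x(i := s)) v) +
      (\<Sum>e\<in>edges H - incident H i. \<Prod>v\<in>e. (x(i := s)) v)"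
    unfolding edge_form_def using D(2)
    by (subst sum.subset_diff[of "incident H i"]) (auto simp: incident_def)
  also have "(\<Sum>e\<in>incident H i. \<Prod>v\<in>e. (x(i := s)) v) =
      (\<Sum>e\<in>incident H i. s * (\<Prod>j\<in>e - {i}. x j))"
  proof (rule sum.cong[OF refl])
    fix e assume e: "e \<in> incident H i"
    then have "(\<Prod>v\<in>e. (x(i := s)) v) = (x(i := s)) i * (\<Prod>j\<in>e - {i}. (x(i := s)) j)"
      by (intro prod.remove) (use D(4) in \<open>auto simp: incident_def\<close>)
    also have "(\<Prod>j\<in>e - {i}. (x(i := s)) j) = (\<Prod>j\<in>e - {i}. x j)"
      by (intro prod.cong) auto
    finally show "(\<Prod>v\<in>e. (x(i := s)) v) = s * (\<Prod>j\<in>e - {i}. x j)" by simp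
  qed
  also have "(\<Sum>e\<in>edges H - incident H i. \<Prod>v\<in>e. (x(i := s)) v) =
      (\<Sum>e\<in>edges H - incident H i. \<Prod>j\<in>e. x j)"
    by (intro sum.cong prod.cong) (auto simp: incident_def)
  finally show ?thesis by (simp only: sum_distrib_left)
qed

text \<open>One coordinate is varied at a time. Using the homogeneous inequality instead of the
  constraint on the sphere avoids Lagrange multipliers; a vanishing coordinate, which can occur in a
  disconnected graph, needs a one-sided argument.\<close>

lemma maximizer_eigenvalue:
  assumes H: "kgraph k H" and k: "k \<ge> 2"
    and L: "\<And>x. (\<And>v. x v \<ge> 0) \<Longrightarrow> k * edge_form H x \<le> L * (\<Sum>v\<in>verts H. x v ^ k)"
    and x: "\<And>v. x v \<ge> 0" "(\<Sum>v\<in>verts H. x v ^ k) = 1" "k * edge_form H x = L"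
  shows "tensor_eigenvalue k (verts H) (adj_tensor k H) (of_real L)"
proof -
  note D = kgraphD[OF H]
  have eq: "(\<Sum>e\<in>incident H i. \<Prod>j\<in>e - {i}. x j) = L * x i ^ (k - 1)" if i: "i \<in> verts H" for i
  proof -
    define A where "A = (\<Sum>e\<in>incident H i. \<Prod>j\<in>e - {i}. x j)"
    define B where "B = (\<Sum>e\<in>edges H - incident H i. \<Prod>j\<in>e. x j)"
    define S where "S = (\<Sum>v\<in>verts H - {i}. x v ^ k)"
    \<comment> \<open>Defect of the inequality along coordinate \<open>i\<close>: at most 0 for
      \<open>s \<ge> 0\<close>, and 0 at \<open>s = x i\<close>.\<close>
    define f where "f s = k * (s * A + B) - L * (s ^ k + S)" for s
    have sum_upd: "(\<Sum>v\<in>verts H. (x(i := s)) v ^ k) = s ^ k + S" for s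
    proof -
      have "(\<Sum>v\<in>verts H. (x(i := s)) v ^ k) =
          (x(i := s)) i ^ k + (\<Sum>v\<in>verts H - {i}. (x(i := s)) v ^ k)"
        by (rule sum.remove) (use D i in auto)
      also have "(\<Sum>v\<in>verts H - {i}. (x(i := s)) v ^ k) = S"
        unfolding S_def by (intro sum.cong) auto
      finally show ?thesis by simp
    qed
    have f0: "f s \<le> 0" if "s \<ge> 0" for s
    proof -
      have "k * edge_form H (x(i := s)) \<le> L * (\<Sum>v\<in>verts H. (x(i := s)) v ^ k)"
        by (rule L) (use x(1) that in auto)
      then show ?thesis
        unfolding sum_upd edge_form_upd[OF H] f_def A_def B_def by simp
    qed
    have fx: "f (x i) = 0"
      using x(2,3) sum_upd[of "x i"] edge_form_upd[OF H, of x i "x i"]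
      unfolding f_def A_def B_def by simp
    have A0: "A \<ge> 0" unfolding A_def by (intro sum_nonneg prod_nonneg) (use x in auto)
    have "A = L * x i ^ (k - 1)"
    proof (cases "x i = 0")
      case False
      then have xi: "x i > 0" using x(1)[of i] by simp
      have "DERIV f (x i) :> k * A - L * (k * x i ^ (k - 1))"
        unfolding f_def by (auto intro!: derivative_eq_intros)
      moreover have "\<forall>s. \<bar>x i - s\<bar> < x i \<longrightarrow> f s \<le> f (x i)" using f0 fx by auto
      ultimately have "k * A - L * (k * x i ^ (k - 1)) = 0" using DERIV_local_max xi by blast
      then have "k * (A - L * x i ^ (k - 1)) = 0" by (simp add: algebra_simps)
      then show ?thesis using k by simp
    next
      case True
      \<comment> \<open>The constant terms of \<open>f\<close> cancel, so \<open>f s \<le> 0\<close>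
        may be divided by \<open>s\<close>; letting \<open>s\<close> tend to 0 from the right gives
        \<open>A \<le> 0\<close>, hence \<open>A = 0\<close>.\<close>
      have "k * B = L * S" using fx True k by (simp add: f_def)
      then have "k * A \<le> L * s ^ (k - 1)" if "s > 0" for s
      proof -
        have "s * (k * A) \<le> s * (L * s ^ (k - 1))"
          using f0[of s] that \<open>k * B = L * S\<close> k
          by (simp add: f_def algebra_simps power_eq_if[of s k])
        then show ?thesis using that by simp
      qed
      then have ev: "\<forall>\<^sub>F s in at_right 0. k * A \<le> L * s ^ (k - 1)"
        by (auto simp: eventually_at_right_less intro: eventually_mono[OF eventually_at_right_less])
      have "((\<lambda>s. L * s ^ (k - 1)) \<longlongrightarrow> L * 0 ^ (k - 1)) (at_right (0::real))"
        by (intro tendsto_intros)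
      then have "k * A \<le> L * 0 ^ (k - 1)"
        using ev by (rule tendsto_lowerbound) simp
      then have "k * A \<le> 0" using k by (simp add: power_eq_if)
      then have "A = 0" using A0 k by (simp add: mult_le_0_iff)
      then show ?thesis using True k by (simp add: power_eq_if)
    qed
    then show ?thesis by (simp add: A_def)
  qed
  have "\<exists>i\<in>verts H. x i \<noteq> 0"
  proof (rule ccontr)
    assume "\<not> ?thesis"
    then have "(\<Sum>v\<in>verts H. x v ^ k) = 0" using k by simp
    then show False using x(2) by simp
  qed
  moreover have "(\<Sum>e\<in>incident H i. \<Prod>j\<in>e - {i}. complex_of_real (x j)) =
      of_real L * complex_of_real (x i) ^ (k - 1)" if "i \<in> verts H" for i
    using arg_cong[OF eq[OF that], of complex_of_real] by simp
  ultimately show ?thesis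
    unfolding tensor_eigenvalue_def using adj_tensor_sum[OF H] k
    by (intro exI[of _ "\<lambda>v. complex_of_real (x v)"]) auto
qed

lemma edge_form_scale:
  assumes "kgraph k H"
  shows "edge_form H (\<lambda>v. c * x v) = c ^ k * edge_form H x"
  using kgraphD(6)[OF assms] by (simp add: edge_form_def prod.distrib sum_distrib_left)

lemma edge_form_cong:
  assumes "kgraph k H" "\<And>v. v \<in> verts H \<Longrightarrow> x v = y v"
  shows "edge_form H x = edge_form H y"
  unfolding edge_form_def
  by (intro sum.cong prod.cong refl) (use assms kgraphD(5)[OF assms(1)] in blast)

text \<open>Compactness gives a maximiser on the sphere; homogeneity of degree \<open>k\<close> on
  both sides carries the bound to every nonnegative vector.\<close>

lemma edge_form_max_ex:
  assumes H: "kgraph k H" and k: "k \<ge> 1"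
  shows "\<exists>x. (\<forall>v. x v \<ge> 0) \<and> (\<Sum>v\<in>verts H. x v ^ k) = 1 \<and>
    (\<forall>y. (\<forall>v. y v \<ge> 0) \<longrightarrow> edge_form H y \<le> edge_form H x * (\<Sum>v\<in>verts H. y v ^ k))"
proof -
  note D = kgraphD[OF H]
  \<comment> \<open>Coordinates outside the vertex set are pinned to 0, so the box is compact by
    Tychonoff even over an infinite vertex type.\<close>
  define S where "S v = (if v \<in> verts H then {0..1} else {0 :: real})" for v
  define K where "K = PiE UNIV S \<inter> {x. (\<Sum>v\<in>verts H. x v ^ k) = 1}"
  have "compactin (product_topology (\<lambda>v. euclidean) UNIV) (PiE UNIV S)"
    unfolding compactin_PiE by (simp add: S_def)
  then have "compact (PiE UNIV S)" by (simp add: euclidean_product_topology)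
  moreover have "closed {x :: 'a \<Rightarrow> real. (\<Sum>v\<in>verts H. x v ^ k) = 1}"
    by (intro closed_Collect_eq continuous_intros continuous_on_product_coordinates)
  ultimately have cK: "compact K" unfolding K_def by (rule compact_Int_closed)
  obtain v0 where v0: "v0 \<in> verts H" using D by blast
  have "(\<lambda>v. if v = v0 then 1 else 0) \<in> K"
    unfolding K_def S_def using v0 k D(1)
    by (auto simp: PiE_def Pi_def if_distrib[of "\<lambda>z. z ^ k"] power_0_left cong: if_cong)
  moreover have "continuous_on K (edge_form H)"
    unfolding edge_form_def
    by (intro continuous_intros continuous_on_subset[OF continuous_on_product_coordinates]) auto
  ultimately obtain x where x: "x \<in> K" "\<And>y. y \<in> K \<Longrightarrow> edge_form H y \<le> edge_form H x"
    using continuous_attains_sup[OF cK] by blast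
  have x0: "x v \<ge> 0" for v
  proof -
    have "x v \<in> S v" using x(1) by (auto simp: K_def PiE_def Pi_def)
    then show ?thesis by (auto simp: S_def split: if_splits)
  qed
  have "edge_form H y \<le> edge_form H x * (\<Sum>v\<in>verts H. y v ^ k)" if y: "\<forall>v. y v \<ge> 0" for y
  proof (cases "(\<Sum>v\<in>verts H. y v ^ k) = 0")
    case True
    then have "\<forall>v\<in>verts H. y v = 0"
      using y D(1) k by (simp add: sum_nonneg_eq_0_iff)
    then have "edge_form H y = edge_form H (\<lambda>v. 0 * y v)" by (intro edge_form_cong[OF H]) auto
    also have "\<dots> = 0" using k by (simp only: edge_form_scale[OF H]) (simp add: power_0_left)
    finally show ?thesis using True by simp
  next
    case False
    define T where "T = (\<Sum>v\<in>verts H. y v ^ k)"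
    have T: "T > 0" unfolding T_def using False y by (metis less_le sum_nonneg zero_le_power)
    define c where "c = root k T"
    have c: "c > 0" "c ^ k = T" using T k by (auto simp: c_def)
    define z where "z v = (if v \<in> verts H then y v / c else 0)" for v
    have yT: "y v ^ k \<le> T" if "v \<in> verts H" for v
      unfolding T_def by (rule member_le_sum[OF that]) (use y D in auto)
    have "z v \<in> S v" for v
    proof (cases "v \<in> verts H")
      case True
      then have "y v \<le> c" using yT[OF True] c y k
        by (metis less_le power_mono_iff neq0_conv not_one_le_zero)
      then show ?thesis using True y c by (simp add: z_def S_def)
    qed (simp add: z_def S_def)
    moreover have "(\<Sum>v\<in>verts H. z v ^ k) = 1"
    proof -
      have "(\<Sum>v\<in>verts H. z v ^ k) = (\<Sum>v\<in>verts H. y v ^ k / T)"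
        by (intro sum.cong) (auto simp: z_def power_divide c)
      also have "\<dots> = T / T" unfolding T_def by (rule sum_divide_distrib[symmetric])
      finally show ?thesis using T by simp
    qed
    ultimately have "edge_form H z \<le> edge_form H x"
      by (intro x(2)) (auto simp: K_def)
    moreover have "edge_form H y = edge_form H (\<lambda>v. c * z v)"
      by (intro edge_form_cong[OF H]) (use c in \<open>auto simp: z_def\<close>)
    ultimately show ?thesis
      using T by (simp add: edge_form_scale[OF H] c T_def[symmetric] mult.commute)
  qed
  then show ?thesis using x x0 by (intro exI[of _ x]) (auto simp: K_def)
qed

text \<open>The maximum of the form is itself an eigenvalue and bounds the modulus of all others, so
  the \<open>GREATEST\<close> in the definition is attained.\<close>

proposition spectral_radius_variational:
  assumes H: "kgraph k H" and k: "k \<ge> 2"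
  shows "\<exists>x. (\<forall>v. x v \<ge> 0) \<and> (\<Sum>v\<in>verts H. x v ^ k) = 1 \<and> k * edge_form H x = spectral_radius k H"
    and "(\<And>v. y v \<ge> 0) \<Longrightarrow> k * edge_form H y \<le> spectral_radius k H * (\<Sum>v\<in>verts H. y v ^ k)"
proof -
  obtain x where x: "\<forall>v. x v \<ge> 0" "(\<Sum>v\<in>verts H. x v ^ k) = 1"
    "\<And>y. (\<forall>v. y v \<ge> 0) \<Longrightarrow> edge_form H y \<le> edge_form H x * (\<Sum>v\<in>verts H. y v ^ k)"
    using edge_form_max_ex[OF H] k by (metis One_nat_def Suc_1 Suc_leD)
  define L where "L = k * edge_form H x"
  have L: "k * edge_form H y \<le> L * (\<Sum>v\<in>verts H. y v ^ k)" if "\<And>v. y v \<ge> 0" for y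
    using x(3)[of y] that by (simp add: L_def mult.assoc mult_left_mono)
  have L0: "L \<ge> 0" unfolding L_def edge_form_def
    by (intro mult_nonneg_nonneg sum_nonneg prod_nonneg) (use x in auto)
  have "tensor_eigenvalue k (verts H) (adj_tensor k H) (of_real L)"
    by (rule maximizer_eigenvalue[OF H k L, of x]) (use x L_def in auto)
  then have "L \<in> cmod ` {c. tensor_eigenvalue k (verts H) (adj_tensor k H) c}"
    using L0 by (intro image_eqI[of _ _ "of_real L"]) auto
  then have "spectral_radius k H = L"
    unfolding spectral_radius_def
    by (rule Greatest_equality) (use eigenvalue_le[OF H _ L] k in auto)
  then show "\<exists>x. (\<forall>v. x v \<ge> 0) \<and> (\<Sum>v\<in>verts H. x v ^ k) = 1 \<and> k * edge_form H x = spectral_radius k H"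
    "(\<And>v. y v \<ge> 0) \<Longrightarrow> k * edge_form H y \<le> spectral_radius k H * (\<Sum>v\<in>verts H. y v ^ k)"
    using x L by (auto simp: L_def)
qed

section \<open>Incidence labellings\<close>

text \<open>For \<open>t = 0\<close> this is an \<open>\<alpha>\<close>-subnormal labelling with \<open>\<alpha> = 1 / r\<close>. The weight \<open>t v\<close> reserves
  room for \<open>t v\<close> further edges at \<open>v\<close>: a pendent edge at \<open>v\<close> is labelled \<open>1 / r\<close> there.\<close>

definition feasible :: "real \<Rightarrow> 'a hgraph \<Rightarrow> ('a \<Rightarrow> real) \<Rightarrow> bool" where
  "feasible r H t \<longleftrightarrow> (\<exists>B. (\<forall>e\<in>edges H. (\<forall>v\<in>e. 0 < B v e) \<and> 1 / r \<le> (\<Prod>v\<in>e. B v e)) \<and>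
     (\<forall>v\<in>verts H. (\<Sum>e\<in>incident H v. B v e) + t v / r \<le> 1))"

text \<open>Here \<open>X v\<close> is the \<open>k\<close>-th power of the entry at \<open>v\<close> of a positive eigenvector, and \<open>Y e / X v\<close>
  is the label of the incidence of \<open>v\<close> and \<open>e\<close>.\<close>

definition normal :: "real \<Rightarrow> nat \<Rightarrow> 'a hgraph \<Rightarrow> ('a \<Rightarrow> real) \<Rightarrow> bool" where
  "normal r k H t \<longleftrightarrow> (\<exists>X Y. (\<forall>v\<in>verts H. 0 < X v \<and> X v * (1 - t v / r) = (\<Sum>e\<in>incident H v. Y e)) \<and>
     (\<forall>e\<in>edges H. 0 < Y e \<and> (\<Prod>v\<in>e. X v) = r * Y e ^ k))"

text \<open>AM-GM on each edge for the numbers \<open>B v e * x v ^ k\<close>: the product condition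
  supplies the factor \<open>1 / r\<close>, and after exchanging the two sums the vertex condition
  bounds the total coefficient of \<open>x v ^ k\<close> by 1.\<close>

lemma spectral_radius_le:
  assumes H: "kgraph k H" and k: "k \<ge> 2" and r: "r > 0" and f: "feasible r H (\<lambda>_. 0)"
  shows "spectral_radius k H \<le> root k r"
proof -
  note D = kgraphD[OF H]
  obtain B where B: "\<And>e v. e \<in> edges H \<Longrightarrow> v \<in> e \<Longrightarrow> 0 < B v e"
    "\<And>e. e \<in> edges H \<Longrightarrow> 1 / r \<le> (\<Prod>v\<in>e. B v e)"
    "\<And>v. v \<in> verts H \<Longrightarrow> (\<Sum>e\<in>incident H v. B v e) \<le> 1"
    using f unfolding feasible_def by auto
  define L where "L = root k r"
  have L: "L > 0" "L ^ k = r" using k r by (auto simp: L_def)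
  obtain x where x: "\<forall>v. x v \<ge> 0" "(\<Sum>v\<in>verts H. x v ^ k) = 1"
    "k * edge_form H x = spectral_radius k H"
    using spectral_radius_variational(1)[OF H k] by blast
  have e: "k * (\<Prod>v\<in>e. x v) \<le> L * (\<Sum>v\<in>e. B v e * x v ^ k)" if e: "e \<in> edges H" for e
  proof -
    define z where "z v = B v e * x v ^ k" for v
    have z: "z v \<ge> 0" if "v \<in> e" for v
      using B(1)[OF e that] x by (simp add: z_def)
    have ne: "e \<noteq> {}" using D(6)[OF e] k by auto
    have "((\<Prod>v\<in>e. x v) / L) ^ k = (1 / r) * (\<Prod>v\<in>e. x v ^ k)"
      by (simp add: power_divide L prod_power_distrib)
    also have "\<dots> \<le> (\<Prod>v\<in>e. B v e) * (\<Prod>v\<in>e. x v ^ k)"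
      by (intro mult_right_mono B e prod_nonneg) (use x in auto)
    also have "\<dots> = (\<Prod>v\<in>e. z v)" by (simp add: z_def prod.distrib)
    finally have le: "((\<Prod>v\<in>e. x v) / L) ^ k \<le> (\<Prod>v\<in>e. z v)" .
    have p0: "(\<Prod>v\<in>e. x v) / L \<ge> 0" using x L by (simp add: prod_nonneg)
    have "(\<Prod>v\<in>e. x v) / L = root k (((\<Prod>v\<in>e. x v) / L) ^ k)"
      using k p0 by (simp add: real_root_power_cancel)
    also have "\<dots> \<le> root k (\<Prod>v\<in>e. z v)" using le k by simp
    also have "\<dots> = (\<Prod>v\<in>e. z v) powr (1 / card e)"
      unfolding D(6)[OF e] by (rule root_powr_inverse) (use k z in \<open>auto intro: prod_nonneg\<close>)
    also have "\<dots> \<le> (\<Sum>v\<in>e. z v / card e)" by (rule arith_geom_mean[OF D(4)[OF e] ne z])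
    also have "\<dots> = (\<Sum>v\<in>e. z v) / k" using D(6)[OF e] by (simp add: sum_divide_distrib)
    finally show ?thesis using L k by (simp add: field_simps z_def)
  qed
  have "spectral_radius k H = (\<Sum>e\<in>edges H. k * (\<Prod>v\<in>e. x v))"
    using x(3) by (simp add: edge_form_def sum_distrib_left)
  also have "\<dots> \<le> (\<Sum>e\<in>edges H. L * (\<Sum>v\<in>e. B v e * x v ^ k))" by (intro sum_mono e)
  also have "\<dots> = L * (\<Sum>v\<in>verts H. \<Sum>e\<in>incident H v. B v e * x v ^ k)"
    by (simp add: sum_distrib_left[symmetric] sum_incidences[OF H])
  also have "\<dots> = L * (\<Sum>v\<in>verts H. (\<Sum>e\<in>incident H v. B v e) * x v ^ k)"
    by (simp add: sum_distrib_right)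
  also have "\<dots> \<le> L * (\<Sum>v\<in>verts H. 1 * x v ^ k)"
    by (intro mult_left_mono sum_mono mult_right_mono B) (use x L in auto)
  finally show ?thesis using x(2) by (simp add: L_def)
qed

text \<open>Upper bound: the labels \<open>Y e / X v\<close> meet both feasibility conditions with
  equality. Lower bound: on the \<open>k\<close>-th roots of \<open>X\<close> the quotient of the
  form by the sum of \<open>k\<close>-th powers is \<open>root k r\<close>.\<close>

lemma spectral_radius_eq:
  assumes H: "kgraph k H" and k: "k \<ge> 2" and r: "r > 0" and n: "normal r k H (\<lambda>_. 0)"
  shows "spectral_radius k H = root k r"
proof -
  note D = kgraphD[OF H]
  obtain X Y where XY: "\<forall>v\<in>verts H. 0 < X v \<and> X v * (1 - 0 / r) = (\<Sum>e\<in>incident H v. Y e)"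
    "\<forall>e\<in>edges H. 0 < Y e \<and> (\<Prod>v\<in>e. X v) = r * Y e ^ k"
    using n unfolding normal_def by blast
  have X: "0 < X v" "(\<Sum>e\<in>incident H v. Y e) = X v" if "v \<in> verts H" for v
    using bspec[OF XY(1) that] by auto
  have Y: "0 < Y e" "(\<Prod>v\<in>e. X v) = r * Y e ^ k" if "e \<in> edges H" for e
    using XY(2) that by auto
  have "feasible r H (\<lambda>_. 0)"
    unfolding feasible_def
  proof (intro exI[of _ "\<lambda>v e. Y e / X v"] conjI ballI)
    fix e assume e: "e \<in> edges H"
    show "0 < Y e / X v" if "v \<in> e" for v using e that X(1) Y(1) D(5) by (meson divide_pos_pos subsetD)
    have "(\<Prod>v\<in>e. Y e / X v) = 1 / r"
      using Y(1)[OF e] Y(2)[OF e] D(6)[OF e] by (simp add: prod_dividef)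
    then show "1 / r \<le> (\<Prod>v\<in>e. Y e / X v)" by simp
  next
    fix v assume v: "v \<in> verts H"
    then show "(\<Sum>e\<in>incident H v. Y e / X v) + 0 / r \<le> 1"
      using X[OF v] by (simp add: sum_divide_distrib[symmetric])
  qed
  then have le: "spectral_radius k H \<le> root k r" by (rule spectral_radius_le[OF H k r])
  define x where "x v = (if v \<in> verts H then root k (X v) else 0)" for v
  have x0: "x v \<ge> 0" for v using X(1)[of v] k by (auto simp: x_def less_imp_le)
  have "(\<Prod>v\<in>e. x v) = root k r * Y e" if e: "e \<in> edges H" for e
  proof -
    have "(\<Prod>v\<in>e. x v) ^ k = (\<Prod>v\<in>e. X v)"
      unfolding prod_power_distrib
      by (intro prod.cong refl) (use k D(5)[OF e] X(1) in \<open>auto simp: x_def less_imp_le\<close>)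
    also have "\<dots> = (root k r * Y e) ^ k"
      using Y(2)[OF e] k r by (simp add: power_mult_distrib)
    finally show ?thesis
      by (rule power_eq_imp_eq_base) (use x0 Y(1)[OF e] r k in \<open>auto simp: prod_nonneg less_imp_le\<close>)
  qed
  then have "k * edge_form H x = (\<Sum>e\<in>edges H. \<Sum>v\<in>e. root k r * Y e)"
    using D(6) by (simp add: edge_form_def sum_distrib_left)
  also have "\<dots> = root k r * (\<Sum>v\<in>verts H. X v)"
    unfolding sum_incidences[OF H, of "\<lambda>v e. root k r * Y e"]
    by (simp add: sum_distrib_left[symmetric] X(2))
  also have "(\<Sum>v\<in>verts H. X v) = (\<Sum>v\<in>verts H. x v ^ k)"
    using X(1) k by (intro sum.cong) (auto simp: x_def less_imp_le)
  finally have "root k r * (\<Sum>v\<in>verts H. x v ^ k) \<le> spectral_radius k H * (\<Sum>v\<in>verts H. x v ^ k)"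
    using spectral_radius_variational(2)[OF H k, of x] x0 by simp
  moreover have "(\<Sum>v\<in>verts H. x v ^ k) > 0"
    using D X(1) k by (intro sum_pos) (auto simp: x_def)
  ultimately have "root k r \<le> spectral_radius k H" by simp
  then show ?thesis using le by simp
qed

lemma feasible_mono:
  assumes "feasible r H t'" "r > 0" "\<And>v. v \<in> verts H \<Longrightarrow> t v \<le> t' v"
  shows "feasible r H t"
proof -
  obtain B where "\<forall>e\<in>edges H. (\<forall>v\<in>e. 0 < B v e) \<and> 1 / r \<le> (\<Prod>v\<in>e. B v e)"
    and B: "\<forall>v\<in>verts H. (\<Sum>e\<in>incident H v. B v e) + t' v / r \<le> 1"
    using assms(1) unfolding feasible_def by blast
  moreover have "(\<Sum>e\<in>incident H v. B v e) + t v / r \<le> 1" if "v \<in> verts H" for v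
    using B that divide_right_mono[OF assms(3)[OF that], of r] assms(2) by fastforce
  ultimately show ?thesis unfolding feasible_def by blast
qed

text \<open>Weierstrass product inequality; it makes the loss at an edge depend only on the sum of
  the weights there.\<close>

lemma prod_one_minus_ge:
  fixes x :: "'a \<Rightarrow> real"
  assumes "finite S" "\<And>i. i \<in> S \<Longrightarrow> 0 \<le> x i" "\<And>i. i \<in> S \<Longrightarrow> x i \<le> 1"
  shows "1 - (\<Sum>i\<in>S. x i) \<le> (\<Prod>i\<in>S. 1 - x i)"
  using assms
proof (induction S rule: finite_induct)
  case (insert a S)
  have "0 \<le> (\<Sum>i\<in>S. x i)" "0 \<le> x a" "x a \<le> 1" using insert by (auto intro: sum_nonneg)
  then have "1 - (\<Sum>i\<in>insert a S. x i) \<le> (1 - x a) * (1 - (\<Sum>i\<in>S. x i))"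
    using insert by (simp add: algebra_simps)
  also have "\<dots> \<le> (1 - x a) * (\<Prod>i\<in>S. 1 - x i)"
    using insert \<open>x a \<le> 1\<close> by (intro mult_left_mono) auto
  finally show ?case using insert by simp
qed simp

section \<open>Passing a labelling across one pendent edge\<close>

locale pendent_edge =
  fixes k :: nat and H H' :: "'a hgraph" and x :: 'a and N :: "'a set"
  assumes kgraph: "kgraph k H" and k: "k \<ge> 2" and x: "x \<in> verts H"
    and N: "finite N" "card N = k - 1" "N \<inter> verts H = {}"
    and H': "H' = (verts H \<union> N, insert (insert x N) (edges H))"
begin

lemma not_edge: "insert x N \<notin> edges H" and N_nonempty: "N \<noteq> {}" and x_notin: "x \<notin> N"
proof -
  show ne: "N \<noteq> {}" using N k by auto
  show "x \<notin> N" using N x by auto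
  show "insert x N \<notin> edges H" using ne N kgraphD(5)[OF kgraph, of "insert x N"] by blast
qed

lemma kgraph': "kgraph k H'"
  using kgraph x N k x_notin unfolding kgraph_def H' by auto

lemma card_edges': "card (edges H') = Suc (card (edges H))"
  using not_edge kgraphD(2)[OF kgraph] by (simp add: H')

lemma incident':
  assumes "v \<in> verts H \<union> N"
  shows "incident H' v = (if v \<in> N then {insert x N} else
    if v = x then insert (insert x N) (incident H x) else incident H v)"
  using assms N x kgraphD(5)[OF kgraph] unfolding incident_def H' by auto

lemma not_incident: "insert x N \<notin> incident H v"
  using not_edge by (auto simp: incident_def)

text \<open>A new vertex \<open>v\<close> gives all its remaining capacity
  \<open>1 - t v / r\<close> to the new edge and \<open>x\<close> gives \<open>1 / (r - S)\<close>,
  with \<open>S\<close> the weight on \<open>N\<close>; the product is then at least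
  \<open>(1 - S / r) / (r - S) = 1 / r\<close>. In units of \<open>1 / r\<close> the edge costs
  \<open>x\<close> exactly \<open>r / (r - S)\<close>.\<close>

lemma feasible_attach:
  assumes r: "r > 0" and t: "\<And>v. v \<in> N \<Longrightarrow> 0 \<le> t v" and S: "(\<Sum>v\<in>N. t v) < r"
    and f: "feasible r H (t(x := t x + r / (r - (\<Sum>v\<in>N. t v))))"
  shows "feasible r H' t"
proof -
  note D = kgraphD[OF kgraph]
  define S where "S = (\<Sum>v\<in>N. t v)"
  have S0: "0 \<le> S" "S < r" using t S by (auto simp: S_def sum_nonneg)
  have tS: "t v \<le> S" if "v \<in> N" for v
    unfolding S_def using t N that by (intro member_le_sum) auto
  obtain B where B: "\<And>e v. e \<in> edges H \<Longrightarrow> v \<in> e \<Longrightarrow> 0 < B v e"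
    "\<And>e. e \<in> edges H \<Longrightarrow> 1 / r \<le> (\<Prod>v\<in>e. B v e)"
    "\<And>v. v \<in> verts H \<Longrightarrow> (\<Sum>e\<in>incident H v. B v e) + (t(x := t x + r / (r - S))) v / r \<le> 1"
    using f unfolding feasible_def S_def by blast
  define B' where "B' v e = (if e = insert x N then if v = x then 1 / (r - S) else 1 - t v / r
     else B v e)" for v e
  have B'N: "B' v (insert x N) = 1 - t v / r" if "v \<in> N" for v
    using that x_notin by (auto simp: B'_def)
  have B'x: "B' x (insert x N) = 1 / (r - S)" by (simp add: B'_def)
  have B'e: "B' v e = B v e" if "e \<in> edges H" for v e using that not_edge by (auto simp: B'_def)
  have B's: "(\<Sum>e\<in>incident H v. B' v e) = (\<Sum>e\<in>incident H v. B v e)" for v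
    by (intro sum.cong) (auto simp: incident_def B'e)
  show ?thesis
    unfolding feasible_def
  proof (intro exI[of _ B'] conjI ballI)
    fix e assume e: "e \<in> edges H'"
    show "0 < B' v e" if v: "v \<in> e" for v
    proof (cases "e = insert x N")
      case True
      then show ?thesis using v S0 r tS[of v] B'N[of v] B'x by (cases "v = x") auto
    next
      case False
      then show ?thesis using e v B(1) B'e by (auto simp: H')
    qed
    show "1 / r \<le> (\<Prod>v\<in>e. B' v e)"
    proof (cases "e = insert x N")
      case True
      have "1 - (\<Sum>v\<in>N. t v / r) \<le> (\<Prod>v\<in>N. 1 - t v / r)"
        using N t tS S0 r by (intro prod_one_minus_ge) (auto intro: order_trans[OF tS])
      then have "1 - S / r \<le> (\<Prod>v\<in>N. 1 - t v / r)" by (simp add: S_def sum_divide_distrib)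
      then have "1 / (r - S) * (1 - S / r) \<le> 1 / (r - S) * (\<Prod>v\<in>N. 1 - t v / r)"
        using S0 by (intro mult_left_mono) auto
      moreover have "1 / (r - S) * (1 - S / r) = 1 / r" using S0 r by (simp add: field_simps)
      moreover have "(\<Prod>v\<in>e. B' v e) = 1 / (r - S) * (\<Prod>v\<in>N. 1 - t v / r)"
        using True N x_notin by (simp add: B'x B'N)
      ultimately show ?thesis by simp
    next
      case False
      then show ?thesis using e B(2) B'e by (auto simp: H')
    qed
  next
    fix v assume v: "v \<in> verts H'"
    then have v': "v \<in> verts H \<union> N" by (simp add: H')
    consider "v \<in> N" | "v = x" | "v \<in> verts H" "v \<noteq> x" "v \<notin> N" using v by (auto simp: H')
    then show "(\<Sum>e\<in>incident H' v. B' v e) + t v / r \<le> 1"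
    proof cases
      case 1
      then show ?thesis using incident'[OF v'] B'N by simp
    next
      case 2
      have "(\<Sum>e\<in>incident H' v. B' v e) = 1 / (r - S) + (\<Sum>e\<in>incident H x. B x e)"
        using 2 incident'[OF v'] x_notin not_incident D(7) by (simp add: B'x B's)
      then show ?thesis using B(3)[OF x] 2 r S0 by (simp add: add_divide_distrib)
    next
      case 3
      then show ?thesis using incident'[OF v'] B(3)[of v] by (simp add: B's)
    qed
  qed
qed

text \<open>The cruder cost \<open>1 + S\<close> counts the edge and everything hanging on it. It
  dominates \<open>r / (r - S)\<close> because \<open>S + 1 \<le> r\<close>, and that bound is read
  off the vertex condition at \<open>x\<close>.\<close>

lemma feasible_attach_contract:
  assumes r: "r > 0" and t: "\<And>v. v \<in> verts H' \<Longrightarrow> 0 \<le> t v"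
    and f: "feasible r H (t(x := t x + 1 + (\<Sum>v\<in>N. t v)))"
  shows "feasible r H' t"
proof -
  define S where "S = (\<Sum>v\<in>N. t v)"
  have S0: "S \<ge> 0" unfolding S_def using t by (intro sum_nonneg) (auto simp: H')
  obtain B where B: "\<And>e v. e \<in> edges H \<Longrightarrow> v \<in> e \<Longrightarrow> 0 < B v e"
    "(\<Sum>e\<in>incident H x. B x e) + (t x + 1 + S) / r \<le> 1"
    using f x unfolding feasible_def S_def by fastforce
  have "(\<Sum>e\<in>incident H x. B x e) \<ge> 0"
    by (intro sum_nonneg less_imp_le B) (auto simp: incident_def)
  then have "(t x + 1 + S) / r \<le> 1" using B by linarith
  then have Sr: "1 + S \<le> r" using r t[of x] x by (auto simp: H' field_simps)
  then have "0 \<le> S * (r - 1 - S)" using S0 by simp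
  then have "r / (r - S) \<le> 1 + S" using Sr by (simp add: field_simps)
  then have "feasible r H (t(x := t x + r / (r - S)))"
    by (intro feasible_mono[OF f r]) (auto simp: S_def[symmetric])
  then show ?thesis
    using feasible_attach[OF r, of t] t Sr unfolding S_def H' by auto
qed

text \<open>Exact counterpart of \<open>feasible_attach\<close>: the vertex equation at a new vertex
  forces \<open>X v = y * (r / (r - t v))\<close>, where \<open>y\<close> is the weight of the new
  edge, and the edge equation then fixes \<open>y\<close> in terms of \<open>X x\<close>.\<close>

lemma normal_attach:
  assumes r: "r > 0" and t: "\<And>v. v \<in> N \<Longrightarrow> t v < r"
    and n: "normal r k H (t(x := t x + (\<Prod>v\<in>N. r / (r - t v))))"
  shows "normal r k H' t"
proof -
  note D = kgraphD[OF kgraph]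
  define P where "P = (\<Prod>v\<in>N. r / (r - t v))"
  have P: "P > 0" unfolding P_def using t r by (intro prod_pos) auto
  obtain X Y where X: "\<And>v. v \<in> verts H \<Longrightarrow> 0 < X v"
    "\<And>v. v \<in> verts H \<Longrightarrow> X v * (1 - (t(x := t x + P)) v / r) = (\<Sum>e\<in>incident H v. Y e)"
    and Y: "\<And>e. e \<in> edges H \<Longrightarrow> 0 < Y e" "\<And>e. e \<in> edges H \<Longrightarrow> (\<Prod>v\<in>e. X v) = r * Y e ^ k"
    using n unfolding normal_def P_def[symmetric] by metis
  define y where "y = X x * P / r"
  have y: "y > 0" using X(1)[OF x] P r by (simp add: y_def)
  define X' where "X' v = (if v \<in> N then y * (r / (r - t v)) else X v)" for v
  define Y' where "Y' e = (if e = insert x N then y else Y e)" for e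
  have Ys: "(\<Sum>e\<in>incident H v. Y' e) = (\<Sum>e\<in>incident H v. Y e)" for v
    using not_incident by (intro sum.cong) (auto simp: Y'_def)
  show ?thesis
    unfolding normal_def
  proof (intro exI[of _ X'] exI[of _ Y'] conjI ballI)
    fix v assume v: "v \<in> verts H'"
    then have v': "v \<in> verts H \<union> N" by (simp add: H')
    consider "v \<in> N" | "v = x" | "v \<in> verts H" "v \<noteq> x" "v \<notin> N" using v by (auto simp: H')
    note cases = this
    show "0 < X' v" using cases X(1) y r t x by cases (auto simp: X'_def)
    show "X' v * (1 - t v / r) = (\<Sum>e\<in>incident H' v. Y' e)"
      using cases
    proof cases
      case 1
      have "X' v * (1 - t v / r) = y * (r / (r - t v) * (1 - t v / r))" using 1 by (simp add: X'_def)
      also have "r / (r - t v) * (1 - t v / r) = 1" using t[OF 1] r by (simp add: field_simps)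
      finally show ?thesis using 1 incident'[OF v'] by (simp add: Y'_def)
    next
      case 2
      have "(\<Sum>e\<in>incident H' v. Y' e) = y + (\<Sum>e\<in>incident H x. Y e)"
        using 2 incident'[OF v'] x_notin not_incident D(7) by (simp add: Ys) (simp add: Y'_def)
      also have "\<dots> = X x * (1 - t x / r)"
        using X(2)[OF x] r by (simp add: y_def field_simps)
      finally show ?thesis using 2 x_notin by (simp add: X'_def)
    next
      case 3
      then show ?thesis using incident'[OF v'] X(2)[of v] by (simp add: Ys X'_def)
    qed
  next
    fix e assume e: "e \<in> edges H'"
    show "0 < Y' e" using e y Y(1) by (auto simp: Y'_def H')
    show "(\<Prod>v\<in>e. X' v) = r * Y' e ^ k"
    proof (cases "e = insert x N")
      case True
      have "(\<Prod>v\<in>e. X' v) = X x * (\<Prod>v\<in>N. y * (r / (r - t v)))"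
        using True N x_notin by (simp add: X'_def)
      also have "\<dots> = X x * P * y ^ (k - 1)"
        by (simp only: prod.distrib P_def prod_constant N) (simp add: mult_ac)
      also have "\<dots> = r * y ^ k" using r k by (simp add: y_def power_eq_if[of _ k])
      finally show ?thesis using True by (simp add: Y'_def)
    next
      case False
      then have eH: "e \<in> edges H" using e by (auto simp: H')
      have "(\<Prod>v\<in>e. X' v) = (\<Prod>v\<in>e. X v)"
        using D(5)[OF eH] N by (intro prod.cong) (auto simp: X'_def)
      then show ?thesis using Y(2)[OF eH] False by (simp add: Y'_def)
    qed
  qed
qed

end

section \<open>Attaching pendent edges\<close>

lemma attach_pendentE:
  assumes "attach_pendent k x H H'" "kgraph k H" "k \<ge> 2"
  obtains N where "pendent_edge k H H' x N"
proof -
  obtain N where "finite N" "card N = k - 1" "N \<inter> verts H = {}" "x \<in> verts H"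
    "H' = (verts H \<union> N, insert (insert x N) (edges H))"
    using assms(1) unfolding attach_pendent_def by blast
  then have "pendent_edge k H H' x N" using assms(2,3) by unfold_locales
  then show thesis by (rule that)
qed

lemma attach_pendent_pow:
  assumes "kgraph k H" "k \<ge> 2" "(attach_pendent k x ^^ a) H H'"
  shows "kgraph k H'" "verts H \<subseteq> verts H'" "edges H \<subseteq> edges H'"
    "card (edges H') = card (edges H) + a"
    "w \<in> verts H' - verts H \<Longrightarrow> \<exists>f\<in>edges H' - edges H. x \<in> f \<and> w \<in> f"
proof -
  have "kgraph k H' \<and> verts H \<subseteq> verts H' \<and> edges H \<subseteq> edges H' \<and>
    card (edges H') = card (edges H) + a \<and>
    (\<forall>w\<in>verts H' - verts H. \<exists>f\<in>edges H' - edges H. x \<in> f \<and> w \<in> f)"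
    using assms(3)
  proof (induction a arbitrary: H')
    case 0
    then show ?case using assms by auto
  next
    case (Suc a)
    then obtain H1 where H1: "(attach_pendent k x ^^ a) H H1" "attach_pendent k x H1 H'" by auto
    note IH = Suc.IH[OF H1(1)]
    obtain N where "pendent_edge k H1 H' x N" using attach_pendentE[OF H1(2)] IH assms(2) by blast
    then interpret pendent_edge k H1 H' x N .
    have sub: "edges H' = insert (insert x N) (edges H1)" "verts H' = verts H1 \<union> N" by (auto simp: H')
    have "\<exists>f\<in>edges H' - edges H. x \<in> f \<and> w \<in> f" if "w \<in> verts H' - verts H" for w
    proof (cases "w \<in> N")
      case True
      then have "insert x N \<in> edges H' - edges H" "x \<in> insert x N" "w \<in> insert x N"
        using not_edge IH by (auto simp: sub)
      then show ?thesis by blast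
    next
      case False
      then have "w \<in> verts H1 - verts H" using that sub by auto
      then show ?thesis using IH sub by blast
    qed
    moreover have "card (edges H') = card (edges H) + Suc a" using IH card_edges' by simp
    moreover have "verts H \<subseteq> verts H'" "edges H \<subseteq> edges H'" using IH sub by auto
    ultimately show ?case using kgraph' by blast
  qed
  then show "kgraph k H'" "verts H \<subseteq> verts H'" "edges H \<subseteq> edges H'"
    "card (edges H') = card (edges H) + a"
    "w \<in> verts H' - verts H \<Longrightarrow> \<exists>f\<in>edges H' - edges H. x \<in> f \<and> w \<in> f" by blast+
qed

lemma normal_cong:
  assumes "normal r k H t" "\<And>v. v \<in> verts H \<Longrightarrow> t v = t' v"
  shows "normal r k H t'"
proof -
  have "normal r k H t = normal r k H t'"
    unfolding normal_def using assms(2) by (intro ex_cong1 conj_cong ball_cong refl) auto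
  then show ?thesis using assms(1) by simp
qed

lemma normal_attach_pow:
  fixes t :: "'a \<Rightarrow> real"
  assumes "kgraph k H" "k \<ge> 2" "r > 0" "x \<in> verts H" "(attach_pendent k x ^^ a) H H'"
    and "\<And>v. v \<in> verts H' - verts H \<Longrightarrow> t v = 0"
    and "normal r k H (t(x := t x + a))"
  shows "normal r k H' t"
  using assms(5-7)
proof (induction a arbitrary: H' t)
  case 0
  then show ?case by auto
next
  case (Suc a)
  then obtain H1 where H1: "(attach_pendent k x ^^ a) H H1" "attach_pendent k x H1 H'" by auto
  note P = attach_pendent_pow[OF assms(1,2) H1(1)]
  obtain N where "pendent_edge k H1 H' x N" using attach_pendentE[OF H1(2) P(1) assms(2)] .
  then interpret pendent_edge k H1 H' x N .
  have t0: "t v = 0" if "v \<in> N" for v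
    by (rule Suc.prems(2)) (use that P(2) N in \<open>auto simp: H'\<close>)
  have "normal r k H1 (t(x := t x + 1))"
  proof (rule Suc.IH[OF H1(1)])
    show "(t(x := t x + 1)) v = 0" if "v \<in> verts H1 - verts H" for v
      using that assms(4) Suc.prems(2) by (auto simp: H')
    show "normal r k H ((t(x := t x + 1))(x := (t(x := t x + 1)) x + a))"
      by (rule normal_cong[OF Suc.prems(3)]) (auto simp: algebra_simps)
  qed
  then show ?case using assms(3) by (intro normal_attach) (auto simp: t0)
qed

text \<open>Of the \<open>a\<close> new edges, the one through \<open>w\<close> costs
  \<open>r / (r - 1)\<close> and each other one costs 1. The real difference
  \<open>real a - 1\<close> is harmless at \<open>a = 0\<close>, where no new vertex
  \<open>w\<close> exists.\<close>

lemma normal_attach_pow_weighted: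
  fixes t :: "'a \<Rightarrow> real"
  assumes "kgraph k H" "k \<ge> 2" "r > 1" "x \<in> verts H" "(attach_pendent k x ^^ a) H H'"
    and "\<And>v. v \<in> verts H' - verts H \<Longrightarrow> t v = 0" "w \<in> verts H' - verts H"
    and "normal r k H (t(x := t x + (real a - 1) + r / (r - 1)))"
  shows "normal r k H' (t(w := 1))"
  using assms(5-8)
proof (induction a arbitrary: H' t)
  case 0
  then show ?case by auto
next
  case (Suc a H' t)
  then obtain H1 where H1: "(attach_pendent k x ^^ a) H H1" "attach_pendent k x H1 H'"
    by (metis relpowp_Suc_E)
  note P = attach_pendent_pow[OF assms(1,2) H1(1)]
  obtain N where "pendent_edge k H1 H' x N" using attach_pendentE[OF H1(2) P(1) assms(2)] .
  then interpret pendent_edge k H1 H' x N .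
  have t0: "t v = 0" if "v \<in> N" for v
    by (rule Suc.prems(2)) (use that P(2) N in \<open>auto simp: H'\<close>)
  show ?case
  proof (cases "w \<in> N")
    case True
    then have w: "w \<noteq> x" "w \<notin> verts H1" using x_notin N by auto
    have "(\<Prod>v\<in>N. r / (r - (t(w := 1)) v)) = (\<Prod>v\<in>N. if v = w then r / (r - 1) else 1)"
      using t0 assms(3) by (intro prod.cong) auto
    also have "\<dots> = r / (r - 1)" using True N by simp
    finally have P': "(\<Prod>v\<in>N. r / (r - (t(w := 1)) v)) = r / (r - 1)" .
    have "normal r k H1 (t(x := t x + r / (r - 1)))"
    proof (rule normal_attach_pow[OF assms(1,2) _ assms(4) H1(1)])
      show "(t(x := t x + r / (r - 1))) v = 0" if "v \<in> verts H1 - verts H" for v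
        using that assms(4) Suc.prems(2) by (auto simp: H')
      show "normal r k H ((t(x := t x + r / (r - 1)))(x := (t(x := t x + r / (r - 1))) x + a))"
        by (rule normal_cong[OF Suc.prems(4)]) (auto simp: algebra_simps)
    qed (use assms in auto)
    then have n: "normal r k H1 ((t(w := 1))(x := (t(w := 1)) x + r / (r - 1)))"
      by (rule normal_cong) (use w in auto)
    show ?thesis
    proof (rule normal_attach)
      show "normal r k H1 ((t(w := 1))(x := (t(w := 1)) x + (\<Prod>v\<in>N. r / (r - (t(w := 1)) v))))"
        unfolding P' by (rule n)
    qed (use assms(3) t0 in auto)
  next
    case False
    then have w: "w \<in> verts H1 - verts H" using Suc.prems(3) by (auto simp: H')
    have "normal r k H1 ((t(x := t x + 1))(w := 1))"
    proof (rule Suc.IH[OF H1(1) _ w])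
      show "(t(x := t x + 1)) v = 0" if "v \<in> verts H1 - verts H" for v
        using that assms(4) Suc.prems(2) by (auto simp: H')
      show "normal r k H ((t(x := t x + 1))(x := (t(x := t x + 1)) x + (real a - 1) + r / (r - 1)))"
        by (rule normal_cong[OF Suc.prems(4)]) (auto simp: algebra_simps)
    qed
    then have n: "normal r k H1 ((t(w := 1))(x := (t(w := 1)) x + 1))"
      by (rule normal_cong) (use w assms(4) in auto)
    have P': "(\<Prod>v\<in>N. r / (r - (t(w := 1)) v)) = 1"
      using False t0 assms(3) by (intro prod.neutral) auto
    show ?thesis
    proof (rule normal_attach)
      show "normal r k H1 ((t(w := 1))(x := (t(w := 1)) x + (\<Prod>v\<in>N. r / (r - (t(w := 1)) v))))"
        unfolding P' by (rule n)
    qed (use assms(3) t0 in auto)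
  qed
qed

lemma frac_le_self:
  fixes x r :: real
  assumes "0 \<le> x" "x + 1 \<le> r"
  shows "x / (r - x) \<le> x"
proof -
  have "x * 1 \<le> x * (r - x)" using assms by (intro mult_left_mono) auto
  then show ?thesis using assms by (simp add: field_simps)
qed

text \<open>Superadditivity of \<open>x / (r - x)\<close>: the costliest arrangement puts all weight
  on a single edge.\<close>

lemma frac_add_le:
  fixes x y r :: real
  assumes "0 \<le> x" "0 \<le> y" "x + y < r"
  shows "x / (r - x) + y / (r - y) \<le> (x + y) / (r - (x + y))"
proof -
  have "x / (r - x) \<le> x / (r - (x + y))" "y / (r - y) \<le> y / (r - (x + y))"
    using assms by (auto intro!: divide_left_mono)
  then show ?thesis by (simp add: add_divide_distrib)
qed

text \<open>An edge with weight \<open>s\<close> on its new vertices costs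
  \<open>r / (r - s) = 1 + s / (r - s)\<close>; by superadditivity the total weight \<open>y\<close>
  may be treated as if it hung on one of the \<open>a\<close> edges.\<close>

lemma feasible_attach_pow:
  fixes t :: "'a \<Rightarrow> real"
  assumes "kgraph k H" "k \<ge> 2" "r > 0" "x \<in> verts H" "(attach_pendent k x ^^ a) H H'"
    and "\<And>v. v \<in> verts H' \<Longrightarrow> t v \<ge> 0" "(\<Sum>v\<in>verts H' - verts H. t v) = y" "y < r"
    and "feasible r H (t(x := t x + a + y / (r - y)))"
  shows "feasible r H' t"
  using assms(5-9)
proof (induction a arbitrary: H' t y)
  case 0
  then show ?case by auto
next
  case (Suc a)
  then obtain H1 where H1: "(attach_pendent k x ^^ a) H H1" "attach_pendent k x H1 H'" by auto
  note P = attach_pendent_pow[OF assms(1,2) H1(1)]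
  obtain N where "pendent_edge k H1 H' x N" using attach_pendentE[OF H1(2) P(1) assms(2)] .
  then interpret pendent_edge k H1 H' x N .
  define yN where "yN = (\<Sum>v\<in>N. t v)"
  define y1 where "y1 = (\<Sum>v\<in>verts H1 - verts H. t v)"
  have "verts H' - verts H = (verts H1 - verts H) \<union> N" using P(2) N by (auto simp: H')
  then have "y = y1 + yN"
    unfolding y1_def yN_def Suc.prems(3)[symmetric]
    using N kgraphD(1)[OF kgraph] by (auto intro: sum.union_disjoint)
  have y0: "y1 \<ge> 0" "yN \<ge> 0"
    unfolding y1_def yN_def using Suc.prems(2) by (auto intro!: sum_nonneg simp: H')
  have xN: "t x \<ge> 0" using Suc.prems(2)[of x] x by (simp add: H')
  have "feasible r H1 (t(x := t x + r / (r - yN)))"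
  proof (rule Suc.IH[OF H1(1)])
    show "(t(x := t x + r / (r - yN))) v \<ge> 0" if "v \<in> verts H1" for v
      using that Suc.prems(2)[of v] y0 Suc.prems(4) \<open>y = _\<close> assms(3) xN by (auto simp: H')
    show "sum (t(x := t x + r / (r - yN))) (verts H1 - verts H) = y1"
      unfolding y1_def using assms(4) by (intro sum.cong) auto
    show "y1 < r" using Suc.prems(4) y0 \<open>y = _\<close> by simp
    have "r / (r - yN) = 1 + yN / (r - yN)"
      using Suc.prems(4) y0 \<open>y = _\<close> by (simp add: field_simps)
    then have "r / (r - yN) + a + y1 / (r - y1) \<le> Suc a + y / (r - y)"
      using frac_add_le[of y1 yN r] y0 Suc.prems(4) unfolding \<open>y = _\<close> by simp
    then show "feasible r H ((t(x := t x + r / (r - yN)))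
        (x := (t(x := t x + r / (r - yN))) x + a + y1 / (r - y1)))"
      by (intro feasible_mono[OF Suc.prems(5) assms(3)]) auto
  qed
  then show ?case
    using Suc.prems(2,4) y0 assms(3) \<open>y = _\<close> unfolding yN_def
    by (intro feasible_attach) (auto simp: H')
qed

section \<open>Order of attachments and the symmetry between \<open>u\<close> and
  \<open>v\<close>\<close>

lemma attach_pendent_commute:
  assumes "attach_pendent k y H H1" "attach_pendent k x H1 H2" "x \<in> verts H"
  shows "\<exists>H1'. attach_pendent k x H H1' \<and> attach_pendent k y H1' H2"
proof -
  obtain N where N: "y \<in> verts H" "finite N" "card N = k - 1" "N \<inter> verts H = {}"
    "H1 = (verts H \<union> N, insert (insert y N) (edges H))"
    using assms(1) unfolding attach_pendent_def by blast
  obtain M where M: "finite M" "card M = k - 1" "M \<inter> verts H1 = {}"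
    "H2 = (verts H1 \<union> M, insert (insert x M) (edges H1))"
    using assms(2) unfolding attach_pendent_def by blast
  show ?thesis
    unfolding attach_pendent_def using N M assms(3)
    by (intro exI[of _ "(verts H \<union> M, insert (insert x M) (edges H))"] conjI exI[of _ M] exI[of _ N])
      auto
qed

lemma attach_pendent_pow_verts:
  assumes "(attach_pendent k y ^^ b) H G"
  shows "verts H \<subseteq> verts G"
  using assms
proof (induction b arbitrary: G)
  case 0
  then show ?case by simp
next
  case (Suc b)
  then obtain G' where G': "(attach_pendent k y ^^ b) H G'" "attach_pendent k y G' G"
    by (metis relpowp_Suc_E)
  have "verts G' \<subseteq> verts G" using G'(2) unfolding attach_pendent_def by fastforce
  then show ?case using Suc.IH[OF G'(1)] by blast
qed

lemma attach_pendent_pow_commute: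
  assumes "(attach_pendent k y ^^ b) H H1" "attach_pendent k x H1 H2" "x \<in> verts H"
  shows "\<exists>H1'. attach_pendent k x H H1' \<and> (attach_pendent k y ^^ b) H1' H2"
  using assms(1,2)
proof (induction b arbitrary: H1 H2)
  case 0
  then show ?case by (metis relpowp_0_E relpowp_0_I)
next
  case (Suc b)
  then obtain G where G: "(attach_pendent k y ^^ b) H G" "attach_pendent k y G H1" by auto
  have "verts H \<subseteq> verts G" by (rule attach_pendent_pow_verts[OF G(1)])
  then obtain G' where G': "attach_pendent k x G G'" "attach_pendent k y G' H2"
    using attach_pendent_commute[OF G(2) Suc.prems(2)] assms(3) by blast
  then show ?case using Suc.IH[OF G(1) G'(1)] by (metis relpowp_Suc_I)
qed

definition two_cycle :: "nat \<Rightarrow> 'a \<Rightarrow> 'a \<Rightarrow> 'a set \<Rightarrow> 'a set \<Rightarrow> bool" where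
  "two_cycle k u v e1 e2 \<longleftrightarrow> finite e1 \<and> finite e2 \<and> card e1 = k \<and> card e2 = k \<and> e1 \<noteq> e2 \<and>
     u \<noteq> v \<and> e1 \<inter> e2 = {u, v}"

lemma U2_at_two_cycle:
  "U2_at k a b u v e1 e2 H \<longleftrightarrow> two_cycle k u v e1 e2 \<and>
    (\<exists>H1. (attach_pendent k u ^^ a) (e1 \<union> e2, {e1, e2}) H1 \<and> (attach_pendent k v ^^ b) H1 H)"
  unfolding U2_at_def two_cycle_def by blast

lemma two_cycle_commute: "two_cycle k u v e1 e2 \<Longrightarrow> two_cycle k v u e1 e2"
  "two_cycle k u v e1 e2 \<Longrightarrow> two_cycle k u v e2 e1"
  unfolding two_cycle_def by (auto simp: insert_commute Int_commute)

lemma kgraph_two_cycle: "two_cycle k u v e1 e2 \<Longrightarrow> kgraph k (e1 \<union> e2, {e1, e2})"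
  unfolding two_cycle_def kgraph_def by auto

lemma two_cycleD:
  assumes "two_cycle k u v e1 e2"
  shows "u \<in> e1" "u \<in> e2" "v \<in> e1" "v \<in> e2" "u \<noteq> v" "e1 \<noteq> e2" "finite e1" "finite e2"
    "card e1 = k" "card e2 = k" "e1 \<inter> e2 = {u, v}"
  using assms unfolding two_cycle_def by auto

lemma U2_at_commute_edges: "U2_at k a b u v e1 e2 H \<Longrightarrow> U2_at k a b u v e2 e1 H"
  unfolding U2_at_two_cycle Un_commute[of e1] insert_commute[of e1] using two_cycle_commute(2)[of k u v e1 e2] by blast

text \<open>\<open>U2_at\<close> attaches everything at \<open>u\<close> before anything at
  \<open>v\<close>, so a later edge at \<open>u\<close> has to be moved past the edges at
  \<open>v\<close>; disjointness of the fresh vertex sets makes attachments commute.\<close>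

lemma U2_at_attach_left:
  assumes "U2_at k a b u v e1 e2 H" "attach_pendent k u H H'" "k \<ge> 2"
  shows "U2_at k (Suc a) b u v e1 e2 H'"
proof -
  obtain H1 where H1: "(attach_pendent k u ^^ a) (e1 \<union> e2, {e1, e2}) H1" "(attach_pendent k v ^^ b) H1 H"
    and c: "two_cycle k u v e1 e2" using assms(1) U2_at_two_cycle by metis
  have "u \<in> verts H1"
    using attach_pendent_pow(2)[OF kgraph_two_cycle[OF c] assms(3) H1(1)] two_cycleD[OF c] by auto
  then obtain H1' where "attach_pendent k u H1 H1'" "(attach_pendent k v ^^ b) H1' H'"
    using attach_pendent_pow_commute[OF H1(2) assms(2)] by blast
  then show ?thesis unfolding U2_at_two_cycle using c H1(1) by (metis relpowp_Suc_I)
qed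

lemma U2_at_attach_right:
  assumes "U2_at k a b u v e1 e2 H" "attach_pendent k v H H'"
  shows "U2_at k a (Suc b) u v e1 e2 H'"
  using assms unfolding U2_at_def by auto

lemma U2_at_swap:
  assumes "U2_at k a b u v e1 e2 H" "k \<ge> 2"
  shows "U2_at k b a v u e1 e2 H"
proof -
  obtain H1 where H1: "(attach_pendent k u ^^ a) (e1 \<union> e2, {e1, e2}) H1" "(attach_pendent k v ^^ b) H1 H"
    and c: "two_cycle k u v e1 e2" using assms(1) U2_at_two_cycle by metis
  show ?thesis using H1(2)
  proof (induction b arbitrary: H)
    case 0
    then show ?case unfolding U2_at_two_cycle using H1(1) two_cycle_commute(1)[OF c] by auto
  next
    case (Suc b)
    then obtain G where "(attach_pendent k v ^^ b) H1 G" "attach_pendent k v G H" by auto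
    then show ?case using Suc.IH U2_at_attach_left assms(2) by metis
  qed
qed

text \<open>\<open>H\<close> arises from \<open>C\<close> by attaching pendent edges one after the other; \<open>\<phi> x\<close> is the vertex of \<open>C\<close>
  at which the branch containing \<open>x\<close> hangs, and \<open>t c\<close> is the number of edges in the branches at \<open>c\<close>.\<close>

inductive grown :: "nat \<Rightarrow> 'a hgraph \<Rightarrow> ('a \<Rightarrow> 'a) \<Rightarrow> ('a \<Rightarrow> nat) \<Rightarrow> 'a hgraph \<Rightarrow> bool"
  for k :: nat and C :: "'a hgraph" where
  grown_refl: "grown k C (\<lambda>y. y) (\<lambda>_. 0) C"
| grown_step: "grown k C \<phi> t H \<Longrightarrow> x \<in> verts H \<Longrightarrow> finite N \<Longrightarrow> card N = k - 1 \<Longrightarrow>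
    N \<inter> verts H = {} \<Longrightarrow> grown k C (\<lambda>y. if y \<in> N then \<phi> x else \<phi> y) (t(\<phi> x := Suc (t (\<phi> x))))
      (verts H \<union> N, insert (insert x N) (edges H))"

lemma grownD:
  assumes "grown k C \<phi> t H" "kgraph k C" "k \<ge> 2"
  shows "kgraph k H" "verts C \<subseteq> verts H" "c \<in> verts C \<Longrightarrow> \<phi> c = c"
    "x \<in> verts H \<Longrightarrow> \<phi> x \<in> verts C" "x \<in> verts H \<Longrightarrow> t (\<phi> x) = 0 \<Longrightarrow> x \<in> verts C"
    "(\<Sum>c\<in>verts C. t c) + card (edges C) = card (edges H)"
proof -
  have "kgraph k H \<and> verts C \<subseteq> verts H \<and> (\<forall>c\<in>verts C. \<phi> c = c) \<and>
    (\<forall>x\<in>verts H. \<phi> x \<in> verts C \<and> (t (\<phi> x) = 0 \<longrightarrow> x \<in> verts C)) \<and>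
    (\<Sum>c\<in>verts C. t c) + card (edges C) = card (edges H)"
    using assms
  proof (induction rule: grown.induct)
    case grown_refl
    then show ?case by simp
  next
    case (grown_step \<phi> t H x N)
    let ?H' = "(verts H \<union> N, insert (insert x N) (edges H))"
    interpret pendent_edge k H ?H' x N
      using grown_step by unfold_locales auto
    have "(\<Sum>c\<in>verts C. (t(\<phi> x := Suc (t (\<phi> x)))) c) =
        (\<Sum>c\<in>verts C. t c + (if c = \<phi> x then 1 else 0))"
      by (intro sum.cong) auto
    also have "\<dots> = (\<Sum>c\<in>verts C. t c) + 1"
      using grown_step kgraphD(1)[OF grown_step.prems(1)] by (simp add: sum.distrib)
    finally show ?case using grown_step kgraph' card_edges' by auto
  qed
  then show "kgraph k H" "verts C \<subseteq> verts H" "c \<in> verts C \<Longrightarrow> \<phi> c = c"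
    "x \<in> verts H \<Longrightarrow> \<phi> x \<in> verts C" "x \<in> verts H \<Longrightarrow> t (\<phi> x) = 0 \<Longrightarrow> x \<in> verts C"
    "(\<Sum>c\<in>verts C. t c) + card (edges C) = card (edges H)" by blast+
qed

lemma feasible_cong:
  assumes "feasible r H t" "\<And>v. v \<in> verts H \<Longrightarrow> t v = t' v"
  shows "feasible r H t'"
proof -
  have "feasible r H t = feasible r H t'"
    unfolding feasible_def using assms(2) by (intro ex_cong1 conj_cong ball_cong refl) auto
  then show ?thesis using assms(1) by simp
qed

text \<open>Arbitrary weights \<open>w\<close> make the induction go through: undoing the last
  attachment moves the weight of the deleted vertices plus 1 to \<open>x\<close>, which leaves the
  total of every branch unchanged.\<close>

lemma feasible_grown_weighted:
  fixes w :: "'a \<Rightarrow> real"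
  assumes "grown k C \<phi> t H" "kgraph k C" "k \<ge> 2" "r > 0" "\<And>v. v \<in> verts H \<Longrightarrow> 0 \<le> w v"
    and "feasible r C (\<lambda>c. t c + (\<Sum>x | x \<in> verts H \<and> \<phi> x = c. w x))"
  shows "feasible r H w"
  using assms
proof (induction arbitrary: w rule: grown.induct)
  case grown_refl
  have "feasible r C w"
  proof (rule feasible_cong[OF grown_refl.prems(5)])
    fix v assume "v \<in> verts C"
    then have "{x. x \<in> verts C \<and> x = v} = {v}" by auto
    then show "real 0 + (\<Sum>x | x \<in> verts C \<and> x = v. w x) = w v" by simp
  qed
  then show ?case .
next
  case (grown_step \<phi> t H x N)
  let ?H' = "(verts H \<union> N, insert (insert x N) (edges H))"
  note G = grownD[OF grown_step.hyps(1) grown_step.prems(1,2)]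
  interpret pendent_edge k H ?H' x N
    using grown_step G by unfold_locales auto
  define s where "s = (\<Sum>v\<in>N. w v)"
  have s: "s \<ge> 0" unfolding s_def using grown_step.prems(4) by (intro sum_nonneg) auto
  have finH: "finite (verts H)" using kgraphD(1)[OF G(1)] .
  have "feasible r H (w(x := w x + 1 + s))"
  proof (rule grown_step.IH[OF grown_step.prems(1-3)])
    show "0 \<le> (w(x := w x + 1 + s)) v" if "v \<in> verts H" for v
      using that grown_step.prems(4)[of v] s by (auto simp: add_nonneg_nonneg)
    show "feasible r C (\<lambda>c. t c + (\<Sum>y | y \<in> verts H \<and> \<phi> y = c. (w(x := w x + 1 + s)) y))"
    proof (rule feasible_cong[OF grown_step.prems(5)])
      fix c assume c: "c \<in> verts C"
      let ?A = "{y. y \<in> verts H \<and> \<phi> y = c}"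
      have "{y \<in> verts ?H'. (if y \<in> N then \<phi> x else \<phi> y) = c} = ?A \<union> (if \<phi> x = c then N else {})"
        using N by auto
      then have "(\<Sum>y | y \<in> verts ?H' \<and> (if y \<in> N then \<phi> x else \<phi> y) = c. w y) =
          (\<Sum>y\<in>?A. w y) + (if \<phi> x = c then s else 0)"
        using N finH by (auto simp: s_def intro!: sum.union_disjoint)
      moreover have "(\<Sum>y\<in>?A. (w(x := w x + 1 + s)) y) = (\<Sum>y\<in>?A. w y + (if y = x then 1 + s else 0))"
        by (intro sum.cong) auto
      then have "(\<Sum>y\<in>?A. (w(x := w x + 1 + s)) y) = (\<Sum>y\<in>?A. w y) + (if \<phi> x = c then 1 + s else 0)"
        using finH x by (simp add: sum.distrib)
      ultimately show "real ((t(\<phi> x := Suc (t (\<phi> x)))) c) +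
          (\<Sum>y | y \<in> verts ?H' \<and> (if y \<in> N then \<phi> x else \<phi> y) = c. w y) =
          t c + (\<Sum>y\<in>?A. (w(x := w x + 1 + s)) y)"
        by auto
    qed
  qed
  then show ?case
    using grown_step.prems(3,4) unfolding s_def by (intro feasible_attach_contract) auto
qed

lemma feasible_grown:
  assumes "grown k C \<phi> t H" "kgraph k C" "k \<ge> 2" "r > 0" "feasible r C t"
  shows "feasible r H (\<lambda>_. 0)"
  by (rule feasible_grown_weighted[OF assms(1-4)]) (use assms(5) in auto)

text \<open>An edge attached last, but at a core vertex, is independent of the earlier attachments
  and can be made part of the core; the root map changes only on the new vertices.\<close>

lemma grown_attach_core:
  assumes "grown k C \<phi> t H" "x \<in> verts C" "finite N" "card N = k - 1" "N \<inter> verts H = {}"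
  shows "grown k (verts C \<union> N, insert (insert x N) (edges C)) (\<lambda>y. if y \<in> N then y else \<phi> y) t
    (verts H \<union> N, insert (insert x N) (edges H))"
  using assms
proof (induction rule: grown.induct)
  case grown_refl
  have "(\<lambda>y. if y \<in> N then y else y) = (\<lambda>y. y)" by auto
  then show ?case using grown.grown_refl[of k "(verts C \<union> N, insert (insert x N) (edges C))"] by simp
next
  case (grown_step \<phi> t H x' M)
  let ?C = "(verts C \<union> N, insert (insert x N) (edges C))"
  let ?H = "(verts H \<union> N, insert (insert x N) (edges H))"
  let ?\<phi> = "\<lambda>y. if y \<in> N then y else \<phi> y"
  have "grown k ?C ?\<phi> t ?H" using grown_step by auto
  moreover have "x' \<in> verts ?H" "M \<inter> verts ?H = {}" using grown_step by auto
  ultimately have "grown k ?C (\<lambda>y. if y \<in> M then ?\<phi> x' else ?\<phi> y)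
      (t(?\<phi> x' := Suc (t (?\<phi> x')))) (verts ?H \<union> M, insert (insert x' M) (edges ?H))"
    using grown_step.hyps(3,4) by (intro grown.grown_step) auto
  moreover have "x' \<notin> N" using grown_step by auto
  moreover have "(\<lambda>y. if y \<in> M then ?\<phi> x' else ?\<phi> y) =
      (\<lambda>y. if y \<in> N then y else if y \<in> M then \<phi> x' else \<phi> y)"
    using grown_step \<open>x' \<notin> N\<close> by (intro ext) auto
  ultimately show ?case by (simp add: Un_ac insert_commute fun_upd_def)
qed

lemma grown_zero:
  assumes "grown k C \<phi> t H" "kgraph k C" "k \<ge> 2" "(\<Sum>c\<in>verts C. t c) = 0"
  shows "H = C"
  using assms(1)
proof cases
  case (grown_step \<psi> s G x N)
  have x: "\<psi> x \<in> verts C" by (rule grownD(4)[OF grown_step(4) assms(2,3) grown_step(5)])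
  have "\<forall>c\<in>verts C. t c = 0" using assms(4) kgraphD(1)[OF assms(2)] by simp
  then have "t (\<psi> x) = 0" using x by blast
  then show ?thesis unfolding grown_step(2) by simp
qed simp

lemma grown_one:
  assumes "grown k C \<phi> t H" "kgraph k C" "k \<ge> 2" "(\<Sum>c\<in>verts C. t c) = 1"
  shows "\<exists>w\<in>verts C. attach_pendent k w C H \<and> t w = 1"
  using assms(1)
proof cases
  case grown_refl
  then show ?thesis using assms(4) by simp
next
  case (grown_step \<psi> s G x N)
  note G = grownD[OF grown_step(4) assms(2,3)]
  have fin: "finite (verts C)" using kgraphD(1)[OF assms(2)] .
  have x: "\<psi> x \<in> verts C" using G(4) grown_step by blast
  have "(\<Sum>c\<in>verts C. t c) = (\<Sum>c\<in>verts C. s c + (if c = \<psi> x then 1 else 0))"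
    using grown_step by (intro sum.cong) auto
  also have "\<dots> = (\<Sum>c\<in>verts C. s c) + 1" using fin x by (simp add: sum.distrib)
  finally have s0: "(\<Sum>c\<in>verts C. s c) = 0" using assms(4) by simp
  then have GC: "G = C" using grown_zero[OF grown_step(4) assms(2,3)] by simp
  then have "x \<in> verts C" using grown_step by simp
  moreover have "\<psi> x = x" using G(3) calculation by blast
  moreover have "s x = 0" using s0 fin calculation by simp
  ultimately show ?thesis
    using grown_step GC unfolding attach_pendent_def by auto
qed

text \<open>All edges attached directly at \<open>u\<close> or \<open>v\<close> are moved into the core, so that the remaining
  branches hang elsewhere.\<close>

lemma grown_two_cycle:
  assumes "grown k (e1 \<union> e2, {e1, e2}) \<phi> t H" "two_cycle k u v e1 e2" "k \<ge> 2"
  shows "\<exists>a b H0 \<psi> s. U2_at k a b u v e1 e2 H0 \<and> grown k H0 \<psi> s H \<and> s u = 0 \<and> s v = 0"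
  using assms
proof (induction rule: grown.induct)
  case grown_refl
  have "U2_at k 0 0 u v e1 e2 (e1 \<union> e2, {e1, e2})"
    using grown_refl unfolding U2_at_two_cycle by auto
  then show ?case using grown.grown_refl[of k "(e1 \<union> e2, {e1, e2})"]
    by (intro exI[of _ 0] exI[of _ "(e1 \<union> e2, {e1, e2})"] exI[of _ "\<lambda>y. y"] exI[of _ "\<lambda>_. 0"]) simp
next
  case (grown_step \<phi> t H x N)
  then obtain a b H0 \<psi> s where U: "U2_at k a b u v e1 e2 H0" and g: "grown k H0 \<psi> s H"
    and s: "s u = 0" "s v = 0" by blast
  let ?G = "(verts H \<union> N, insert (insert x N) (edges H))"
  let ?K = "(verts H0 \<union> N, insert (insert x N) (edges H0))"
  have k0: "kgraph k H0" and sub: "e1 \<union> e2 \<subseteq> verts H0"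
  proof -
    obtain H1 where H1: "(attach_pendent k u ^^ a) (e1 \<union> e2, {e1, e2}) H1" "(attach_pendent k v ^^ b) H1 H0"
      and c: "two_cycle k u v e1 e2" using U U2_at_two_cycle by metis
    note P = attach_pendent_pow[OF kgraph_two_cycle[OF c] assms(3) H1(1)]
    note Q = attach_pendent_pow[OF P(1) assms(3) H1(2)]
    show "kgraph k H0" "e1 \<union> e2 \<subseteq> verts H0" using P Q by auto
  qed
  note G = grownD[OF g k0 assms(3)]
  show ?case
  proof (cases "\<psi> x \<in> {u, v}")
    case True
    then have "s (\<psi> x) = 0" using s by auto
    then have xH0: "x \<in> verts H0" using G(5) grown_step by blast
    then have x: "x \<in> {u, v}" using G(3) True by metis
    have at: "attach_pendent k x H0 ?K"
      unfolding attach_pendent_def using xH0 grown_step.hyps G(2) by blast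
    consider "x = u" | "x = v" using x by blast
    then have "\<exists>a b. U2_at k a b u v e1 e2 ?K"
    proof cases
      case 1
      then show ?thesis using U2_at_attach_left[OF U _ assms(3), of ?K] at by blast
    next
      case 2
      then show ?thesis using U2_at_attach_right[OF U, of ?K] at by blast
    qed
    moreover have "grown k ?K (\<lambda>y. if y \<in> N then y else \<psi> y) s ?G"
      by (rule grown_attach_core[OF g xH0 grown_step.hyps(3-5)])
    ultimately show ?thesis using s by blast
  next
    case False
    have "grown k H0 (\<lambda>y. if y \<in> N then \<psi> x else \<psi> y) (s(\<psi> x := Suc (s (\<psi> x)))) ?G"
      by (rule grown.grown_step[OF g grown_step.hyps(2-5)])
    moreover have "(s(\<psi> x := Suc (s (\<psi> x)))) u = 0" "(s(\<psi> x := Suc (s (\<psi> x)))) v = 0"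
      using False s by auto
    ultimately show ?thesis using U by blast
  qed
qed

section \<open>Cycles with pendent trees\<close>

text \<open>Connectivity phrased through edge sets instead of paths: no proper nonempty part of the
  edges is vertex-disjoint from the rest. In this form it passes easily through deletion and
  contraction of edges.\<close>

definition linked :: "'a set set \<Rightarrow> bool" where
  "linked E \<longleftrightarrow> (\<forall>S\<subseteq>E. S \<noteq> {} \<longrightarrow> S \<noteq> E \<longrightarrow> (\<exists>e\<in>S. \<exists>f\<in>E - S. e \<inter> f \<noteq> {}))"

definition linked_unicyclic :: "nat \<Rightarrow> 'a hgraph \<Rightarrow> bool" where
  "linked_unicyclic k H \<longleftrightarrow> kgraph k H \<and> verts H = \<Union>(edges H) \<and> linked (edges H) \<and>
     card (verts H) = card (edges H) * (k - 1)"

lemma linkedD: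
  assumes "linked E" "S \<subseteq> E" "S \<noteq> {}" "S \<noteq> E"
  obtains e f where "e \<in> S" "f \<in> E" "f \<notin> S" "e \<inter> f \<noteq> {}"
proof -
  have "\<exists>e\<in>S. \<exists>f\<in>E - S. e \<inter> f \<noteq> {}" using assms unfolding linked_def by simp
  then show thesis using that by blast
qed

text \<open>Two edges force at least two vertices, so every vertex lies on a path of positive length
  and none is isolated. Along a path, membership in the union of a separated edge set cannot change,
  which yields linkedness.\<close>

lemma linked_unicyclicI:
  assumes H: "unicyclic k H" and k: "k \<ge> 2" and m: "card (edges H) \<ge> 2"
  shows "linked_unicyclic k H"
proof -
  have kg: "kgraph k H" and con: "connected_hgraph H"
    and n: "card (verts H) = card (edges H) * (k - 1)" using H by (auto simp: unicyclic_def)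
  note D = kgraphD[OF kg]
  have "2 * 1 \<le> card (edges H) * (k - 1)" using m k by (intro mult_le_mono) auto
  then have n2: "card (verts H) \<ge> 2" using n by simp
  have "v \<in> \<Union>(edges H)" if v: "v \<in> verts H" for v
  proof -
    have "verts H \<noteq> {v}" using n2 by auto
    then obtain w where w: "w \<in> verts H" "w \<noteq> v" using v by blast
    obtain vs es where p: "hpath H vs es" "v \<in> set vs" "w \<in> set vs"
      using con v w unfolding connected_hgraph_def by blast
    have l: "length vs = Suc (length es)" using p(1) by (simp add: hpath_def)
    have "length es \<noteq> 0"
    proof
      assume "length es = 0"
      then have "length vs = 1" using l by simp
      then obtain z where "vs = [z]" by (metis One_nat_def length_0_conv length_Suc_conv)
      then show False using p w by auto
    qed
    moreover obtain j where j: "j < length vs" "vs ! j = v" using p(2) by (auto simp: in_set_conv_nth)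
    ultimately obtain i where "i < length es" "v \<in> es ! i"
    proof (cases "j < length es")
      case True
      then show ?thesis using p(1) j that unfolding hpath_def by blast
    next
      case False
      then have "j = Suc (length es - 1)" "length es - 1 < length es"
        using j l \<open>length es \<noteq> 0\<close> by auto
      then show ?thesis using p(1) j that[of "length es - 1"] unfolding hpath_def by metis
    qed
    then show ?thesis using p(1) unfolding hpath_def by (meson UnionI nth_mem subsetD)
  qed
  then have V: "verts H = \<Union>(edges H)" using D(5) by blast
  moreover have "linked (edges H)"
    unfolding linked_def
  proof (intro allI impI)
    fix S assume S: "S \<subseteq> edges H" "S \<noteq> {}" "S \<noteq> edges H"
    show "\<exists>e\<in>S. \<exists>f\<in>edges H - S. e \<inter> f \<noteq> {}"
    proof (rule ccontr)
      assume "\<not> ?thesis"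
      then have sep: "e \<inter> f = {}" if "e \<in> S" "f \<in> edges H - S" for e f using that by blast
      obtain e f where e: "e \<in> S" and f: "f \<in> edges H" "f \<notin> S" using S by blast
      have "e \<noteq> {}" "f \<noteq> {}" using e f S D(6) k by fastforce+
      then obtain x y where xy: "x \<in> e" "y \<in> f" by blast
      have "x \<in> verts H" "y \<in> verts H" using xy e f S(1) D(5) by blast+
      then obtain vs es where p: "hpath H vs es" "x \<in> set vs" "y \<in> set vs"
        using con unfolding connected_hgraph_def by blast
      have st: "vs ! j \<in> \<Union>S \<longleftrightarrow> vs ! Suc j \<in> \<Union>S" if "j < length es" for j
      proof -
        have g: "es ! j \<in> edges H" "vs ! j \<in> es ! j" "vs ! Suc j \<in> es ! j"
          using p(1) that unfolding hpath_def by auto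
        show ?thesis
        proof (cases "es ! j \<in> S")
          case False
          then have "es ! j \<inter> \<Union>S = {}" using sep g(1) by blast
          then show ?thesis using g by blast
        qed (use g in blast)
      qed
      have all: "vs ! j \<in> \<Union>S \<longleftrightarrow> vs ! 0 \<in> \<Union>S" if "j < length vs" for j
        using that
      proof (induction j)
        case (Suc j)
        have "j < length es" using Suc.prems p(1) by (simp add: hpath_def)
        then show ?case using st Suc by simp
      qed simp
      obtain i j where "i < length vs" "vs ! i = x" "j < length vs" "vs ! j = y"
        using p by (auto simp: in_set_conv_nth)
      then have "x \<in> \<Union>S \<longleftrightarrow> y \<in> \<Union>S" using all by metis
      moreover have "x \<in> \<Union>S" using xy e by blast
      moreover have "y \<notin> \<Union>S" using xy sep f by blast
      ultimately show False by blast
    qed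
  qed
  ultimately show ?thesis using kg n by (simp add: linked_unicyclic_def)
qed

text \<open>Together with linkedness these degree conditions describe a cycle: every edge has
  exactly two junctions, each shared with one other edge.\<close>

definition cycle_core :: "nat \<Rightarrow> 'a hgraph \<Rightarrow> bool" where
  "cycle_core k H \<longleftrightarrow> linked_unicyclic k H \<and> (\<forall>v\<in>verts H. card (incident H v) \<le> 2) \<and>
     (\<forall>e\<in>edges H. card {v\<in>e. card (incident H v) = 2} = 2)"

lemma sum_eq_imp_eq:
  fixes f :: "'a \<Rightarrow> nat"
  assumes "finite A" "\<And>x. x \<in> A \<Longrightarrow> c \<le> f x" "(\<Sum>x\<in>A. f x) \<le> c * card A" "x \<in> A"
  shows "f x = c"
proof (rule ccontr)
  assume "f x \<noteq> c"
  then have "(\<Sum>x\<in>A. c) < (\<Sum>x\<in>A. f x)"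
    using assms by (intro sum_strict_mono_ex1) (auto intro!: bexI[of _ x] le_neq_implies_less)
  then show False using assms(3) by (simp add: mult.commute)
qed

text \<open>A single edge would have \<open>k\<close> vertices, while the unicyclic vertex count
  allows only \<open>k - 1\<close>.\<close>

lemma card_edges_ge_2:
  assumes "linked_unicyclic k H" "k \<ge> 1"
  shows "card (edges H) \<ge> 2"
proof (rule ccontr)
  have kg: "kgraph k H" and V: "verts H = \<Union>(edges H)" and n: "card (verts H) = card (edges H) * (k - 1)"
    using assms by (auto simp: linked_unicyclic_def)
  assume "\<not> ?thesis"
  moreover have "edges H \<noteq> {}" using V kgraphD(3)[OF kg] by auto
  then have "card (edges H) \<noteq> 0" using kgraphD(2)[OF kg] by simp
  ultimately have c: "card (edges H) = 1" by linarith
  then obtain e where e: "edges H = {e}" by (metis card_1_singletonE)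
  then have "card (verts H) = k" using V kgraphD(6)[OF kg, of e] by simp
  then show False using n c assms(2) by simp
qed

text \<open>If every edge has two vertices of degree at least two, then counting incidences forces
  equality everywhere, because the degrees minus one sum up to the number of edges.\<close>

lemma cycle_coreI:
  assumes H: "linked_unicyclic k H" and k: "k \<ge> 2"
    and two: "\<And>e. e \<in> edges H \<Longrightarrow> card {v\<in>e. card (incident H v) \<ge> 2} \<ge> 2"
  shows "cycle_core k H"
proof -
  have kg: "kgraph k H" and V: "verts H = \<Union>(edges H)"
    and n: "card (verts H) = card (edges H) * (k - 1)"
    using H by (auto simp: linked_unicyclic_def)
  note D = kgraphD[OF kg]
  define d where "d v = card (incident H v)" for v
  define M where "M = {v\<in>verts H. d v \<ge> 2}"
  have finM: "finite M" using D(1) by (simp add: M_def)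
  have d1: "d v \<ge> 1" if "v \<in> verts H" for v
  proof -
    have "incident H v \<noteq> {}" using that V by (auto simp: incident_def)
    then have "card (incident H v) > 0" using D(7) by (simp add: card_gt_0_iff)
    then show ?thesis by (simp add: d_def)
  qed
  have eM: "{v\<in>e. card (incident H v) \<ge> 2} = e \<inter> M" if "e \<in> edges H" for e
    using that D(5) by (auto simp: M_def d_def)
  have "(\<Sum>v\<in>verts H. d v) = (\<Sum>e\<in>edges H. card e)"
    using sum_incidences[OF kg, of "\<lambda>_ _. 1::nat"] by (simp add: d_def)
  also have "\<dots> = card (edges H) * k" using D(6) by simp
  finally have total: "(\<Sum>v\<in>verts H. d v) = card (edges H) * k" .
  have "(\<Sum>v\<in>verts H. d v) = (\<Sum>v\<in>M. d v) + (\<Sum>v\<in>verts H - M. d v)"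
    using D(1) by (subst sum.subset_diff[of M]) (auto simp: M_def)
  also have "(\<Sum>v\<in>verts H - M. d v) = (\<Sum>v\<in>verts H - M. 1)"
    using d1 by (intro sum.cong) (force simp: M_def)+
  also have "\<dots> = card (verts H) - card M"
    using D(1) finM by (simp add: card_Diff_subset M_def)
  finally have split: "card (edges H) * k = (\<Sum>v\<in>M. d v) + (card (verts H) - card M)"
    using total by simp
  have Mle: "card M \<le> card (verts H)" using D(1) by (auto simp: M_def intro: card_mono)
  have mk: "card (edges H) * k = card (edges H) * (k - 1) + card (edges H)"
    using k by (metis One_nat_def add.commute diff_add_inverse2 le_add_diff_inverse mult.right_neutral
        Suc_1 Suc_leD distrib_left)
  \<comment> \<open>Off \<open>M\<close> every degree is 1, so the whole excess of the degrees over
    1, which equals the number of edges, sits on \<open>M\<close>.\<close>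
  have dM: "(\<Sum>v\<in>M. d v) = card (edges H) + card M" using split Mle mk n by linarith
  have "(\<Sum>v\<in>M. d v) = (\<Sum>v\<in>verts H. if v \<in> M then d v else 0)"
    using D(1) by (intro sum.mono_neutral_cong_left) (auto simp: M_def)
  also have "\<dots> = (\<Sum>v\<in>verts H. \<Sum>e\<in>incident H v. if v \<in> M then 1 else 0)"
    by (intro sum.cong) (auto simp: d_def)
  also have "\<dots> = (\<Sum>e\<in>edges H. \<Sum>v\<in>e. if v \<in> M then 1 else 0)"
    by (rule sum_incidences[OF kg, symmetric])
  also have "\<dots> = (\<Sum>e\<in>edges H. card (e \<inter> M))"
    using D(4) by (intro sum.cong refl) (simp add: sum.If_cases Int_def)
  finally have eMsum: "(\<Sum>v\<in>M. d v) = (\<Sum>e\<in>edges H. card (e \<inter> M))" .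
  have ge2: "card (e \<inter> M) \<ge> 2" if "e \<in> edges H" for e using two[OF that] eM[OF that] by simp
  \<comment> \<open>Two vertices of \<open>M\<close> on each edge give
    \<open>card (edges H) \<le> card M\<close>; degree at least 2 on \<open>M\<close> gives the
    reverse inequality.\<close>
  have "2 * card (edges H) = (\<Sum>e\<in>edges H. 2)" by simp
  also have "\<dots> \<le> (\<Sum>e\<in>edges H. card (e \<inter> M))" by (rule sum_mono) (rule ge2)
  finally have m1: "2 * card (edges H) \<le> card (edges H) + card M" using eMsum dM by simp
  have "2 * card M = (\<Sum>v\<in>M. 2)" by simp
  also have "\<dots> \<le> (\<Sum>v\<in>M. d v)" by (rule sum_mono) (auto simp: M_def)
  finally have m2: "2 * card M \<le> card (edges H) + card M" using dM by simp
  have cM: "card M = card (edges H)" using m1 m2 by simp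
  have dv: "d v = 2" if "v \<in> M" for v
    by (rule sum_eq_imp_eq[OF finM _ _ that]) (use dM cM in \<open>auto simp: M_def\<close>)
  have ce: "card (e \<inter> M) = 2" if "e \<in> edges H" for e
    by (rule sum_eq_imp_eq[OF D(2) _ _ that]) (use ge2 eMsum dM cM in auto)
  have "{v\<in>e. card (incident H v) = 2} = e \<inter> M" if "e \<in> edges H" for e
    using that D(5) dv by (auto simp: M_def d_def)
  moreover have "card (incident H v) \<le> 2" if "v \<in> verts H" for v
    using dv[of v] that by (cases "v \<in> M") (auto simp: M_def d_def)
  ultimately show ?thesis using H ce by (simp add: cycle_core_def)
qed

text \<open>By \<open>cycle_coreI\<close> some edge has at most one vertex of degree at least 2;
  linkedness provides one, \<open>x\<close>, so the edge is pendent. Removing it takes away one edge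
  and \<open>k - 1\<close> vertices, which preserves the unicyclic count.\<close>

lemma prune:
  assumes H: "linked_unicyclic k H" and k: "k \<ge> 2" and nc: "\<not> cycle_core k H"
  shows "\<exists>G x N. linked_unicyclic k G \<and> x \<in> verts G \<and> finite N \<and> card N = k - 1 \<and> N \<inter> verts G = {} \<and>
    H = (verts G \<union> N, insert (insert x N) (edges G)) \<and> card (edges G) < card (edges H)"
proof -
  have kg: "kgraph k H" and V: "verts H = \<Union>(edges H)" and l: "linked (edges H)"
    and n: "card (verts H) = card (edges H) * (k - 1)"
    using H by (auto simp: linked_unicyclic_def)
  note D = kgraphD[OF kg]
  obtain e where e: "e \<in> edges H" and "card {v\<in>e. card (incident H v) \<ge> 2} < 2"
    using cycle_coreI[OF H k] nc by (meson not_le)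
  then have c1: "card {v\<in>e. card (incident H v) \<ge> 2} \<le> 1" by simp
  have m2: "card (edges H) \<ge> 2" using card_edges_ge_2[OF H] k by simp
  have "{e} \<noteq> edges H"
  proof
    assume "{e} = edges H"
    then have "card (edges H) = card {e}" by simp
    then show False using m2 by simp
  qed
  then obtain f where f: "f \<in> edges H" "f \<noteq> e" "e \<inter> f \<noteq> {}"
    using linkedD[OF l, of "{e}"] e by (metis empty_not_insert empty_subsetI insert_subset singletonD singletonI)
  then obtain x where x: "x \<in> e" "x \<in> f" by blast
  have big: "card (incident H v) \<ge> 2" if "v \<in> e" "v \<in> g" "g \<in> edges H" "g \<noteq> e" for v g
  proof -
    have "{e, g} \<subseteq> incident H v" using that e by (auto simp: incident_def)
    then have "card {e, g} \<le> card (incident H v)" by (intro card_mono D)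
    then show ?thesis using that(4) by simp
  qed
  have only: "v = x" if "v \<in> e" "v \<in> g" "g \<in> edges H" "g \<noteq> e" for v g
  proof (rule ccontr)
    assume "v \<noteq> x"
    then have "card {v, x} = 2" by simp
    moreover have "{v, x} \<subseteq> {v\<in>e. card (incident H v) \<ge> 2}"
      using big[OF that] big[OF x f(1,2)] x that by auto
    then have "card {v, x} \<le> card {v\<in>e. card (incident H v) \<ge> 2}"
      using D(4)[OF e] by (intro card_mono) auto
    ultimately show False using c1 by simp
  qed
  define N where "N = e - {x}"
  define G where "G = (verts H - N, edges H - {e})"
  have eN: "insert x N = e" using x by (auto simp: N_def)
  have fN: "finite N" and cN: "card N = k - 1"
    using D(4)[OF e] D(6)[OF e] x by (auto simp: N_def)
  have NV: "N \<subseteq> verts H" using D(5)[OF e] by (auto simp: N_def)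
  have xG: "x \<in> verts G" using D(5)[OF e] x by (auto simp: G_def N_def)
  have sub: "g \<subseteq> verts G" if "g \<in> edges G" for g
    using that D(5)[of g] only[of _ g] by (auto simp: G_def N_def)
  have kG: "kgraph k G"
    unfolding kgraph_def using sub xG D(1,6) by (auto simp: G_def)
  have VG: "verts G = \<Union>(edges G)"
  proof
    show "verts G \<subseteq> \<Union>(edges G)"
    proof
      fix v assume v: "v \<in> verts G"
      show "v \<in> \<Union>(edges G)"
      proof (cases "v = x")
        case True
        then show ?thesis using f x by (auto simp: G_def)
      next
        case False
        then have "v \<notin> e" "v \<in> verts H" using v by (auto simp: G_def N_def)
        then show ?thesis using V by (auto simp: G_def)
      qed
    qed
  qed (use sub in blast)
  have lG: "linked (edges G)"
    unfolding linked_def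
  proof (intro allI impI)
    fix S assume S: "S \<subseteq> edges G" "S \<noteq> {}" "S \<noteq> edges G"
    have SH: "S \<subseteq> edges H" "e \<notin> S" using S by (auto simp: G_def)
    show "\<exists>a\<in>S. \<exists>b\<in>edges G - S. a \<inter> b \<noteq> {}"
    proof (cases "x \<in> \<Union>S")
      case True
      \<comment> \<open>The removed edge meets the rest only in \<open>x\<close>, so it is added to
        the side containing \<open>x\<close>; a link found at \<open>e\<close> then passes through
        \<open>x\<close> itself.\<close>
      have ne: "insert e S \<noteq> edges H" using S SH by (auto simp: G_def)
      obtain a b where ab: "a \<in> insert e S" "b \<in> edges H" "b \<notin> insert e S" "a \<inter> b \<noteq> {}"
        by (rule linkedD[OF l, of "insert e S"]) (use SH e ne in auto)
      then have bG: "b \<in> edges G - S" by (auto simp: G_def)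
      show ?thesis
      proof (cases "a = e")
        case True
        then have "x \<in> b" using ab only[of _ b] by blast
        then show ?thesis using \<open>x \<in> \<Union>S\<close> bG by blast
      next
        case False
        then show ?thesis using ab bG by blast
      qed
    next
      case False
      obtain a b where ab: "a \<in> S" "b \<in> edges H" "b \<notin> S" "a \<inter> b \<noteq> {}"
        by (rule linkedD[OF l, of S]) (use SH S e in auto)
      have "b \<noteq> e"
      proof
        assume "b = e"
        then have "x \<in> a" using ab only[of _ a] SH by blast
        then show False using False ab by blast
      qed
      then show ?thesis using ab by (auto simp: G_def)
    qed
  qed
  have cE: "card (edges G) = card (edges H) - 1" using e D(2) by (simp add: G_def)
  have "card (verts G) = card (verts H) - (k - 1)"
    using NV fN cN by (simp add: G_def card_Diff_subset)
  then have "card (verts G) = card (edges G) * (k - 1)"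
    unfolding n cE by (simp add: diff_mult_distrib)
  then have "linked_unicyclic k G" using kG VG lG by (simp add: linked_unicyclic_def)
  moreover have "H = (verts G \<union> N, insert (insert x N) (edges G))"
    unfolding eN using NV e by (simp add: G_def Un_absorb2 insert_absorb prod_eq_iff)
  moreover have "N \<inter> verts G = {}" by (auto simp: G_def)
  moreover have "card (edges G) < card (edges H)" using cE m2 by simp
  ultimately show ?thesis using xG fN cN by blast
qed

lemma grown_from_cycle_core:
  assumes "linked_unicyclic k H" "k \<ge> 2"
  shows "\<exists>C \<phi> t. cycle_core k C \<and> grown k C \<phi> t H"
  using assms(1)
proof (induction "card (edges H)" arbitrary: H rule: less_induct)
  case less
  show ?case
  proof (cases "cycle_core k H")
    case True
    then show ?thesis using grown_refl by blast
  next
    case False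
    obtain G x N where G: "linked_unicyclic k G" "x \<in> verts G" "finite N" "card N = k - 1"
      "N \<inter> verts G = {}" "H = (verts G \<union> N, insert (insert x N) (edges G))"
      "card (edges G) < card (edges H)"
      using prune[OF less.prems assms(2) False] by blast
    obtain C \<phi> t where C: "cycle_core k C" "grown k C \<phi> t G" using less.hyps[OF G(7,1)] by blast
    have "grown k C (\<lambda>y. if y \<in> N then \<phi> x else \<phi> y) (t(\<phi> x := Suc (t (\<phi> x)))) H"
      unfolding G(6) by (rule grown_step[OF C(2) G(2-5)])
    then show ?thesis using C(1) by blast
  qed
qed

lemma cycle_core_two:
  assumes "cycle_core k C" "card (edges C) = 2"
  shows "\<exists>u v e1 e2. two_cycle k u v e1 e2 \<and> C = (e1 \<union> e2, {e1, e2})"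
proof -
  have kg: "kgraph k C" and V: "verts C = \<Union>(edges C)"
    and two: "\<And>e. e \<in> edges C \<Longrightarrow> card {v\<in>e. card (incident C v) = 2} = 2"
    using assms by (auto simp: cycle_core_def linked_unicyclic_def)
  note D = kgraphD[OF kg]
  obtain e1 e2 where e: "edges C = {e1, e2}" "e1 \<noteq> e2" using assms(2) by (meson card_2_iff)
  have "{v\<in>e1. card (incident C v) = 2} = e1 \<inter> e2"
  proof -
    have "incident C v = (if v \<in> e2 then {e1, e2} else {e1})" if "v \<in> e1" for v
      using that e by (auto simp: incident_def)
    moreover have "card {e1, e2} = 2" using e(2) by simp
    ultimately show ?thesis by (auto split: if_splits)
  qed
  then have "card (e1 \<inter> e2) = 2" using two[of e1] e by simp
  then obtain u v where "e1 \<inter> e2 = {u, v}" "u \<noteq> v" by (meson card_2_iff)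
  then have "two_cycle k u v e1 e2"
    using e D(4,6) by (simp add: two_cycle_def)
  moreover have "C = (e1 \<union> e2, {e1, e2})" using e V by (simp add: prod_eq_iff)
  ultimately show ?thesis by blast
qed

section \<open>Contracting an edge of a cycle\<close>

lemma cycle_coreD:
  assumes "cycle_core k C"
  shows "kgraph k C" "verts C = \<Union>(edges C)" "linked (edges C)"
    "card (verts C) = card (edges C) * (k - 1)"
    "v \<in> verts C \<Longrightarrow> card (incident C v) \<le> 2"
    "e \<in> edges C \<Longrightarrow> card {v\<in>e. card (incident C v) = 2} = 2"
  using assms by (auto simp: cycle_core_def linked_unicyclic_def)

lemma cycle_core_incident:
  assumes "cycle_core k C" "v \<in> e" "v \<in> f" "e \<in> edges C" "f \<in> edges C" "e \<noteq> f"
  shows "incident C v = {e, f}"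
proof -
  have "{e, f} \<subseteq> incident C v" using assms by (auto simp: incident_def)
  moreover have "v \<in> verts C" using kgraphD(5)[OF cycle_coreD(1)[OF assms(1)] assms(4)] assms(2) by blast
  then have "card (incident C v) \<le> card {e, f}" using cycle_coreD(5)[OF assms(1), of v] assms(6) by simp
  ultimately show ?thesis
    using kgraphD(7)[OF cycle_coreD(1)[OF assms(1)]] by (metis card_seteq)
qed

locale cycle_contraction =
  fixes k :: nat and C :: "'a hgraph" and f e e' :: "'a set" and p q :: 'a
  assumes core: "cycle_core k C" and k: "k \<ge> 3"
    and f: "f \<in> edges C" "f \<noteq> e" "f \<noteq> e'" and e: "e \<in> edges C" "e' \<in> edges C" "e \<noteq> e'"
    and pq: "p \<noteq> q" "p \<in> f" "p \<in> e" "q \<in> f" "q \<in> e'"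
begin

lemmas D = kgraphD[OF cycle_coreD(1)[OF core]]

lemma incident_p: "incident C p = {f, e}" and incident_q: "incident C q = {f, e'}"
  using cycle_core_incident[OF core] f e pq by blast+

lemma p_notin: "p \<notin> e'" and q_notin: "q \<notin> e"
  using incident_p incident_q f e by (auto simp: incident_def)

lemma degree_two_f: "{v\<in>f. card (incident C v) = 2} = {p, q}"
proof -
  have "card {v\<in>f. card (incident C v) = 2} = 2" using cycle_coreD(6)[OF core] f by blast
  moreover have "{p, q} \<subseteq> {v\<in>f. card (incident C v) = 2}"
    using incident_p incident_q f e pq by (auto simp: card_insert_if)
  ultimately show ?thesis
    using D(4)[OF f(1)] pq(1) by (intro card_seteq[symmetric]) auto
qed

lemma meets_f: "v \<in> f \<Longrightarrow> v \<in> g \<Longrightarrow> g \<in> edges C \<Longrightarrow> g \<noteq> f \<Longrightarrow> v = p \<and> g = e \<or> v = q \<and> g = e'"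
proof -
  assume a: "v \<in> f" "v \<in> g" "g \<in> edges C" "g \<noteq> f"
  have i: "incident C v = {f, g}" using cycle_core_incident[OF core] a f by blast
  then have "v \<in> {v\<in>f. card (incident C v) = 2}" using a by auto
  then have "v \<in> {p, q}" using degree_two_f by simp
  then show ?thesis using i incident_p incident_q a by (auto simp: doubleton_eq_iff)
qed

text \<open>The edge \<open>f\<close> is shrunk to its junction \<open>p\<close>: its other
  neighbour \<open>e'\<close> receives \<open>p\<close> in place of \<open>q\<close>.\<close>

definition "e'' = insert p (e' - {q})"
definition "C' = (verts C - (f - {p}), insert e'' (edges C - {f, e'}))"
definition "rep g = (if g = e' then e'' else g)"

text \<open>As \<open>p\<close> lies only on \<open>f\<close> and \<open>e\<close>, the critical
  collision is with \<open>e\<close>. Then all of \<open>e' - {q}\<close> would lie in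
  \<open>e\<close> and have degree 2, but besides \<open>q\<close> the edge \<open>e'\<close> has
  only one such vertex, whereas \<open>k - 1 \<ge> 2\<close>.\<close>

lemma e''_notin: "e'' \<notin> edges C"
proof
  assume a: "e'' \<in> edges C"
  moreover have "p \<in> e''" by (simp add: e''_def)
  ultimately have "e'' \<in> incident C p" by (simp add: incident_def)
  moreover have "e'' \<noteq> f"
    unfolding e''_def
  proof -
    have "card (e' - {q}) = k - 1" using D(4,6)[OF e(2)] pq by simp
    then have "card (e' - {q}) \<noteq> 0" using k by linarith
    then have "e' - {q} \<noteq> {}" by (metis card.empty)
    then obtain z where "z \<in> e'" "z \<noteq> q" by blast
    then have "z \<notin> f" using meets_f[of z e'] e f by metis
    then show "insert p (e' - {q}) \<noteq> f" using \<open>z \<in> e'\<close> \<open>z \<noteq> q\<close> by blast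
  qed
  ultimately have "e'' = e" using incident_p by auto
  then have "e' - {q} \<subseteq> e" by (auto simp: e''_def)
  have "z \<in> {v\<in>e'. card (incident C v) = 2} - {q}" if "z \<in> e' - {q}" for z
  proof -
    have "z \<in> e'" "z \<in> e" "z \<noteq> q" using that \<open>e' - {q} \<subseteq> e\<close> by auto
    moreover have "incident C z = {e', e}"
      using cycle_core_incident[OF core] calculation e by blast
    ultimately show ?thesis using e(3) by simp
  qed
  then have "e' - {q} \<subseteq> {v\<in>e'. card (incident C v) = 2} - {q}" by blast
  then have "card (e' - {q}) \<le> card ({v\<in>e'. card (incident C v) = 2} - {q})"
    using D(4)[OF e(2)] by (intro card_mono) auto
  also have "\<dots> = 1"
    using cycle_coreD(6)[OF core e(2)] incident_q f pq D(4)[OF e(2)] by (simp add: card_Diff_singleton_if)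
  finally show False using D(4,6)[OF e(2)] pq k by simp
qed

lemma edges_C': "edges C' = rep ` (edges C - {f})"
  using e f by (auto simp: C'_def rep_def)

lemma inj_rep: "inj_on rep (edges C)"
  using e''_notin by (auto simp: inj_on_def rep_def)

lemma verts_C': "v \<in> verts C' \<longleftrightarrow> v \<in> verts C \<and> (v = p \<or> v \<notin> f)"
  using D(5)[OF f(1)] pq by (auto simp: C'_def)

lemma p_verts: "p \<in> verts C'"
  using D(5)[OF f(1)] pq verts_C' by auto

lemma in_rep: "v \<notin> f \<Longrightarrow> v \<in> rep g \<longleftrightarrow> v \<in> g"
  using pq by (auto simp: rep_def e''_def)

lemma incident_C': "v \<notin> f \<Longrightarrow> incident C' v = rep ` incident C v"
  unfolding incident_def edges_C' using in_rep by auto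

lemma incident_C'_p: "incident C' p = {e, e''}"
proof -
  have iff: "p \<in> rep g \<longleftrightarrow> g = e \<or> g = e'" if g: "g \<in> edges C - {f}" for g
  proof (cases "g = e'")
    case False
    have "p \<in> g \<longleftrightarrow> g \<in> incident C p" using g by (auto simp: incident_def)
    then show ?thesis using False g incident_p by (simp add: rep_def)
  qed (simp add: rep_def e''_def)
  have "incident C' p = rep ` {g \<in> edges C - {f}. p \<in> rep g}"
    unfolding incident_def edges_C' by blast
  also have "{g \<in> edges C - {f}. p \<in> rep g} = {e, e'}"
  proof (intro equalityI subsetI)
    show "g \<in> {e, e'}" if "g \<in> {g \<in> edges C - {f}. p \<in> rep g}" for g using that iff by blast
    show "g \<in> {g \<in> edges C - {f}. p \<in> rep g}" if "g \<in> {e, e'}" for g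
    proof -
      have "g \<in> edges C - {f}" using that e f by auto
      then show ?thesis using that iff by blast
    qed
  qed
  finally show ?thesis using e by (simp add: rep_def)
qed

lemma e''_ne: "e \<noteq> e''"
  using e''_notin e by auto

lemma card_incident_C': "v \<in> verts C' \<Longrightarrow> card (incident C' v) = card (incident C v)"
proof (cases "v = p")
  case True
  then show ?thesis using incident_C'_p incident_p e''_ne f by simp
next
  case False
  assume "v \<in> verts C'"
  then have "v \<notin> f" using False verts_C' by auto
  moreover have "inj_on rep (incident C v)"
    using inj_rep by (rule inj_on_subset) (auto simp: incident_def)
  ultimately show ?thesis using incident_C' by (simp add: card_image)
qed

lemma sub_C': "g \<in> edges C - {f} \<Longrightarrow> rep g \<subseteq> verts C'"
proof
  fix v assume g: "g \<in> edges C - {f}" and v: "v \<in> rep g"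
  show "v \<in> verts C'"
  proof (cases "v = p")
    case True
    then show ?thesis using p_verts by simp
  next
    case False
    then have vg: "v \<in> g" "g = e' \<longrightarrow> v \<noteq> q" using v by (auto simp: rep_def e''_def split: if_splits)
    then have "v \<notin> f" using meets_f[of v g] g False by blast
    then show ?thesis using vg D(5)[of g] g verts_C' by auto
  qed
qed

lemma kgraph_C': "kgraph k C'"
  unfolding kgraph_def
proof (intro conjI ballI)
  show "finite (verts C')" using D(1) by (simp add: C'_def)
  show "verts C' \<noteq> {}" using p_verts by auto
  fix g assume "g \<in> edges C'"
  then obtain h where h: "h \<in> edges C - {f}" "g = rep h" using edges_C' by auto
  show "g \<subseteq> verts C'" using sub_C' h by simp
  have "card e'' = card e'"
    using p_notin pq(5) D(4)[OF e(2)] unfolding e''_def by (metis card.remove card_insert_disjoint finite_Diff insert_Diff1 Diff_iff)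
  then show "card g = k" using h D(6)[of h] D(6)[OF e(2)] by (auto simp: rep_def)
qed

lemma card_edges_C': "Suc (card (edges C')) = card (edges C)"
proof -
  have "card (edges C') = card (edges C - {f})"
    unfolding edges_C' by (rule card_image[OF inj_on_subset[OF inj_rep]]) auto
  then show ?thesis using f(1) D(2) by (metis card_Suc_Diff1)
qed

text \<open>A separation \<open>S'\<close> of the contracted graph is pulled back to
  \<open>C\<close>. If \<open>e\<close> and \<open>e'\<close> fall on different sides,
  \<open>p\<close> links them; otherwise \<open>f\<close> is put on the side of both its neighbours,
  and a link in \<open>C\<close> cannot involve \<open>f\<close>.\<close>

lemma linked_C': "linked (edges C')"
  unfolding linked_def
proof (intro allI impI)
  fix S' assume S': "S' \<subseteq> edges C'" "S' \<noteq> {}" "S' \<noteq> edges C'"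
  define S where "S = {g \<in> edges C - {f}. rep g \<in> S'}"
  have SS: "S' = rep ` S" using S' unfolding S_def edges_C' by auto
  have S1: "S \<subseteq> edges C - {f}" unfolding S_def by blast
  have S2: "S \<noteq> {}" using S'(2) SS by (metis image_empty)
  have S3: "S \<noteq> edges C - {f}" using S'(3) SS edges_C' by metis
  note S = S1 S2 S3
  have out: "rep g \<in> edges C' - S'" if "g \<in> edges C" "g \<noteq> f" "g \<notin> S" for g
    using that unfolding S_def edges_C' by auto
  have meet: "rep a \<inter> rep b \<noteq> {}" if ab: "a \<in> edges C - {f}" "b \<in> edges C - {f}" "a \<noteq> b" "a \<inter> b \<noteq> {}" for a b
  proof -
    obtain z where z: "z \<in> a" "z \<in> b" using ab by blast
    have "z \<noteq> q"
    proof
      assume "z = q"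
      then have "a \<in> incident C q" "b \<in> incident C q" using z ab by (auto simp: incident_def)
      then show False using incident_q ab by auto
    qed
    then have "z \<in> rep a" "z \<in> rep b" using z by (auto simp: rep_def e''_def)
    then show ?thesis by blast
  qed
  have pe: "p \<in> rep e" "p \<in> rep e'" using pq e by (auto simp: rep_def e''_def)
  show "\<exists>a\<in>S'. \<exists>b\<in>edges C' - S'. a \<inter> b \<noteq> {}"
  proof (cases "e \<in> S \<longleftrightarrow> e' \<in> S")
    case False
    then show ?thesis
    proof (cases "e \<in> S")
      case True
      then have "rep e \<in> S'" "rep e' \<in> edges C' - S'" using False SS out e f by auto
      then show ?thesis using pe by blast
    next
      case F: False
      then have "rep e' \<in> S'" "rep e \<in> edges C' - S'" using False SS out e f by auto
      then show ?thesis using pe by blast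
    qed
  next
    case same: True
    define T where "T = (if e \<in> S then insert f S else S)"
    have "T \<subseteq> edges C" "T \<noteq> {}" "T \<noteq> edges C" using S f by (auto simp: T_def)
    then obtain a b where ab: "a \<in> T" "b \<in> edges C" "b \<notin> T" "a \<inter> b \<noteq> {}"
      using linkedD[OF cycle_coreD(3)[OF core]] by metis
    have "a \<noteq> f"
    proof
      assume a: "a = f"
      then have "e \<in> S" using ab S by (auto simp: T_def split: if_splits)
      moreover have "b = e \<or> b = e'" using meets_f ab a \<open>e \<in> S\<close> by (auto simp: T_def)
      ultimately show False using ab same by (auto simp: T_def)
    qed
    moreover have "b \<noteq> f"
    proof
      assume b: "b = f"
      then have "e \<notin> S" using ab by (auto simp: T_def split: if_splits)
      then have "a \<in> S" using ab by (simp add: T_def)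
      then have "a \<in> edges C" using S by auto
      then have "a = e \<or> a = e'" using meets_f ab b \<open>a \<noteq> f\<close> by blast
      then show False using \<open>a \<in> S\<close> \<open>e \<notin> S\<close> same by auto
    qed
    ultimately have aS: "a \<in> S" "b \<notin> S" using ab by (auto simp: T_def split: if_splits)
    then have "rep a \<in> S'" "rep b \<in> edges C' - S'" using SS out ab \<open>b \<noteq> f\<close> by auto
    moreover have "rep a \<inter> rep b \<noteq> {}"
      using aS ab S \<open>b \<noteq> f\<close> by (intro meet) auto
    ultimately show ?thesis by blast
  qed
qed

lemma cycle_core_C': "cycle_core k C'"
proof -
  have "verts C' = \<Union>(edges C')"
  proof
    show "verts C' \<subseteq> \<Union>(edges C')"
    proof
      fix v assume v: "v \<in> verts C'"
      show "v \<in> \<Union>(edges C')"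
      proof (cases "v = p")
        case True
        then show ?thesis using incident_C'_p by (auto simp: incident_def)
      next
        case False
        then have "v \<notin> f" "v \<in> verts C" using v verts_C' by auto
        then obtain g where "g \<in> edges C - {f}" "v \<in> rep g"
          using cycle_coreD(2)[OF core] in_rep by blast
        then show ?thesis using edges_C' by blast
      qed
    qed
  qed (use sub_C' edges_C' in auto)
  moreover have "card (verts C') = card (edges C') * (k - 1)"
  proof -
    have "card (f - {p}) = k - 1" using D(4,6)[OF f(1)] pq by simp
    then have "card (verts C') = card (verts C) - (k - 1)"
      using D(4,5)[OF f(1)] by (simp add: C'_def card_Diff_subset subset_iff)
    then show ?thesis using cycle_coreD(4)[OF core] card_edges_C' by (metis diff_add_inverse mult_Suc)
  qed
  moreover have "card {v\<in>g. card (incident C' v) = 2} = 2" if g: "g \<in> edges C'" for g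
  proof -
    obtain h where h: "h \<in> edges C - {f}" "g = rep h" using g edges_C' by auto
    have "{v\<in>g. card (incident C' v) = 2} = {v\<in>g. card (incident C v) = 2}"
      using sub_C'[OF h(1)] h(2) card_incident_C' by auto
    also have "card \<dots> = 2"
    proof (cases "h = e'")
      case False
      then show ?thesis using h cycle_coreD(6)[OF core, of h] by (simp add: rep_def)
    next
      case True
      let ?A = "{v\<in>e'. card (incident C v) = 2}"
      have q2: "q \<in> ?A" using incident_q f pq by simp
      have "{v\<in>g. card (incident C v) = 2} = insert p (?A - {q})"
      proof -
        have "card (incident C p) = 2" using incident_p f by simp
        moreover have "g = insert p (e' - {q})" using True h by (simp add: rep_def e''_def)
        ultimately show ?thesis by auto
      qed
      moreover have "p \<notin> ?A - {q}" "finite (?A - {q})" using p_notin D(4)[OF e(2)] by auto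
      moreover have "card (?A - {q}) = 1"
        using q2 cycle_coreD(6)[OF core e(2)] D(4)[OF e(2)] by (simp add: card_Diff_singleton_if)
      ultimately show ?thesis by simp
    qed
    finally show ?thesis .
  qed
  moreover have "card (incident C' v) \<le> 2" if "v \<in> verts C'" for v
    using card_incident_C'[OF that] cycle_coreD(5)[OF core] that verts_C' by auto
  ultimately show ?thesis
    unfolding cycle_core_def linked_unicyclic_def using kgraph_C' linked_C' by blast
qed

text \<open>On \<open>f\<close> every vertex gives what remains after its other commitments
  \<open>X v\<close>; at \<open>q\<close> these include the label that \<open>e''\<close> has at
  \<open>p\<close>. The vertex condition at \<open>p\<close> in the contracted graph says precisely
  that the \<open>X v\<close> sum to at most \<open>1 - 1 / r\<close>, so the product over
  \<open>f\<close> is at least \<open>1 / r\<close>.\<close>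

lemma feasible_contract:
  fixes t :: "'a \<Rightarrow> real"
  assumes r: "r > 0" and t: "\<And>v. v \<in> verts C \<Longrightarrow> 0 \<le> t v"
    and feas: "feasible r C' (t(p := 1 + (\<Sum>v\<in>f. t v)))"
  shows "feasible r C t"
proof -
  obtain B where B: "\<And>g v. g \<in> edges C' \<Longrightarrow> v \<in> g \<Longrightarrow> 0 < B v g"
    "\<And>g. g \<in> edges C' \<Longrightarrow> 1 / r \<le> (\<Prod>v\<in>g. B v g)"
    "\<And>v. v \<in> verts C' \<Longrightarrow> (\<Sum>g\<in>incident C' v. B v g) + (t(p := 1 + (\<Sum>v\<in>f. t v))) v / r \<le> 1"
    using feas unfolding feasible_def by blast
  define X where "X v = t v / r + (if v = p then B p e else if v = q then B p e'' else 0)" for v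
  define B' where "B' v g = (if g = f then 1 - X v else if v = q \<and> g = e' then B p e'' else B v (rep g))"
    for v g
  have eC: "e \<in> edges C'" "e'' \<in> edges C'" using e f edges_C' by (auto simp: rep_def)
  have Bp: "0 < B p e" "0 < B p e''" using B(1) eC pq by (auto simp: e''_def)
  have tf: "0 \<le> t v" if "v \<in> f" for v using t that D(5)[OF f(1)] by blast
  have X0: "X v \<ge> 0" if "v \<in> f" for v
    using tf[OF that] r Bp by (auto simp: X_def)
  have ff: "finite f" using D(4) f by blast
  have "(\<Sum>v\<in>f. X v) = (\<Sum>v\<in>f. t v / r) + (\<Sum>v\<in>f. if v = p then B p e else if v = q then B p e'' else 0)"
    by (simp add: X_def sum.distrib)
  also have "(\<Sum>v\<in>f. if v = p then B p e else if v = q then B p e'' else 0) =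
      (\<Sum>v\<in>f. (if v = p then B p e else 0) + (if v = q then B p e'' else 0))"
    using pq by (intro sum.cong) auto
  also have "\<dots> = B p e + B p e''" using pq ff by (simp add: sum.distrib)
  finally have sX: "(\<Sum>v\<in>f. X v) = (\<Sum>v\<in>f. t v) / r + B p e + B p e''"
    by (simp add: sum_divide_distrib)
  have "B p e + B p e'' + (1 + (\<Sum>v\<in>f. t v)) / r \<le> 1"
    using B(3)[OF p_verts] e''_ne unfolding incident_C'_p by simp
  then have sX1: "(\<Sum>v\<in>f. X v) \<le> 1 - 1 / r" unfolding sX by (simp add: add_divide_distrib)
  have X1: "X v \<le> 1 - 1 / r" if "v \<in> f" for v
    using sX1 member_le_sum[of v f X] X0 that ff by fastforce
  have r1: "1 / r > 0" using r by simp
  show ?thesis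
    unfolding feasible_def
  proof (intro exI[of _ B'] conjI ballI)
    fix g assume g: "g \<in> edges C"
    show "0 < B' v g" if v: "v \<in> g" for v
    proof (cases "g = f")
      case True
      then have "X v \<le> 1 - 1 / r" using X1 v by blast
      then have "X v < 1" using r1 by linarith
      then show ?thesis using True by (simp add: B'_def)
    next
      case False
      then have "rep g \<in> edges C'" using g edges_C' by auto
      moreover have "v \<in> rep g \<or> v = q \<and> g = e'" using v by (auto simp: rep_def e''_def)
      ultimately show ?thesis using False Bp B(1) by (auto simp: B'_def)
    qed
    show "1 / r \<le> (\<Prod>v\<in>g. B' v g)"
    proof (cases "g = f")
      case True
      have "1 / r \<le> 1 - (\<Sum>v\<in>f. X v)" using sX1 by simp
      also have "\<dots> \<le> (\<Prod>v\<in>f. 1 - X v)"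
      proof (rule prod_one_minus_ge[OF ff X0])
        show "X v \<le> 1" if "v \<in> f" for v using X1[OF that] r1 by linarith
      qed
      finally show ?thesis using True by (simp add: B'_def)
    next
      case False
      show ?thesis
      proof (cases "g = e'")
        case True
        have "(\<Prod>v\<in>e'. B' v e') = B' q e' * (\<Prod>v\<in>e' - {q}. B' v e')"
          using D(4)[OF e(2)] pq by (simp add: prod.remove)
        also have "\<dots> = B p e'' * (\<Prod>v\<in>e' - {q}. B v e'')"
          using f by (intro arg_cong2[of _ _ _ _ "(*)"] prod.cong) (auto simp: B'_def rep_def)
        also have "\<dots> = (\<Prod>v\<in>e''. B v e'')"
          using D(4)[OF e(2)] p_notin unfolding e''_def by simp
        finally show ?thesis using B(2)[OF eC(2)] True by simp
      next
        case F: False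
        have "g \<in> edges C'" using g False F by (auto simp: C'_def)
        then show ?thesis using B(2)[of g] False F by (simp add: B'_def rep_def)
      qed
    qed
  next
    fix v assume v: "v \<in> verts C"
    show "(\<Sum>g\<in>incident C v. B' v g) + t v / r \<le> 1"
    proof (cases "v \<in> f")
      case True
      show ?thesis
      proof (cases "v \<in> {p, q}")
        case True
        then consider "v = p" | "v = q" by blast
        then show ?thesis
        proof cases
          case 1
          have "B' p f = 1 - X p" "B' p e = B p e" using f e pq by (auto simp: B'_def rep_def)
          then show ?thesis using 1 incident_p f by (simp add: X_def)
        next
          case 2
          have "B' q f = 1 - X q" "B' q e' = B p e''" using f e pq by (auto simp: B'_def)
          then show ?thesis using 2 incident_q f pq by (simp add: X_def)
        qed
      next
        case False
        have "incident C v = {f}"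
        proof (intro equalityI subsetI)
          show "g \<in> {f}" if "g \<in> incident C v" for g
            using meets_f[OF True, of g] that False unfolding incident_def by blast
          show "g \<in> incident C v" if "g \<in> {f}" for g
            using that True f(1) by (simp add: incident_def)
        qed
        then show ?thesis using False by (simp add: B'_def X_def)
      qed
    next
      case False
      then have v': "v \<in> verts C'" "v \<noteq> p" using v verts_C' pq by auto
      have "(\<Sum>g\<in>incident C' v. B v g) = (\<Sum>g\<in>incident C v. B v (rep g))"
        unfolding incident_C'[OF False]
        by (subst sum.reindex) (auto intro: inj_on_subset[OF inj_rep] simp: incident_def)
      also have "\<dots> = (\<Sum>g\<in>incident C v. B' v g)"
        using False pq by (intro sum.cong) (auto simp: B'_def incident_def)
      finally show ?thesis using B(3)[OF v'(1)] v'(2) by simp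
    qed
  qed
qed

end

text \<open>Two different neighbours exist because otherwise \<open>f\<close> and its only neighbour
  would spend all their junctions on each other, leaving no link to a third edge.\<close>

lemma cycle_contraction_ex:
  assumes core: "cycle_core k C" and k: "k \<ge> 3" and c: "card (edges C) \<ge> 3" and f: "f \<in> edges C"
  shows "\<exists>e e' p q. cycle_contraction k C f e e' p q"
proof -
  note D = kgraphD[OF cycle_coreD(1)[OF core]]
  have "card {v\<in>f. card (incident C v) = 2} = 2" using cycle_coreD(6)[OF core f] .
  then obtain p q where pq: "{v\<in>f. card (incident C v) = 2} = {p, q}" "p \<noteq> q" by (meson card_2_iff)
  have other: "\<exists>e\<in>edges C. e \<noteq> f \<and> v \<in> e" if "v \<in> {p, q}" for v
  proof -
    have v: "v \<in> f" "card (incident C v) = 2" using that pq by auto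
    have "incident C v \<noteq> {f}" using v(2) by auto
    moreover have "f \<in> incident C v" using v(1) f by (simp add: incident_def)
    ultimately obtain e where "e \<in> incident C v" "e \<noteq> f" by blast
    then show ?thesis unfolding incident_def by blast
  qed
  obtain e e' where e: "e \<in> edges C" "e \<noteq> f" "p \<in> e" "e' \<in> edges C" "e' \<noteq> f" "q \<in> e'"
    using other by (meson insertI1 insertI2)
  have pf: "p \<in> f" "q \<in> f" using pq by auto
  have "e \<noteq> e'"
  proof
    assume ee: "e = e'"
    have i: "incident C p = {f, e}" "incident C q = {f, e}"
      using cycle_core_incident[OF core] e pf f ee by blast+
    have "{p, q} \<subseteq> {v\<in>e. card (incident C v) = 2}" using i e ee by auto
    then have De: "{v\<in>e. card (incident C v) = 2} = {p, q}"
      using cycle_coreD(6)[OF core e(1)] pq(2) D(4)[OF e(1)] by (intro card_seteq[symmetric]) auto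
    have ne: "{f, e} \<noteq> edges C"
    proof
      assume "{f, e} = edges C"
      then have "card (edges C) = card {f, e}" by simp
      also have "\<dots> \<le> 2" by (simp add: card_insert_if)
      finally show False using c by simp
    qed
    obtain a b where ab: "a \<in> {f, e}" "b \<in> edges C" "b \<notin> {f, e}" "a \<inter> b \<noteq> {}"
      by (rule linkedD[OF cycle_coreD(3)[OF core], of "{f, e}"]) (use ne f e in simp_all)
    then obtain z where z: "z \<in> a" "z \<in> b" by blast
    have iz: "incident C z = {a, b}"
      using cycle_core_incident[OF core z] ab f e by blast
    have "a \<noteq> b" using ab by blast
    then have "card (incident C z) = 2" unfolding iz by simp
    then have "z \<in> {v\<in>a. card (incident C v) = 2}" using z(1) by blast
    then have "z \<in> {p, q}" using ab(1) pq(1) De by blast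
    then have "incident C z = {f, e}" using i by blast
    then show False using iz ab(3) by blast
  qed
  then show ?thesis
    using core k f e pf pq(2)
    by (intro exI[of _ e] exI[of _ e'] exI[of _ p] exI[of _ q] cycle_contraction.intro) simp_all
qed

section \<open>Cycles of length two and three\<close>

text \<open>Vertices other than the two junctions spend everything left on the edge; what the
  junctions must then supply is the product \<open>1 / (r - s)\<close>, with \<open>s\<close> the
  weight off the junctions.\<close>

lemma edge_label_bound:
  fixes t :: "'a \<Rightarrow> real"
  assumes e: "finite e" "u \<in> e" "v \<in> e" "u \<noteq> v" and r: "r > 0"
    and t: "\<And>w. w \<in> e \<Longrightarrow> 0 \<le> t w" and s: "(\<Sum>w\<in>e - {u, v}. t w) < r"
    and B: "\<And>w. w \<in> e - {u, v} \<Longrightarrow> B w = 1 - t w / r" "0 < B u" "0 < B v"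
      "1 / (r - (\<Sum>w\<in>e - {u, v}. t w)) \<le> B u * B v"
  shows "(\<forall>w\<in>e. 0 < B w) \<and> 1 / r \<le> (\<Prod>w\<in>e. B w)"
proof
  define s where "s = (\<Sum>w\<in>e - {u, v}. t w)"
  have ts: "t w \<le> s" if "w \<in> e - {u, v}" for w
    unfolding s_def using that t e by (intro member_le_sum) auto
  have sr: "s < r" using assms by (simp add: s_def)
  have s0: "s \<ge> 0" unfolding s_def using t by (intro sum_nonneg) auto
  have small: "t w / r < 1" if "w \<in> e - {u, v}" for w using ts[OF that] sr r by simp
  show "\<forall>w\<in>e. 0 < B w"
  proof
    fix w assume w: "w \<in> e"
    show "0 < B w"
    proof (cases "w \<in> {u, v}")
      case False
      then have "w \<in> e - {u, v}" using w by blast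
      then show ?thesis using small B(1) by fastforce
    qed (use B in blast)
  qed
  have "(\<Prod>w\<in>e. B w) = B u * (\<Prod>w\<in>e - {u}. B w)" by (rule prod.remove) (use e in auto)
  also have "(\<Prod>w\<in>e - {u}. B w) = B v * (\<Prod>w\<in>e - {u} - {v}. B w)"
    by (rule prod.remove) (use e in auto)
  also have "e - {u} - {v} = e - {u, v}" by auto
  also have "(\<Prod>w\<in>e - {u, v}. B w) = (\<Prod>w\<in>e - {u, v}. 1 - t w / r)"
    by (rule prod.cong[OF refl B(1)])
  finally have P: "(\<Prod>w\<in>e. B w) = B u * B v * (\<Prod>w\<in>e - {u, v}. 1 - t w / r)" by simp
  have "1 - (\<Sum>w\<in>e - {u, v}. t w / r) \<le> (\<Prod>w\<in>e - {u, v}. 1 - t w / r)"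
    using e t r small by (intro prod_one_minus_ge) (auto simp: less_imp_le)
  then have Q: "1 - s / r \<le> (\<Prod>w\<in>e - {u, v}. 1 - t w / r)" by (simp add: s_def sum_divide_distrib)
  have "1 / r = 1 / (r - s) * (1 - s / r)" using r sr by (simp add: field_simps)
  also have "\<dots> \<le> (B u * B v) * (\<Prod>w\<in>e - {u, v}. 1 - t w / r)"
    using B(2-4) Q sr r by (intro mult_mono) (auto simp: s_def)
  finally show "1 / r \<le> (\<Prod>w\<in>e. B w)" by (simp add: P)
qed

text \<open>The capacities at \<open>u\<close> and \<open>v\<close> are both split between the edges
  in the ratio \<open>g1 : g2\<close>, the square roots of the demands \<open>r / (r - s1)\<close>
  and \<open>r / (r - s2)\<close>. This works once \<open>(g1 + g2)^2 * r\<close> is at most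
  \<open>(r - t u) * (r - t v)\<close>.\<close>

lemma feasible_two_cycle:
  fixes t :: "'a \<Rightarrow> real"
  assumes c: "two_cycle k u v e1 e2" and r: "r > 0" and t: "\<And>w. w \<in> e1 \<union> e2 \<Longrightarrow> 0 \<le> t w"
    and s: "(\<Sum>w\<in>e1 \<union> e2 - {u, v}. t w) = s" "s < r" and uv: "t u < r" "t v < r"
    and le: "2 * r * (2 + s / (r - s)) \<le> (r - t u) * (r - t v)"
  shows "feasible r (e1 \<union> e2, {e1, e2}) t"
proof -
  note D = two_cycleD[OF c]
  define s1 where "s1 = (\<Sum>w\<in>e1 - {u, v}. t w)"
  define s2 where "s2 = (\<Sum>w\<in>e2 - {u, v}. t w)"
  have "e1 \<union> e2 - {u, v} = (e1 - {u, v}) \<union> (e2 - {u, v})" by auto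
  then have ss: "s = s1 + s2"
    unfolding s(1)[symmetric] s1_def s2_def using D by (auto intro!: sum.union_disjoint)
  have s0: "s1 \<ge> 0" "s2 \<ge> 0" unfolding s1_def s2_def using t by (auto intro!: sum_nonneg)
  define g1 where "g1 = sqrt (r / (r - s1))"
  define g2 where "g2 = sqrt (r / (r - s2))"
  have g: "g1 > 0" "g2 > 0" "g1\<^sup>2 = r / (r - s1)" "g2\<^sup>2 = r / (r - s2)"
    using r s0 ss s(2) by (auto simp: g1_def g2_def)
  have "(g1 + g2)\<^sup>2 \<le> 2 * (g1\<^sup>2 + g2\<^sup>2)"
    using sum_squares_bound[of g1 g2] by (simp add: power2_sum)
  also have "\<dots> = 2 * (2 + (s1 / (r - s1) + s2 / (r - s2)))"
  proof -
    have "r / (r - s1) = 1 + s1 / (r - s1)" "r / (r - s2) = 1 + s2 / (r - s2)"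
      using s0 ss s(2) by (auto simp: field_simps)
    then show ?thesis using g by simp
  qed
  also have "\<dots> \<le> 2 * (2 + s / (r - s))" 
    using frac_add_le[of s1 s2 r] s0 s(2) unfolding ss by (intro mult_left_mono add_left_mono) auto
  finally have "(g1 + g2)\<^sup>2 * r \<le> 2 * (2 + s / (r - s)) * r" using r by (intro mult_right_mono) auto
  then have G: "(g1 + g2)\<^sup>2 * r \<le> (r - t u) * (r - t v)" using le by (simp add: mult_ac)
  define c where "c e = (if e = e1 then g1 else g2) / (g1 + g2)" for e
  have cs: "c e1 + c e2 = 1" "c e1 > 0" "c e2 > 0"
    using g D(6) by (auto simp: c_def add_divide_distrib[symmetric])
  define B where "B w e = (if w = u then (r - t u) / r * c e else if w = v then (r - t v) / r * c e
    else 1 - t w / r)" for w e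
  have Buv: "(r - t u) / r * c e * ((r - t v) / r * c e) \<ge> (g1 + g2)\<^sup>2 * (c e)\<^sup>2 / r" for e
  proof -
    have "(g1 + g2)\<^sup>2 * r * ((c e)\<^sup>2 / r\<^sup>2) \<le> (r - t u) * (r - t v) * ((c e)\<^sup>2 / r\<^sup>2)"
      by (intro mult_right_mono G) auto
    then show ?thesis using r by (simp add: power2_eq_square mult_ac)
  qed
  have c1: "(g1 + g2)\<^sup>2 * (c e1)\<^sup>2 / r = 1 / (r - s1)" "(g1 + g2)\<^sup>2 * (c e2)\<^sup>2 / r = 1 / (r - s2)"
    using g D(6) r by (auto simp: c_def power_divide)
  have b: "(\<forall>w\<in>e. 0 < B w e) \<and> 1 / r \<le> (\<Prod>w\<in>e. B w e)" if e: "e \<in> {e1, e2}" for e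
  proof (rule edge_label_bound[where t = t and u = u and v = v])
    show "finite e" "u \<in> e" "v \<in> e" "u \<noteq> v" using D e by auto
    show "0 \<le> t w" if "w \<in> e" for w using t that e by auto
    show "(\<Sum>w\<in>e - {u, v}. t w) < r" using e s0 ss s(2) by (auto simp: s1_def[symmetric] s2_def[symmetric])
    show "B w e = 1 - t w / r" if "w \<in> e - {u, v}" for w using that by (auto simp: B_def)
    have ce: "c e > 0" using cs e by auto
    show "0 < B u e" "0 < B v e" using D(5) ce uv r by (auto simp: B_def)
    have "1 / (r - (\<Sum>w\<in>e - {u, v}. t w)) = (g1 + g2)\<^sup>2 * (c e)\<^sup>2 / r"
      using e c1 by (auto simp: s1_def s2_def)
    then show "1 / (r - (\<Sum>w\<in>e - {u, v}. t w)) \<le> B u e * B v e"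
      using Buv[of e] D(5) by (simp add: B_def)
  qed (rule r)
  have "(\<Sum>e\<in>incident (e1 \<union> e2, {e1, e2}) w. B w e) + t w / r \<le> 1" if w: "w \<in> e1 \<union> e2" for w
  proof (cases "w \<in> {u, v}")
    case True
    then have "incident (e1 \<union> e2, {e1, e2}) w = {e1, e2}" using D by (auto simp: incident_def)
    then have "(\<Sum>e\<in>incident (e1 \<union> e2, {e1, e2}) w. B w e) = B w e1 + B w e2" using D by simp
    also have "\<dots> = (r - t w) / r * (c e1 + c e2)"
      using True D(5) by (auto simp: B_def distrib_left)
    finally show ?thesis using cs r by (simp add: field_simps)
  next
    case False
    then have "w \<notin> e1 \<inter> e2" using D by blast
    then have "incident (e1 \<union> e2, {e1, e2}) w = {if w \<in> e1 then e1 else e2}"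
      using w unfolding incident_def by (cases "w \<in> e1") auto
    then show ?thesis using False by (auto simp: B_def)
  qed
  then show ?thesis unfolding feasible_def using b by (intro exI[of _ B]) auto
qed

section \<open>Cycles with three edges, \<open>ea\<close> being the edge opposite
  \<open>a\<close>\<close>

locale triangle_core =
  fixes k :: nat and C :: "'a hgraph" and a b c :: 'a and ea eb ec :: "'a set"
  assumes core: "cycle_core k C" and k: "k \<ge> 3"
    and E: "edges C = {ea, eb, ec}" "ea \<noteq> eb" "eb \<noteq> ec" "ec \<noteq> ea"
    and V: "a \<noteq> b" "b \<noteq> c" "c \<noteq> a" "b \<in> ea" "c \<in> ea" "c \<in> eb" "a \<in> eb" "a \<in> ec" "b \<in> ec"

lemma triangle_rotate: "triangle_core k C a b c ea eb ec \<Longrightarrow> triangle_core k C b c a eb ec ea"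
  unfolding triangle_core_def by auto

context triangle_core
begin

lemmas D = kgraphD[OF cycle_coreD(1)[OF core]]

lemma inEC: "ea \<in> edges C" "eb \<in> edges C" "ec \<in> edges C"
  using E by auto

lemma inc: "incident C a = {eb, ec}" "incident C b = {ea, ec}" "incident C c = {ea, eb}"
  using cycle_core_incident[OF core V(7,8)] cycle_core_incident[OF core V(4,9)]
    cycle_core_incident[OF core V(5,6)] inEC E by auto

lemma notin: "a \<notin> ea" "b \<notin> eb" "c \<notin> ec"
  using inc E inEC unfolding incident_def by blast+

lemma contraction: "cycle_contraction k C ea ec eb b c"
  by (rule cycle_contraction.intro) (use core k E V inEC in auto)

lemma shared:
  assumes "w \<in> e" "w \<in> f" "e \<in> edges C" "f \<in> edges C" "e \<noteq> f"
  shows "w \<in> {a, b, c}"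
proof -
  have C2: "cycle_contraction k C ec eb ea a b"
    by (rule cycle_contraction.intro) (use core k E V inEC in auto)
  consider "e = ea" | "f = ea" | "e = ec" | "f = ec" using assms E(1) by auto
  then show ?thesis
    using assms cycle_contraction.meets_f[OF contraction, of w] cycle_contraction.meets_f[OF C2, of w]
    by cases blast+
qed

text \<open>Contracting \<open>ea\<close> into \<open>b\<close> leaves a two-edge cycle with
  junctions \<open>b\<close> and \<open>a\<close>; all weight of \<open>ea\<close>, and 1 for the
  edge itself, is collected in \<open>A\<close>.\<close>

lemma feasible_by_contraction:
  fixes t :: "'a \<Rightarrow> real"
  assumes r: "r > 0" and t: "\<And>w. w \<in> verts C \<Longrightarrow> 0 \<le> t w"
    and s: "(\<Sum>w\<in>eb - {a, c}. t w) + (\<Sum>w\<in>ec - {a, b}. t w) = s" "s < r"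
    and A: "1 + (\<Sum>w\<in>ea. t w) = A" "A < r" "t a < r"
    and le: "2 * r * (2 + s / (r - s)) \<le> (r - A) * (r - t a)"
  shows "feasible r C t"
proof -
  interpret A: cycle_contraction k C ea ec eb b c by (rule contraction)
  have fin: "finite eb" "finite ec" using D(4) inEC by auto
  have e'': "A.e'' = insert b (eb - {c})" by (simp add: A.e''_def)
  have ebc: "eb \<inter> ec = {a}"
  proof
    show "eb \<inter> ec \<subseteq> {a}" using shared[of _ eb ec] inEC E(3) notin by blast
  qed (use V in blast)
  have EC': "edges A.C' = {ec, A.e''}" using E by (auto simp: A.C'_def)
  have VC': "verts A.C' = ec \<union> A.e''"
    using cycle_coreD(2)[OF A.cycle_core_C'] EC' by simp
  have C': "A.C' = (ec \<union> A.e'', {ec, A.e''})" using EC' VC' by (simp add: prod_eq_iff)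
  have "A.e'' \<in> edges A.C'" "ec \<in> edges A.C'" using EC' by auto
  then have "finite A.e''" "finite ec" "card A.e'' = k" "card ec = k"
    using kgraphD(4,6)[OF A.kgraph_C'] by auto
  moreover have "ec \<inter> A.e'' = {b, a}" unfolding e'' using ebc V notin by blast
  ultimately have tc: "two_cycle k b a ec A.e''"
    using A.e''_ne V unfolding two_cycle_def by auto
  have "feasible r A.C' (t(b := 1 + (\<Sum>w\<in>ea. t w)))"
    unfolding C'
  proof (rule feasible_two_cycle[OF tc r])
    let ?t = "t(b := 1 + (\<Sum>w\<in>ea. t w))"
    have "0 \<le> (\<Sum>w\<in>ea. t w)" using t D(5)[OF inEC(1)] by (intro sum_nonneg) auto
    then show "0 \<le> ?t w" if "w \<in> ec \<union> A.e''" for w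
      using that t D(5) inEC VC' A.verts_C' by auto
    have "ec \<union> A.e'' - {b, a} = (eb - {a, c}) \<union> (ec - {a, b})"
      unfolding e'' using notin V by blast
    then have "(\<Sum>w\<in>ec \<union> A.e'' - {b, a}. ?t w) = (\<Sum>w\<in>(eb - {a, c}) \<union> (ec - {a, b}). t w)"
      using notin by (intro sum.cong) auto
    also have "\<dots> = s" unfolding s(1)[symmetric] using fin ebc by (intro sum.union_disjoint) auto
    finally show "(\<Sum>w\<in>ec \<union> A.e'' - {b, a}. ?t w) = s" .
    show "?t b < r" "?t a < r" using A V by auto
    show "2 * r * (2 + s / (r - s)) \<le> (r - ?t b) * (r - ?t a)" using le A V by simp
  qed (rule s)
  then show ?thesis using A.feasible_contract[OF r, of t] t by blast
qed

text \<open>By \<open>edge_label_bound\<close> the six labels at the junctions determine the rest.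
  Here \<open>pab\<close> is the label at \<open>a\<close> on the edge shared with \<open>b\<close>,
  and similarly for the others.\<close>

lemma feasible_by_labels:
  fixes t :: "'a \<Rightarrow> real" and pab pba pac pca pbc pcb :: real
  assumes r: "r > 0" and t: "\<And>w. w \<in> verts C \<Longrightarrow> 0 \<le> t w"
    and s: "(\<Sum>w\<in>ea - {b, c}. t w) = sa" "(\<Sum>w\<in>eb - {a, c}. t w) = sb" "(\<Sum>w\<in>ec - {a, b}. t w) = sc"
      "sa < r" "sb < r" "sc < r"
    and p: "0 < pab" "0 < pba" "0 < pac" "0 < pca" "0 < pbc" "0 < pcb"
    and e: "1 / (r - sa) \<le> pbc * pcb" "1 / (r - sb) \<le> pac * pca" "1 / (r - sc) \<le> pab * pba"
    and v: "pab + pac + t a / r \<le> 1" "pba + pbc + t b / r \<le> 1" "pca + pcb + t c / r \<le> 1"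
  shows "feasible r C t"
proof -
  define B where "B w e =
    (if w = a then if e = ec then pab else pac
     else if w = b then if e = ec then pba else pbc
     else if w = c then if e = eb then pca else pcb
     else 1 - t w / r)" for w e
  have te: "0 \<le> t w" if "w \<in> e" "e \<in> edges C" for w e using t D(5) that by blast
  have b: "(\<forall>w\<in>e. 0 < B w e) \<and> 1 / r \<le> (\<Prod>w\<in>e. B w e)" if "e \<in> edges C" for e
  proof -
    have "(\<forall>w\<in>ea. 0 < B w ea) \<and> 1 / r \<le> (\<Prod>w\<in>ea. B w ea)"
      by (rule edge_label_bound[where t = t and u = b and v = c])
        (use D(4) inEC V E te r s p e notin in \<open>auto simp: B_def\<close>)
    moreover have "(\<forall>w\<in>eb. 0 < B w eb) \<and> 1 / r \<le> (\<Prod>w\<in>eb. B w eb)"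
      by (rule edge_label_bound[where t = t and u = a and v = c])
        (use D(4) inEC V E te r s p e notin in \<open>auto simp: B_def\<close>)
    moreover have "(\<forall>w\<in>ec. 0 < B w ec) \<and> 1 / r \<le> (\<Prod>w\<in>ec. B w ec)"
      by (rule edge_label_bound[where t = t and u = a and v = b])
        (use D(4) inEC V E te r s p e notin in \<open>auto simp: B_def\<close>)
    ultimately show ?thesis using that E by auto
  qed
  have "(\<Sum>e\<in>incident C w. B w e) + t w / r \<le> 1" if w: "w \<in> verts C" for w
  proof (cases "w \<in> {a, b, c}")
    case True
    then consider "w = a" | "w = b" | "w = c" by blast
    then show ?thesis
    proof cases
      case 1
      have "B a eb = pac" "B a ec = pab" using E(3) by (auto simp: B_def)
      then show ?thesis using 1 v(1) E(3) unfolding 1 inc(1) by simp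
    next
      case 2
      have "B b ea = pbc" "B b ec = pba" using E(4) V(1) by (auto simp: B_def)
      then show ?thesis using v(2) E(4) unfolding 2 inc(2) by simp
    next
      case 3
      have "B c ea = pcb" "B c eb = pca" using E(2) V(2,3) by (auto simp: B_def)
      then show ?thesis using v(3) E(2) unfolding 3 inc(3) by simp
    qed
  next
    case False
    obtain e where e: "e \<in> edges C" "w \<in> e" using w cycle_coreD(2)[OF core] by blast
    have "incident C w = {e}"
    proof
      show "incident C w \<subseteq> {e}" using shared[OF e(2) _ e(1)] False unfolding incident_def by blast
    qed (use e in \<open>simp add: incident_def\<close>)
    then show ?thesis using False by (simp add: B_def)
  qed
  then show ?thesis unfolding feasible_def using b by (intro exI[of _ B]) auto
qed

end

text \<open>The second junction of \<open>e\<close> is not on \<open>f\<close>, so with only three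
  edges it must lie on \<open>e'\<close>.\<close>

lemma triangle_ex:
  assumes core: "cycle_core k C" and k: "k \<ge> 3" and c3: "card (edges C) = 3"
  shows "\<exists>a b c ea eb ec. triangle_core k C a b c ea eb ec"
proof -
  note D = kgraphD[OF cycle_coreD(1)[OF core]]
  obtain f where f: "f \<in> edges C" using c3 by fastforce
  obtain e e' p q where "cycle_contraction k C f e e' p q"
    using cycle_contraction_ex[OF core k _ f] c3 by auto
  then interpret cycle_contraction k C f e e' p q .
  have sub: "{f, e, e'} \<subseteq> edges C" and three: "card {f, e, e'} = 3" using f e by auto
  have E: "edges C = {f, e, e'}"
    using card_seteq[OF _ sub] three c3 \<open>card (edges C) = 3\<close> kgraphD(2)[OF cycle_coreD(1)[OF core]] by simp
  have "card {v\<in>e. card (incident C v) = 2} = 2" using cycle_coreD(6)[OF core e(1)] .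
  moreover have "{v\<in>e. card (incident C v) = 2} \<noteq> {p}"
  proof
    assume "{v\<in>e. card (incident C v) = 2} = {p}"
    then show False using calculation by simp
  qed
  moreover have "p \<in> {v\<in>e. card (incident C v) = 2}" using incident_p f pq by simp
  ultimately obtain w where w: "w \<in> e" "card (incident C w) = 2" "w \<noteq> p" by blast
  have "w \<notin> f" using meets_f[of w e] w f e by metis
  have "incident C w \<noteq> {e}" using w(2) by auto
  moreover have "e \<in> incident C w" using w e by (simp add: incident_def)
  ultimately obtain g where "g \<in> incident C w" "g \<noteq> e" by blast
  then have "w \<in> e'" using E \<open>w \<notin> f\<close> by (auto simp: incident_def)
  moreover have "w \<noteq> q" using w q_notin by blast
  ultimately have "triangle_core k C w p q f e' e"
    using core k E f e pq w unfolding triangle_core_def by auto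
  then show ?thesis by blast
qed

section \<open>The decisive inequality\<close>

text \<open>The quantity \<open>y - y / (r - y)\<close> is what is gained when \<open>y\<close>
  edges hang one level further out instead of at the cycle; its growth reduces the delicate cases
  below to the least \<open>y\<close> that is not excluded.\<close>

lemma gain_mono:
  fixes r y c :: real
  assumes "c \<le> y" "y + 2 \<le> r" "c \<le> r / 2" "0 \<le> c"
  shows "c - c / (r - c) \<le> y - y / (r - y)"
proof -
  have 1: "r - y \<ge> 2" "r - c \<ge> 2" "r \<ge> 0" using assms by auto
  have "r \<le> 2 * (r - c)" using assms by simp
  also have "\<dots> \<le> (r - y) * (r - c)" using 1 by (intro mult_right_mono) auto
  finally have "r \<le> (r - y) * (r - c)" .
  moreover have "(r - y) * (r - c) > 0" using 1 by simp
  ultimately have "r / ((r - y) * (r - c)) \<le> 1" by (simp only: divide_le_eq_1) simp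
  then have "0 \<le> (y - c) * (1 - r / ((r - y) * (r - c)))" using assms by simp
  also have "\<dots> = (y - c) - (y / (r - y) - c / (r - c))"
    using 1 by (simp add: divide_simps) (simp add: algebra_simps)
  finally show ?thesis by simp
qed

context
  fixes r :: real and m :: nat
  assumes r: "(r - m) * (r - 2) = 8" "r > m" "m \<ge> 8"
begin

text \<open>At \<open>m = 8\<close> and \<open>r = 9\<close> the product in the root equation is
  only 7.\<close>

lemma root_gt_9: "r > 9"
proof (rule ccontr)
  assume "\<not> r > 9"
  then have "r - m \<le> 1" "r - 2 \<le> 7" "r - m \<ge> 0" "r - 2 \<ge> 0" using r by auto
  then have "(r - m) * (r - 2) \<le> 1 * 7" by (intro mult_mono) auto
  then show False using r by simp
qed

text \<open>\<open>a\<close> and \<open>b\<close> count the edges attached at the two common vertices of the cycle, \<open>y\<close> and \<open>z\<close> the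
  edges hanging at other vertices of these, and \<open>s\<close> the edges hanging at the other vertices of the
  cycle. The excluded parameters belong to the listed graphs.\<close>

lemma core_inequality_ordered:
  fixes a b y z s :: nat
  assumes sum: "a + b + y + z + s + 2 = m" and y: "y > 0 \<longrightarrow> a > 0" and z: "z > 0 \<longrightarrow> b > 0"
    and le: "b + z \<le> a + y"
    and ex: "\<not> (y = 0 \<and> z = 0 \<and> s = 0 \<and> b \<le> 2)" "\<not> (y = 0 \<and> z = 0 \<and> s = 1 \<and> b = 0)"
      "\<not> (y = 1 \<and> z = 0 \<and> s = 0 \<and> b = 0)"
  shows "2 * r * (2 + s / (r - s)) < (r - (a + y / (r - y))) * (r - (b + z / (r - z)))"
proof -
  define \<delta> where "\<delta> = r - m"
  have d: "\<delta> > 0" "\<delta> * (r - 2) = 8" using r by (auto simp: \<delta>_def)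
  have rd: "r * \<delta> = 8 + 2 * \<delta>" using d by (simp add: algebra_simps)
  note r9 = root_gt_9
  define A where "A = a + y / (r - y)"
  define B where "B = b + z / (r - z)"
  have sumr: "real a + b + y + z + s + 2 = m" using sum by (metis of_nat_add of_nat_numeral)
  have Ale: "A \<le> real a + y" and Ble: "B \<le> real b + z"
    using frac_le_self[of y r] frac_le_self[of z r] sumr r by (auto simp: A_def B_def)
  have pos: "r - (real a + y) > 0" "r - (real b + z) > 0" using sumr r by auto
  have "(r - (real a + y)) * (r - (real b + z)) \<le> (r - A) * (r - B)"
    using Ale Ble pos by (intro mult_mono) auto
  moreover have "(r - (real a + y)) * (r - (real b + z)) =
      r * (r - (real a + b + y + z)) + (real a + y) * (real b + z)"
    by (simp add: algebra_simps)
  moreover have "r - (real a + b + y + z) = \<delta> + 2 + s" using sumr by (simp add: \<delta>_def)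
  \<comment> \<open>Replacing \<open>y / (r - y)\<close> by \<open>y\<close> and
    \<open>z / (r - z)\<close> by \<open>z\<close> only lowers the right side. This crude bound
    suffices except for \<open>s = 1\<close> with \<open>b + z = 0\<close> and for
    \<open>s = 0\<close> with \<open>b + z \<le> 2\<close>.\<close>
  ultimately have low: "8 + 2 * \<delta> + 2 * r + r * s + (real a + y) * (real b + z) \<le> (r - A) * (r - B)"
    using rd by (simp add: distrib_left)
  have ab0: "(real a + y) * (real b + z) \<ge> 0" by simp
  have rs: "r - s > 2" using sumr r by auto
  consider "s \<ge> 3" | "s = 2" | "s = 1" | "s = 0" by linarith
  then have "2 * r * (2 + s / (r - s)) < (r - A) * (r - B)"
  proof cases
    case 1
    define w where "w = r - s"
    have s3: "real s \<ge> 3" using 1 by simp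
    have "2 * r * s < w * (r * (real s - 2) + 8 + 2 * \<delta>)"
    proof (cases "s + 2 = m")
      \<comment> \<open>Now \<open>a\<close>, \<open>b\<close>, \<open>y\<close> and
        \<open>z\<close> vanish, and \<open>r - s = 2 + \<delta>\<close> is too close to 2 for the
        estimate of the other case; the exact relation \<open>\<delta> * (s + \<delta>) = 8\<close>
        replaces it.\<close>
      case True
      then have mr: "real m = real s + 2" by simp
      have rr: "r = s + 2 + \<delta>" "w = 2 + \<delta>" unfolding w_def \<delta>_def mr by auto
      have ds: "\<delta> * (s + \<delta>) = 8" using d(2) rr by (simp add: add.commute)
      have "w * (r * (real s - 2) + 8 + 2 * \<delta>) - 2 * r * s = 8 + 4 * \<delta> - 4 * s + s * (\<delta> * (s + \<delta>))"
        unfolding rr by (simp add: algebra_simps)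
      also have "\<dots> = 8 + 4 * \<delta> + 4 * s" unfolding ds by simp
      finally show ?thesis using d(1) by linarith
    next
      case False
      then have w3: "w > 3" using sumr sum d(1) unfolding w_def \<delta>_def by linarith
      have "9 * (real s - 2) \<le> w * w * (real s - 2)"
        using w3 s3 mult_mono[of 3 w 3 w] by (intro mult_right_mono) auto
      moreover have "3 * (real s * s - 4 * s + 8) \<le> w * (real s * s - 4 * s + 8)"
      proof (rule mult_right_mono)
        have "0 \<le> (real s - 2) * (real s - 2)" by simp
        then show "0 \<le> real s * s - 4 * s + 8" by (simp add: algebra_simps)
      qed (use w3 in simp)
      moreover have "0 < 9 * (real s - 2) + 3 * (real s * s - 4 * s + 8) - 2 * s * s"
      proof -
        have "0 \<le> (real s - 3) * real s" using s3 by simp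
        then show ?thesis by (simp add: algebra_simps)
      qed
      moreover have "w * (r * (real s - 2) + 8) - 2 * r * s =
          w * w * (real s - 2) + w * (real s * s - 4 * s + 8) - 2 * s * s"
        unfolding w_def by (simp add: algebra_simps)
      moreover have "w * (r * (real s - 2) + 8 + 2 * \<delta>) = w * (r * (real s - 2) + 8) + 2 * (w * \<delta>)"
        by (simp add: algebra_simps)
      moreover have "w * \<delta> > 0" using w3 d by simp
      ultimately show ?thesis by linarith
    qed
    then have "2 * r * s / w < r * (real s - 2) + 8 + 2 * \<delta>"
      using rs by (simp add: w_def pos_divide_less_eq mult.commute)
    moreover have "2 * r * (2 + s / (r - s)) = 4 * r + 2 * r * s / w" by (simp add: w_def algebra_simps)
    moreover have "r * (real s - 2) = r * s - 2 * r" by (simp add: algebra_simps)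
    ultimately show ?thesis using low ab0 by linarith
  next
    case 2
    have "2 * r * (2 + s / (r - s)) = 4 * r + 4 * (r / (r - 2))" using 2 by (simp add: algebra_simps)
    also have "r / (r - 2) = 1 + 2 / (r - 2)" using r9 by (simp add: field_simps)
    also have "8 / (r - 2) = \<delta>" using d r9 by (simp add: field_simps)
    then have "4 * r + 4 * (1 + 2 / (r - 2)) = 4 * r + 4 + \<delta>" by (simp add: algebra_simps)
    finally have "2 * r * (2 + s / (r - s)) = 4 * r + 4 + \<delta>" .
    moreover have "r * s = 2 * r" using 2 by simp
    ultimately show ?thesis using low ab0 d(1) by linarith
  next
    case 3
    have rhs: "2 * r * (2 + s / (r - s)) = 4 * r + 2 + 2 / (r - 1)"
      using 3 r9 by (simp add: field_simps)
    have r1: "2 / (r - 1) < 1" using r9 by (simp add: field_simps)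
    show ?thesis
    proof (cases "b + z = 0")
      case False
      then have "a + y \<ge> 1" "b + z \<ge> 1" using le by auto
      then have "real a + y \<ge> 1" "real b + z \<ge> 1" by linarith+
      then have "0 \<le> (real a + y - 1) * (real b + z - 1)" by simp
      then have "(real a + y) * (real b + z) \<ge> (real a + y) + (real b + z) - 1"
        by (simp add: algebra_simps)
      then have "(real a + y) * (real b + z) \<ge> real m - 4" using sumr 3 by simp
      then have "8 + 2 * \<delta> + 3 * r + (real m - 4) \<le> (r - A) * (r - B)" using low 3 by simp
      then show ?thesis unfolding rhs using r1 r(2) \<delta>_def by linarith
    next
      case True
      \<comment> \<open>The excluded case \<open>y = 0\<close> belongs to \<open>U3_1\<close>; from
        \<open>y = 1\<close> on, the gain of \<open>1 - 1 / (r - 1)\<close> is enough.\<close>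
      then have b0: "b = 0" "z = 0" by auto
      have y1: "y \<ge> 1" using ex b0 3 by linarith
      have ay: "real a = real m - 3 - real y" "a \<ge> 1" using sumr 3 b0 y y1 by auto
      have "1 - 1 / (r - 1) \<le> y - y / (r - y)"
        by (rule gain_mono) (use y1 ay r r9 in auto)
      moreover have "3 / (r - 1) < \<delta>"
      proof -
        have "\<delta> = 8 / (r - 2)" using d r9 by (simp add: field_simps)
        also have "\<dots> > 3 / (r - 1)" using r9 by (simp add: field_simps)
        finally show ?thesis .
      qed
      moreover have "r - A = \<delta> + 3 + (y - y / (r - y))" using ay by (simp add: A_def \<delta>_def)
      moreover have "3 / (r - 1) = 1 / (r - 1) + 2 / (r - 1)" by (simp add: add_divide_distrib[symmetric])
      ultimately have "r - A > 4 + 2 / (r - 1)" by linarith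
      then have "(4 + 2 / (r - 1)) * r < (r - A) * r" using r9 by (intro mult_strict_right_mono) auto
      moreover have "(4 + 2 / (r - 1)) * r = 4 * r + 2 + 2 / (r - 1)" using r9 by (simp add: field_simps)
      ultimately show ?thesis unfolding rhs using b0 by (simp add: B_def)
    qed
  next
    case 4
    have rhs: "2 * r * (2 + s / (r - s)) = 4 * r" using 4 by simp
    \<comment> \<open>This is the equation of \<open>U2 k (m - 4) 2\<close>, whose cycle condition
      holds with equality at \<open>r\<close>.\<close>
    have four: "4 * r = (\<delta> + 4) * (r - 2)" using d by (simp add: algebra_simps)
    consider "b + z \<ge> 3" | "b + z = 2" | "b + z = 1" | "b + z = 0" by linarith
    then show ?thesis
    proof cases
      case 1
      then have "real b + z \<ge> 3" "real a + y \<ge> 3" using le by linarith+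
      then have "0 \<le> (real a + y - 3) * (real b + z - 3)" by simp
      then have "(real a + y) * (real b + z) \<ge> 3 * ((real a + y) + (real b + z)) - 9"
        by (simp add: algebra_simps)
      then have "(real a + y) * (real b + z) \<ge> 3 * (real m - 2) - 9" using sumr 4 r(3) by (simp add: of_nat_diff)
      moreover have "real m \<ge> 8" using r(3) by simp
      moreover have "8 + 2 * \<delta> + 2 * r + (real a + y) * (real b + z) \<le> (r - A) * (r - B)"
        using low unfolding 4 by simp
      moreover have "4 * r < Q"
        if "3 * (M - 2) - 9 \<le> P" "8 \<le> M" "8 + 2 * (r - M) + 2 * r + P \<le> Q" for P Q M :: real
        using that by argo
      ultimately show ?thesis unfolding rhs \<delta>_def by blast
    next
      case 2
      have ay: "real a + y = real m - 4" using sumr 2 4 by linarith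
      have strict: "real x / (r - x) < x" if "1 \<le> x" "x \<le> m - 2" for x :: nat
      proof -
        have "r - x > 1" using that r by linarith
        then have "real x * 1 < x * (r - x)" using that by (intro mult_strict_left_mono) auto
        then show ?thesis using \<open>r - x > 1\<close> by (simp add: field_simps)
      qed
      \<comment> \<open>The totals on the two sides are those of the reference graph, so strictness
        has to come from an edge that is not attached directly at the cycle.\<close>
      have "y \<ge> 1 \<or> z \<ge> 1" using ex 2 4 by linarith
      then have "A < real a + y \<or> B < real b + z"
        using strict[of y] strict[of z] sum by (auto simp: A_def B_def)
      moreover have "r - (real a + y) = \<delta> + 4" using ay r(3) by (simp add: \<delta>_def)
      moreover have "r - (real b + z) = r - 2" using 2 by linarith
      ultimately have "\<delta> + 4 \<le> r - A" "r - 2 \<le> r - B" "\<delta> + 4 < r - A \<or> r - 2 < r - B"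
        using Ale Ble by linarith+
      then have "(\<delta> + 4) * (r - 2) < (r - A) * (r - B)"
        using d(1) r9 by (smt (verit) mult_le_cancel_left mult_le_cancel_right mult_less_cancel_left mult_less_cancel_right)
      then show ?thesis unfolding rhs four .
    next
      case 3
      have b1: "b = 1" "z = 0" using 3 z by linarith+
      have y1: "y \<ge> 1" using ex b1 4 by linarith
      have ay: "real a = real m - 3 - real y" "a \<ge> 1" using sumr 4 b1 y y1 by auto
      have "1 - 1 / (r - 1) \<le> y - y / (r - y)"
        by (rule gain_mono) (use y1 ay r r9 in auto)
      moreover have "r - A = \<delta> + 3 + (y - y / (r - y))" using ay by (simp add: A_def \<delta>_def)
      ultimately have "r - A \<ge> \<delta> + 4 - 1 / (r - 1)" by linarith
      then have "(\<delta> + 4 - 1 / (r - 1)) * (r - 1) \<le> (r - A) * (r - 1)"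
        using r9 by (intro mult_right_mono) auto
      moreover have "(\<delta> + 4 - 1 / (r - 1)) * (r - 1) = (\<delta> + 4) * (r - 2) + \<delta> + 3"
        using r9 by (simp add: field_simps)
      ultimately show ?thesis unfolding rhs four using b1 d(1) by (simp add: B_def)
    next
      case bz: 4
      then have b0: "b = 0" "z = 0" by auto
      \<comment> \<open>The values 0 and 1 of \<open>y\<close> are excluded; they belong to
        \<open>U2 k (m - 2) 0\<close> and \<open>U3_2 k (m - 4) 0 1\<close>.\<close>
      have y2: "y \<ge> 2" using ex b0 4 by linarith
      have ay: "real a = real m - 2 - real y" "a \<ge> 1" using sumr 4 b0 y y2 by auto
      have "2 - 2 / (r - 2) \<le> y - y / (r - y)"
        by (rule gain_mono) (use y2 ay r r9 in auto)
      moreover have "2 / (r - 2) < \<delta>"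
      proof -
        have "\<delta> = 8 / (r - 2)" using d r9 by (simp add: field_simps)
        also have "\<dots> > 2 / (r - 2)" using r9 by (simp add: field_simps)
        finally show ?thesis .
      qed
      moreover have "r - A = \<delta> + 2 + (y - y / (r - y))" using ay by (simp add: A_def \<delta>_def)
      ultimately have "r - A > 4" by linarith
      then have "4 * r < (r - A) * r" using r9 by (intro mult_strict_right_mono) auto
      then show ?thesis unfolding rhs using b0 by (simp add: B_def)
    qed
  qed
  then show ?thesis by (simp add: A_def B_def)
qed

lemma core_inequality:
  fixes a b y z s :: nat
  assumes sum: "a + b + y + z + s + 2 = m" and y: "y > 0 \<longrightarrow> a > 0" and z: "z > 0 \<longrightarrow> b > 0"
    and ex: "\<not> (y = 0 \<and> z = 0 \<and> s = 0 \<and> (a \<le> 2 \<or> b \<le> 2))"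
      "\<not> (y = 0 \<and> z = 0 \<and> s = 1 \<and> (a = 0 \<or> b = 0))"
      "\<not> (y = 1 \<and> z = 0 \<and> s = 0 \<and> b = 0)" "\<not> (y = 0 \<and> z = 1 \<and> s = 0 \<and> a = 0)"
  shows "2 * r * (2 + s / (r - s)) < (r - (a + y / (r - y))) * (r - (b + z / (r - z)))"
proof (cases "b + z \<le> a + y")
  case True
  then show ?thesis using assms by (intro core_inequality_ordered) auto
next
  case False
  have "2 * r * (2 + s / (r - s)) < (r - (b + z / (r - z))) * (r - (a + y / (r - y)))"
    using assms False by (intro core_inequality_ordered) auto
  then show ?thesis by (simp only: mult.commute)
qed

text \<open>Both sides are continuous at \<open>r\<close>, so the strict inequality survives
  slightly to the left of it.\<close>

lemma core_inequality_left:
  fixes a b y z s :: nat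
  assumes "a + b + y + z + s + 2 = m" "y > 0 \<longrightarrow> a > 0" "z > 0 \<longrightarrow> b > 0"
    and "\<not> (y = 0 \<and> z = 0 \<and> s = 0 \<and> (a \<le> 2 \<or> b \<le> 2))"
      "\<not> (y = 0 \<and> z = 0 \<and> s = 1 \<and> (a = 0 \<or> b = 0))"
      "\<not> (y = 1 \<and> z = 0 \<and> s = 0 \<and> b = 0)" "\<not> (y = 0 \<and> z = 1 \<and> s = 0 \<and> a = 0)"
  shows "\<forall>\<^sub>F x :: real in at_left r. 2 * x * (2 + s / (x - s)) < (x - (a + y / (x - y))) * (x - (b + z / (x - z)))"
proof -
  have ne: "r - s \<noteq> 0" "r - y \<noteq> 0" "r - z \<noteq> 0" using assms(1) r(2) by auto
  let ?F = "\<lambda>x :: real. (x - (a + y / (x - y))) * (x - (b + z / (x - z))) - 2 * x * (2 + s / (x - s))"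
  have "(?F \<longlongrightarrow> ?F r) (at_left r)" by (intro tendsto_intros ne)
  moreover have "0 < ?F r" using core_inequality[OF assms] by simp
  ultimately have "\<forall>\<^sub>F x in at_left r. 0 < ?F x" by (rule order_tendstoD(1))
  then show ?thesis by (rule eventually_mono) simp
qed

lemma left_of_root: "\<forall>\<^sub>F x in at_left r. m < x \<and> 9 < x"
proof (rule eventually_conj)
  show "\<forall>\<^sub>F x in at_left r. m < x" "\<forall>\<^sub>F x in at_left r. 9 < x"
    using r(2) root_gt_9 by (auto intro: order_tendstoD(1)[OF tendsto_ident_at])
qed

end

section \<open>Upper bound for the remaining unicyclic graphs\<close>

context triangle_core
begin

lemma sum_ea: "(\<Sum>w\<in>ea. t w) = t b + t c + (\<Sum>w\<in>ea - {b, c}. t w)" for t :: "'a \<Rightarrow> 'b::comm_monoid_add"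
proof -
  have "(\<Sum>w\<in>ea. t w) = (\<Sum>w\<in>{b, c}. t w) + (\<Sum>w\<in>ea - {b, c}. t w)"
    using D(4)[OF inEC(1)] V by (subst add.commute, intro sum.subset_diff) auto
  then show ?thesis using V by simp
qed

lemma sum_verts:
  fixes t :: "'a \<Rightarrow> nat"
  shows "(\<Sum>w\<in>verts C. t w) = t a + t b + t c + (\<Sum>w\<in>ea - {b, c}. t w) +
    (\<Sum>w\<in>eb - {a, c}. t w) + (\<Sum>w\<in>ec - {a, b}. t w)"
proof -
  have fin: "finite ea" "finite eb" "finite ec" using D(4) inEC by auto
  have verts: "verts C = {a, b, c} \<union> (ea - {b, c}) \<union> (eb - {a, c}) \<union> (ec - {a, b})"
    using cycle_coreD(2)[OF core] E(1) V by auto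
  have dis: "(ea - {b, c}) \<inter> (eb - {a, c}) = {}" "(ea - {b, c}) \<inter> (ec - {a, b}) = {}"
    "(eb - {a, c}) \<inter> (ec - {a, b}) = {}"
    using shared[of _ ea eb] shared[of _ ea ec] shared[of _ eb ec] inEC E(2-4) notin by blast+
  have "(\<Sum>w\<in>verts C. t w) = (\<Sum>w\<in>{a, b, c} \<union> (ea - {b, c}) \<union> (eb - {a, c}). t w) + (\<Sum>w\<in>ec - {a, b}. t w)"
    unfolding verts using fin dis notin by (intro sum.union_disjoint) auto
  also have "(\<Sum>w\<in>{a, b, c} \<union> (ea - {b, c}) \<union> (eb - {a, c}). t w) =
      (\<Sum>w\<in>{a, b, c} \<union> (ea - {b, c}). t w) + (\<Sum>w\<in>eb - {a, c}. t w)"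
    using fin dis notin by (intro sum.union_disjoint) auto
  also have "(\<Sum>w\<in>{a, b, c} \<union> (ea - {b, c}). t w) = (\<Sum>w\<in>{a, b, c}. t w) + (\<Sum>w\<in>ea - {b, c}. t w)"
    using fin notin by (intro sum.union_disjoint) auto
  finally show ?thesis using V by simp
qed

text \<open>The contracted triangle is a two-edge cycle with weights \<open>A\<close> and
  \<open>t a\<close> and nothing further out, so the inequality applies with
  \<open>y = z = 0\<close>. The two guards keep these weights away from the excluded parameters;
  \<open>A \<ge> 1\<close> holds by construction.\<close>

lemma eventually_feasible_by_contraction:
  fixes t :: "'a \<Rightarrow> nat" and r :: real
  assumes r: "(r - m) * (r - 2) = 8" "r > m" "m \<ge> 8" and m: "(\<Sum>w\<in>verts C. t w) + 3 = m"
    and s: "(\<Sum>w\<in>eb - {a, c}. t w) + (\<Sum>w\<in>ec - {a, b}. t w) = s"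
    and g: "s = 0 \<Longrightarrow> 3 \<le> t a \<and> 3 \<le> 1 + (\<Sum>w\<in>ea. t w)" "s = 1 \<Longrightarrow> 1 \<le> t a"
  shows "\<forall>\<^sub>F x in at_left r. feasible x C t"
proof -
  define A where "A = 1 + (\<Sum>w\<in>ea. t w)"
  have sum: "A + t a + 0 + 0 + s + 2 = m"
    using m sum_verts[of t] sum_ea[of t] s by (simp add: A_def)
  have "\<forall>\<^sub>F x :: real in at_left r. 2 * x * (2 + s / (x - s)) <
      (x - (A + (0::nat) / (x - (0::nat)))) * (x - (t a + (0::nat) / (x - (0::nat))))"
    using g by (intro core_inequality_left[OF r sum]) (auto simp: A_def)
  moreover note left_of_root[OF r]
  ultimately show ?thesis
  proof eventually_elim
    case (elim x)
    show ?case
    proof (rule feasible_by_contraction)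
      show "x > 0" using elim by simp
      show "(\<Sum>w\<in>eb - {a, c}. real (t w)) + (\<Sum>w\<in>ec - {a, b}. real (t w)) = real s"
        using s by (metis of_nat_add of_nat_sum)
      show "1 + (\<Sum>w\<in>ea. real (t w)) = real A" by (simp add: A_def)
      show "real s < x" "real A < x" "real (t a) < x" using elim sum by auto
      show "2 * x * (2 + real s / (x - real s)) \<le> (x - real A) * (x - real (t a))"
        using elim by simp
    qed simp
  qed
qed

text \<open>Contracting \<open>ea\<close> would give \<open>A \<le> 2\<close>, an excluded
  parameter. Instead the two edges at \<open>a\<close> share the capacity left there, at least
  \<open>3 / x\<close> or \<open>4 / x\<close>. Each then needs \<open>2 / 3\<close> or
  \<open>1 / 2\<close> at its other end, and the remainders \<open>1 / 3\<close> or
  \<open>3 / 8\<close> suffice on \<open>ea\<close> because \<open>x > 9\<close>.\<close>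

lemma feasible_heavy_vertex:
  fixes t :: "'a \<Rightarrow> nat" and x :: real
  assumes x: "x > m" "x > 9" and m: "(\<Sum>w\<in>verts C. t w) + 3 = m" "m \<ge> 8"
    and s: "(\<Sum>w\<in>ea - {b, c}. t w) = sa" "(\<Sum>w\<in>eb - {a, c}. t w) = 0" "(\<Sum>w\<in>ec - {a, b}. t w) = 0"
    and le: "t b + t c + sa \<le> 1"
  shows "feasible x C t"
proof -
  have ta: "real (t a) + real (t b) + real (t c) + real sa + 3 = m"
    using m(1) sum_verts[of t] s by simp
  have sr: "(\<Sum>w\<in>ea - {b, c}. real (t w)) = real sa" "(\<Sum>w\<in>eb - {a, c}. real (t w)) = 0"
    "(\<Sum>w\<in>ec - {a, b}. real (t w)) = 0"
    using s by (simp_all only: of_nat_sum[symmetric] of_nat_0)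
  consider "t b + t c + sa = 0" | "t b + t c + sa = 1" using le by linarith
  then show ?thesis
  proof cases
    case 1
    then have t0: "t b = 0" "t c = 0" "sa = 0" by auto
    show ?thesis
      by (rule feasible_by_labels[where pab = "3 / (2 * x)" and pac = "3 / (2 * x)" and pba = "2 / 3"
            and pca = "2 / 3" and pbc = "1 / 3" and pcb = "1 / 3", OF _ _ sr])
        (use x ta t0 in \<open>auto simp: field_simps\<close>)
  next
    case 2
    then have l: "real (t b) \<le> 1" "real (t c) \<le> 1" "real sa \<le> 1" "real (t b) + real (t c) + real sa = 1"
      by linarith+
    show ?thesis
    proof (rule feasible_by_labels[where pab = "2 / x" and pac = "2 / x" and pba = "1 / 2"
            and pca = "1 / 2" and pbc = "3 / 8" and pcb = "3 / 8", OF _ _ sr])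
      have "1 / (x - real sa) \<le> 1 / 8" using x l by (intro divide_left_mono) auto
      then show "1 / (x - real sa) \<le> 3 / 8 * (3 / 8)" by simp
      have "real (t b) / x \<le> 1 / 8" "real (t c) / x \<le> 1 / 8" using x l by (auto simp: field_simps)
      then show "1 / 2 + 3 / 8 + real (t b) / x \<le> 1" "1 / 2 + 3 / 8 + real (t c) / x \<le> 1" by linarith+
      show "2 / x + 2 / x + real (t a) / x \<le> 1" using x ta l by (simp add: field_simps)
    qed (use x l in auto)
  qed
qed

text \<open>A weight of at most 2 uses at most a third of the capacity of a junction, leaving a
  third for each of its two edges; \<open>1 / 9 \<ge> 1 / x\<close> then settles the
  products.\<close>

lemma feasible_light:
  fixes t :: "'a \<Rightarrow> nat" and x :: real
  assumes x: "x > 9" and t: "t a \<le> 2" "t b \<le> 2" "t c \<le> 2"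
    and s: "(\<Sum>w\<in>ea - {b, c}. t w) = 0" "(\<Sum>w\<in>eb - {a, c}. t w) = 0" "(\<Sum>w\<in>ec - {a, b}. t w) = 0"
  shows "feasible x C t"
proof -
  have sr: "(\<Sum>w\<in>ea - {b, c}. real (t w)) = 0" "(\<Sum>w\<in>eb - {a, c}. real (t w)) = 0"
    "(\<Sum>w\<in>ec - {a, b}. real (t w)) = 0"
    using s by (simp_all only: of_nat_sum[symmetric] of_nat_0)
  have "real n / x \<le> 1 / 3" if "n \<le> 2" for n :: nat
  proof -
    have "real n / x \<le> 2 / 6" using that x by (intro frac_le) auto
    then show ?thesis by simp
  qed
  note l = this[OF t(1)] this[OF t(2)] this[OF t(3)]
  show ?thesis
    by (rule feasible_by_labels[where pab = "1 / 3" and pac = "1 / 3" and pba = "1 / 3"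
          and pca = "1 / 3" and pbc = "1 / 3" and pcb = "1 / 3", OF _ _ sr])
      (use x l in \<open>auto simp: field_simps\<close>)
qed

text \<open>If two of \<open>sa\<close>, \<open>sb\<close>, \<open>sc\<close> add up to at least 2,
  the third edge is contracted. Otherwise at most one unit hangs off the junctions, and either the
  weights at the junctions still permit a contraction, or one junction carries nearly everything, or
  all junctions are light.\<close>

lemma eventually_feasible:
  fixes t :: "'a \<Rightarrow> nat" and r :: real
  assumes r: "(r - m) * (r - 2) = 8" "r > m" "m \<ge> 8" and m: "(\<Sum>w\<in>verts C. t w) + 3 = m"
  shows "\<forall>\<^sub>F x in at_left r. feasible x C t"
proof -
  define sa where "sa = (\<Sum>w\<in>ea - {b, c}. t w)"
  define sb where "sb = (\<Sum>w\<in>eb - {a, c}. t w)"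
  define sc where "sc = (\<Sum>w\<in>ec - {a, b}. t w)"
  have T1: "triangle_core k C a b c ea eb ec" by unfold_locales
  have T2: "triangle_core k C b c a eb ec ea" using triangle_rotate[OF T1] .
  have T3: "triangle_core k C c a b ec ea eb" using triangle_rotate[OF T2] .
  have s2: "(\<Sum>w\<in>eb - {c, a}. t w) = sb" "(\<Sum>w\<in>ec - {b, a}. t w) = sc" "(\<Sum>w\<in>ea - {c, b}. t w) = sa"
    by (simp_all add: sa_def sb_def sc_def insert_commute)
  note s1 = sa_def[symmetric] sb_def[symmetric] sc_def[symmetric]
  have E: "(\<Sum>w\<in>ea. t w) = t b + t c + sa" "(\<Sum>w\<in>eb. t w) = t c + t a + sb"
    "(\<Sum>w\<in>ec. t w) = t a + t b + sc"
    using triangle_core.sum_ea[OF T1, of t] triangle_core.sum_ea[OF T2, of t]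
      triangle_core.sum_ea[OF T3, of t] s2 s1 by auto
  have tot: "t a + t b + t c + sa + sb + sc + 3 = m" using sum_verts[of t] m s1 by simp
  have ca: ?thesis if "sb + sc = 0 \<Longrightarrow> 3 \<le> t a \<and> 2 \<le> t b + t c + sa" "sb + sc = 1 \<Longrightarrow> 1 \<le> t a"
    by (rule triangle_core.eventually_feasible_by_contraction[OF T1 r m, where s = "sb + sc"])
      (use that E in \<open>auto simp: s1 s2\<close>)
  have cb: ?thesis if "sc + sa = 0 \<Longrightarrow> 3 \<le> t b \<and> 2 \<le> t c + t a + sb" "sc + sa = 1 \<Longrightarrow> 1 \<le> t b"
    by (rule triangle_core.eventually_feasible_by_contraction[OF T2 r m, where s = "sc + sa"])
      (use that E in \<open>auto simp: s1 s2\<close>)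
  have cc: ?thesis if "sa + sb = 0 \<Longrightarrow> 3 \<le> t c \<and> 2 \<le> t a + t b + sc" "sa + sb = 1 \<Longrightarrow> 1 \<le> t c"
    by (rule triangle_core.eventually_feasible_by_contraction[OF T3 r m, where s = "sa + sb"])
      (use that E in \<open>auto simp: s1 s2\<close>)
  have ha: ?thesis if "t b + t c + sa \<le> 1" "sb = 0" "sc = 0"
    using left_of_root[OF r]
    by (rule eventually_mono)
      (rule triangle_core.feasible_heavy_vertex[OF T1 _ _ m r(3), where sa = sa];
        use that in \<open>simp add: s1 s2\<close>)
  have hb: ?thesis if "t c + t a + sb \<le> 1" "sc = 0" "sa = 0"
    using left_of_root[OF r]
    by (rule eventually_mono)
      (rule triangle_core.feasible_heavy_vertex[OF T2 _ _ m r(3), where sa = sb];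
        use that in \<open>simp add: s1 s2\<close>)
  have hc: ?thesis if "t a + t b + sc \<le> 1" "sa = 0" "sb = 0"
    using left_of_root[OF r]
    by (rule eventually_mono)
      (rule triangle_core.feasible_heavy_vertex[OF T3 _ _ m r(3), where sa = sc];
        use that in \<open>simp add: s1 s2\<close>)
  have li: ?thesis if "t a \<le> 2" "t b \<le> 2" "t c \<le> 2" "sa = 0" "sb = 0" "sc = 0"
    using left_of_root[OF r]
    by (rule eventually_mono) (rule feasible_light; use that in \<open>simp add: s1\<close>)
  consider "sb + sc \<ge> 2" | "sc + sa \<ge> 2" | "sa + sb \<ge> 2" | "sa = 1" "sb = 0" "sc = 0"
    | "sa = 0" "sb = 1" "sc = 0" | "sa = 0" "sb = 0" "sc = 1" | "sa = 0" "sb = 0" "sc = 0" by linarith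
  then show ?thesis
  proof cases
    case 4
    then show ?thesis using cb cc ha by (cases "t b \<ge> 1"; cases "t c \<ge> 1") auto
  next
    case 5
    then show ?thesis using ca cc hb by (cases "t a \<ge> 1"; cases "t c \<ge> 1") auto
  next
    case 6
    then show ?thesis using ca cb hc by (cases "t a \<ge> 1"; cases "t b \<ge> 1") auto
  next
    case 7
    consider "t a \<le> 2" "t b \<le> 2" "t c \<le> 2" | "t a \<ge> 3" | "t b \<ge> 3" | "t c \<ge> 3" by linarith
    then show ?thesis
    proof cases
      case 1
      then show ?thesis using li 7 by blast
    next
      case 2
      then show ?thesis using 7 ca ha by (cases "t b + t c \<le> 1") auto
    next
      case 3
      then show ?thesis using 7 cb hb by (cases "t c + t a \<le> 1") auto
    next
      case 4
      then show ?thesis using 7 cc hc by (cases "t a + t b \<le> 1") auto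
    qed
  qed (use ca cb cc in auto)
qed

end

text \<open>Each contraction trades one edge for one unit of weight, so the total \<open>m\<close>
  is preserved down to the triangle.\<close>

lemma eventually_feasible_long_cycle:
  fixes t :: "'a \<Rightarrow> nat" and r :: real
  assumes r: "(r - m) * (r - 2) = 8" "r > m" "m \<ge> 8" and k: "k \<ge> 3"
    and "cycle_core k C" "card (edges C) \<ge> 3" "(\<Sum>w\<in>verts C. t w) + card (edges C) = m"
  shows "\<forall>\<^sub>F x in at_left r. feasible x C t"
  using assms(5-)
proof (induction "card (edges C)" arbitrary: C t rule: less_induct)
  case less
  show ?case
  proof (cases "card (edges C) = 3")
    case True
    obtain a b c ea eb ec where "triangle_core k C a b c ea eb ec"
      using triangle_ex[OF less.prems(1) k True] by blast
    then show ?thesis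
      by (rule triangle_core.eventually_feasible[OF _ r]) (use less.prems True in auto)
  next
    case False
    have "edges C \<noteq> {}" using less.prems(2) by auto
    then obtain f where "f \<in> edges C" by blast
    then obtain e e' p q where cc: "cycle_contraction k C f e e' p q"
      using cycle_contraction_ex[OF less.prems(1) k less.prems(2)] by blast
    interpret cycle_contraction k C f e e' p q by (rule cc)
    define t' where "t' = t(p := 1 + (\<Sum>v\<in>f. t v))"
    have fin: "finite (verts C)" "finite f" and fV: "f \<subseteq> verts C"
      using kgraphD[OF cycle_coreD(1)[OF less.prems(1)]] f(1) by auto
    have "verts C' = insert p (verts C - f)" using fV pq by (auto simp: C'_def)
    then have "(\<Sum>w\<in>verts C'. t' w) = t' p + (\<Sum>w\<in>verts C - f. t' w)"
      using fin pq by simp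
    also have "(\<Sum>w\<in>verts C - f. t' w) = (\<Sum>w\<in>verts C - f. t w)"
      using pq by (intro sum.cong) (auto simp: t'_def)
    also have "t' p + \<dots> = 1 + ((\<Sum>w\<in>verts C - f. t w) + (\<Sum>w\<in>f. t w))" by (simp add: t'_def)
    also have "(\<Sum>w\<in>verts C - f. t w) + (\<Sum>w\<in>f. t w) = (\<Sum>w\<in>verts C. t w)"
      using fin(1) fV by (intro sum.subset_diff[symmetric])
    finally have "(\<Sum>w\<in>verts C'. t' w) + card (edges C') = m"
      using less.prems(3) card_edges_C' by simp
    moreover have "card (edges C') < card (edges C)" "card (edges C') \<ge> 3"
      using card_edges_C' less.prems(2) False by auto
    ultimately have "\<forall>\<^sub>F x in at_left r. feasible x C' t'"
      by (intro less.hyps cycle_core_C')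
    then show ?thesis
      using left_of_root[OF r]
    proof eventually_elim
      case (elim x)
      have "feasible x C' ((\<lambda>v. real (t v))(p := 1 + (\<Sum>v\<in>f. real (t v))))"
        by (rule feasible_cong[OF elim(1)]) (auto simp: t'_def)
      then show ?case using elim by (intro feasible_contract) auto
    qed
  qed
qed

text \<open>Each parameter tuple excluded from \<open>core_inequality_left\<close> leaves at most
  one edge that is not attached directly at \<open>u\<close> or \<open>v\<close>; locating that edge
  identifies \<open>H\<close> as one of the listed graphs.\<close>

lemma eventually_feasible_grown_two_cycle:
  fixes r :: real
  assumes r: "(r - m) * (r - 2) = 8" "r > m" "m \<ge> 8" and k: "k \<ge> 3"
    and c: "two_cycle k u v e1 e2" and g: "grown k (e1 \<union> e2, {e1, e2}) \<phi> t0 H" and m: "card (edges H) = m"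
    and nin: "H \<notin> U2 k (m - 2) 0 \<union> U2 k (m - 3) 1 \<union> U2 k (m - 4) 2 \<union> U3_1 k (m - 3) 0 1 \<union> U3_2 k (m - 4) 0 1"
  shows "\<forall>\<^sub>F x in at_left r. feasible x H (\<lambda>_. 0)"
proof -
  have k2: "k \<ge> 2" using k by simp
  note D = two_cycleD[OF c]
  let ?C = "(e1 \<union> e2, {e1, e2})"
  have kC: "kgraph k ?C" by (rule kgraph_two_cycle[OF c])
  obtain a b H0 \<psi> t where U: "U2_at k a b u v e1 e2 H0" and gr: "grown k H0 \<psi> t H"
    and t0: "t u = 0" "t v = 0" using grown_two_cycle[OF g c k2] by blast
  obtain H1 where H1: "(attach_pendent k u ^^ a) ?C H1" and H0: "(attach_pendent k v ^^ b) H1 H0"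
    using U U2_at_two_cycle by metis
  note P1 = attach_pendent_pow[OF kC k2 H1]
  note P0 = attach_pendent_pow[OF P1(1) k2 H0]
  note G = grownD[OF gr P0(1) k2]
  have uv: "u \<in> verts ?C" "v \<in> verts ?C" "v \<in> verts H1" using D P1(2) by auto
  define y where "y = (\<Sum>w\<in>verts H1 - verts ?C. t w)"
  define z where "z = (\<Sum>w\<in>verts H0 - verts H1. t w)"
  define s where "s = (\<Sum>w\<in>e1 \<union> e2 - {u, v}. t w)"
  have fin: "finite (verts H0)" using kgraphD(1)[OF P0(1)] .
  have V0: "(\<Sum>w\<in>verts H0. t w) = z + (\<Sum>w\<in>verts H1. t w)"
    unfolding z_def using fin P0(2) by (intro sum.subset_diff)
  have "(\<Sum>w\<in>verts H1. t w) = y + (\<Sum>w\<in>verts ?C. t w)"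
    unfolding y_def using P1(2) finite_subset[OF P0(2) fin] by (intro sum.subset_diff)
  moreover have "(\<Sum>w\<in>verts ?C. t w) = s"
  proof -
    have "(\<Sum>w\<in>verts ?C. t w) = s + (\<Sum>w\<in>{u, v}. t w)"
      unfolding s_def using D by (simp only: fst_conv, intro sum.subset_diff) auto
    then show ?thesis using t0 D(5) by simp
  qed
  ultimately have T: "(\<Sum>w\<in>verts H0. t w) = z + y + s" using V0 by simp
  have "card (edges ?C) = 2" using D(6) by simp
  then have sum: "a + b + y + z + s + 2 = m" using G(6) P0(4) P1(4) T m by simp
  have ya: "y > 0 \<longrightarrow> a > 0" using H1 by (cases "a = 0") (auto simp: y_def)
  have zb: "z > 0 \<longrightarrow> b > 0" using H0 by (cases "b = 0") (auto simp: z_def)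
  have Usw: "U2_at k b a v u e1 e2 H0" by (rule U2_at_swap[OF U k2])
  have one: "\<exists>w\<in>verts H0. (attach_pendent k w ^^ 1) H0 H \<and> t w = 1" if "z + y + s = 1"
    unfolding relpowp_1 using grown_one[OF gr P0(1) k2] T that by simp
  have pos: "n \<ge> 1" if "w \<in> A" "finite A" "t w = 1" "n = (\<Sum>w\<in>A. t w)" for w A n
    using member_le_sum[of w A t] that by simp
  have finC: "finite (e1 \<union> e2 - {u, v})" "finite (verts H1 - verts ?C)" "finite (verts H0 - verts H1)"
    using D fin finite_subset[OF P0(2) fin] by auto
  have where_w: "w \<in> e1 \<union> e2 - {u, v} \<and> s \<ge> 1 \<or> w \<in> verts H1 - verts ?C \<and> y \<ge> 1 \<or>
      w \<in> verts H0 - verts H1 \<and> z \<ge> 1" if w: "w \<in> verts H0" "t w = 1" for w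
  proof -
    have "w \<notin> {u, v}" using w t0 by auto
    then consider "w \<in> e1 \<union> e2 - {u, v}" | "w \<in> verts H1 - verts ?C" | "w \<in> verts H0 - verts H1"
      using w(1) by auto
    then show ?thesis
      using pos[OF _ finC(1) w(2) s_def] pos[OF _ finC(2) w(2) y_def]
        pos[OF _ finC(3) w(2) z_def] by cases blast+
  qed
  have ex1: "\<not> (y = 0 \<and> z = 0 \<and> s = 0 \<and> (a \<le> 2 \<or> b \<le> 2))"
  proof
    assume a: "y = 0 \<and> z = 0 \<and> s = 0 \<and> (a \<le> 2 \<or> b \<le> 2)"
    then have "H = H0" using grown_zero[OF gr P0(1) k2] T by simp
    then have U': "H \<in> U2 k a b" "H \<in> U2 k b a" using U Usw unfolding U2_def by blast+
    have ab: "a + b + 2 = m" using sum a by simp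
    consider "a \<le> 2" | "b \<le> 2" using a by blast
    then show False
    proof cases
      case 1
      then have "a = 0 \<and> b = m - 2 \<or> a = 1 \<and> b = m - 3 \<or> a = 2 \<and> b = m - 4" using ab by linarith
      then show False using U' nin by auto
    next
      case 2
      then have "b = 0 \<and> a = m - 2 \<or> b = 1 \<and> a = m - 3 \<or> b = 2 \<and> a = m - 4" using ab by linarith
      then show False using U' nin by auto
    qed
  qed
  have ex2: "\<not> (y = 0 \<and> z = 0 \<and> s = 1 \<and> (a = 0 \<or> b = 0))"
  proof
    assume a: "y = 0 \<and> z = 0 \<and> s = 1 \<and> (a = 0 \<or> b = 0)"
    then obtain w where w: "w \<in> verts H0" "(attach_pendent k w ^^ 1) H0 H" "t w = 1" using one by auto
    have wC: "w \<in> e1 \<union> e2" "w \<notin> {u, v}" using where_w[OF w(1,3)] a by auto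
    have "\<exists>u' v'. U2_at k (m - 3) 0 u' v' e1 e2 H0 \<and> w \<notin> {u', v'}"
    proof (cases "b = 0")
      case True
      then have "a = m - 3" using a sum by linarith
      then show ?thesis using U wC True by blast
    next
      case False
      then have "a = 0" "b = m - 3" using a sum by linarith+
      then show ?thesis using Usw wC by blast
    qed
    then obtain u' v' where U': "U2_at k (m - 3) 0 u' v' e1 e2 H0" "w \<notin> {u', v'}" by blast
    have "H \<in> U3_1 k (m - 3) 0 1"
    proof (cases "w \<in> e1")
      case True
      then have "w \<in> e1 - {u', v'}" using U'(2) by blast
      then show ?thesis unfolding U3_1_def using U'(1) w(2) by blast
    next
      case False
      then have "w \<in> e2 - {u', v'}" using U'(2) wC by blast
      then show ?thesis unfolding U3_1_def using U2_at_commute_edges[OF U'(1)] w(2) by blast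
    qed
    then show False using nin by blast
  qed
  have U32: "H \<in> U3_2 k (m - 4) 0 1"
    if "U2_at k (m - 3) 0 u' v' e1 e2 H0" "f \<in> edges H0 - {e1, e2}" "u' \<in> f" "w \<in> f - {u'}"
      "(attach_pendent k w ^^ 1) H0 H" for u' v' f w
  proof -
    \<comment> \<open>\<open>U3_2\<close> attaches one pendent edge more at \<open>u\<close> than
      its parameter says.\<close>
    have "m - 4 + 1 = m - 3" using r(3) by simp
    then show ?thesis unfolding U3_2_def using that by (intro CollectI) metis
  qed
  have ex3: "\<not> (y = 1 \<and> z = 0 \<and> s = 0 \<and> b = 0)"
  proof
    assume a: "y = 1 \<and> z = 0 \<and> s = 0 \<and> b = 0"
    then obtain w where w: "w \<in> verts H0" "(attach_pendent k w ^^ 1) H0 H" "t w = 1" using one by auto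
    have H01: "H0 = H1" using a H0 by auto
    have wC: "w \<in> verts H1 - verts ?C" using where_w[OF w(1,3)] a by auto
    then obtain f where f: "f \<in> edges H1 - edges ?C" "u \<in> f" "w \<in> f" using P1(5) by blast
    have "w \<noteq> u" using wC uv by auto
    have "a = m - 3" using a sum by linarith
    then have "U2_at k (m - 3) 0 u v e1 e2 H0" using U a by simp
    then have "H \<in> U3_2 k (m - 4) 0 1"
      by (rule U32[of u v f w]) (use f \<open>w \<noteq> u\<close> w(2) H01 in auto)
    then show False using nin by blast
  qed
  have ex4: "\<not> (y = 0 \<and> z = 1 \<and> s = 0 \<and> a = 0)"
  proof
    assume a: "y = 0 \<and> z = 1 \<and> s = 0 \<and> a = 0"
    then obtain w where w: "w \<in> verts H0" "(attach_pendent k w ^^ 1) H0 H" "t w = 1" using one by auto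
    have H01: "H1 = ?C" using a H1 by auto
    have wC: "w \<in> verts H0 - verts H1" using where_w[OF w(1,3)] a by auto
    then obtain f where f: "f \<in> edges H0 - edges H1" "v \<in> f" "w \<in> f" using P0(5) by blast
    have "w \<noteq> v" using wC uv by auto
    have "b = m - 3" using a sum by linarith
    then have "U2_at k (m - 3) 0 v u e1 e2 H0" using Usw a by simp
    then have "H \<in> U3_2 k (m - 4) 0 1"
      by (rule U32[of v u f w]) (use f \<open>w \<noteq> v\<close> w(2) H01 in auto)
    then show False using nin by blast
  qed
  have "\<forall>\<^sub>F x in at_left r. 2 * x * (2 + s / (x - s)) < (x - (a + y / (x - y))) * (x - (b + z / (x - z)))"
    by (rule core_inequality_left[OF r sum ya zb ex1 ex2 ex3 ex4])
  then show ?thesis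
    using left_of_root[OF r]
  proof eventually_elim
    case (elim x)
    have x: "x > 0" "real m < x" using elim by auto
    have sumr: "real a + b + y + z + s + 2 = m" using sum by (metis of_nat_add of_nat_numeral)
    have fy: "y / (x - y) \<le> y" "z / (x - z) \<le> z" using frac_le_self[of y x] frac_le_self[of z x] sumr x by auto
    have f0: "0 \<le> y / (x - y)" "0 \<le> z / (x - z)" using x sumr by auto
    define T where "T = (\<lambda>w. real (t w))"
    define B where "B = b + z / (x - z)"
    define A where "A = a + y / (x - y)"
    have AB: "A < x" "B < x" "2 * x * (2 + real s / (x - real s)) \<le> (x - A) * (x - B)"
      unfolding A_def B_def using fy sumr x elim(1) by linarith+
    \<comment> \<open>Weights are absorbed inwards: the branches count as weights \<open>T\<close>
      on \<open>H0\<close>, the edges at \<open>v\<close> collect into \<open>B\<close> and those at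
      \<open>u\<close> into \<open>A\<close>, and the two-edge cycle remains.\<close>
    have "feasible x H0 T"
    proof (rule feasible_attach_pow[OF P1(1) k2 x(1) uv(3) H0])
      show "(\<Sum>w\<in>verts H0 - verts H1. T w) = real z" by (simp add: T_def z_def)
      show "real z < x" using x sumr by simp
      have "feasible x H1 (T(v := B))"
      proof (rule feasible_attach_pow[OF kC k2 x(1) uv(1) H1])
        show "(\<Sum>w\<in>verts H1 - verts ?C. (T(v := B)) w) = real y"
          unfolding y_def of_nat_sum using uv(2) by (intro sum.cong) (auto simp: T_def)
        show "real y < x" using x sumr by simp
        show "0 \<le> (T(v := B)) w" for w using f0 by (simp add: T_def B_def)
        show "feasible x ?C ((T(v := B))(u := (T(v := B)) u + real a + real y / (x - real y)))"
        proof (rule feasible_two_cycle[OF c x(1)])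
          let ?t = "(T(v := B))(u := (T(v := B)) u + real a + real y / (x - real y))"
          have tu: "?t u = A" "?t v = B" using D(5) t0 by (auto simp: A_def T_def)
          show "0 \<le> ?t w" for w using f0 by (simp add: T_def B_def)
          show "(\<Sum>w\<in>e1 \<union> e2 - {u, v}. ?t w) = real s"
            unfolding s_def of_nat_sum by (intro sum.cong) (auto simp: T_def)
          show "real s < x" using x sumr by simp
          show "?t u < x" "?t v < x" "2 * x * (2 + real s / (x - real s)) \<le> (x - ?t u) * (x - ?t v)"
            unfolding tu by (rule AB)+
        qed
      qed
      then show "feasible x H1 (T(v := T v + real b + real z / (x - real z)))"
        using t0 by (simp add: T_def B_def add.assoc)
    qed (simp add: T_def)
    then show ?case unfolding T_def by (rule feasible_grown[OF gr P0(1) k2 x(1)])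
  qed
qed

lemma unicyclic_spectral_radius_less:
  fixes r :: real
  assumes r: "(r - m) * (r - 2) = 8" "r > m" "m \<ge> 8" and k: "k \<ge> 3"
    and H: "H \<in> unicyclics k m"
    and nin: "H \<notin> U2 k (m - 2) 0 \<union> U2 k (m - 3) 1 \<union> U2 k (m - 4) 2 \<union> U3_1 k (m - 3) 0 1 \<union> U3_2 k (m - 4) 0 1"
  shows "spectral_radius k H < root k r"
proof -
  have k2: "k \<ge> 2" using k by simp
  have m: "card (edges H) = m" and kH: "kgraph k H" using H by (auto simp: unicyclics_def unicyclic_def)
  have "linked_unicyclic k H"
    by (rule linked_unicyclicI) (use H k r in \<open>auto simp: unicyclics_def\<close>)
  then obtain C \<phi> t where C: "cycle_core k C" "grown k C \<phi> t H" using grown_from_cycle_core k2 by blast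
  note G = grownD[OF C(2) cycle_coreD(1)[OF C(1)] k2]
  have "card (edges C) \<ge> 2"
    using card_edges_ge_2[of k C] C(1) k by (auto simp: cycle_core_def)
  then consider "card (edges C) = 2" | "card (edges C) \<ge> 3" by linarith
  then have "\<forall>\<^sub>F x in at_left r. feasible x H (\<lambda>_. 0)"
  proof cases
    case 1
    then obtain u v e1 e2 where c: "two_cycle k u v e1 e2" "C = (e1 \<union> e2, {e1, e2})"
      using cycle_core_two[OF C(1)] by blast
    show ?thesis
      by (rule eventually_feasible_grown_two_cycle[OF r k c(1) C(2)[unfolded c(2)] m nin])
  next
    case 2
    have "\<forall>\<^sub>F x in at_left r. feasible x C t"
      by (rule eventually_feasible_long_cycle[OF r k C(1) 2]) (use G(6) m in simp)
    then show ?thesis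
      using left_of_root[OF r]
    proof eventually_elim
      case (elim x)
      then show ?case using feasible_grown[OF C(2) cycle_coreD(1)[OF C(1)] k2, of x] by simp
    qed
  qed
  moreover have "\<forall>\<^sub>F x in at_left r. x < r" by (simp add: eventually_at_filter)
  moreover note left_of_root[OF r]
  ultimately have "\<forall>\<^sub>F x in at_left r. feasible x H (\<lambda>_. 0) \<and> x < r \<and> x > 0"
    by eventually_elim simp
  then obtain x where "feasible x H (\<lambda>_. 0)" "x < r" "x > 0"
    using eventually_happens[of _ "at_left r"] trivial_limit_at_left_real by (metis (no_types, lifting))
  then have "spectral_radius k H \<le> root k x" "root k x < root k r"
    using spectral_radius_le[OF kH k2] k by auto
  then show ?thesis by simp
qed

section \<open>The extremal graphs\<close>

text \<open>The edge weights are \<open>g\<close> on \<open>e1\<close> and 1 on \<open>e2\<close>.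
  The vertex equations force \<open>X w = g ^ 3\<close> and the value \<open>g\<close> or 1 at
  unweighted vertices, so both edge equations reduce to \<open>X u * X v = r\<close>, which is the
  assumed identity.\<close>

lemma normal_two_cycle:
  fixes t :: "'a \<Rightarrow> real"
  assumes c: "two_cycle k u v e1 e2" and w: "w \<in> e1 - {u, v}" and r: "r > 0"
    and t: "t u < r" "t v < r" "t w < r" "\<And>x. x \<in> e1 \<union> e2 - {u, v, w} \<Longrightarrow> t x = 0"
    and eq: "(1 + sqrt (r / (r - t w)))\<^sup>2 * r = (r - t u) * (r - t v)"
  shows "normal r k (e1 \<union> e2, {e1, e2}) t"
proof -
  note D = two_cycleD[OF c]
  have sub: "{u, v, w} \<subseteq> e1" using D(1,3) w by blast
  have three: "card {u, v, w} = 3" using D(5) w by auto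
  have k: "k \<ge> 3" using card_mono[OF D(7) sub] three D(9) by simp
  define g where "g = sqrt (r / (r - t w))"
  have g: "g > 0" "g\<^sup>2 = r / (r - t w)" using r t by (auto simp: g_def)
  define Y where "Y e = (if e = e1 then g else 1)" for e
  define X where "X x = (if x = u then (1 + g) * (r / (r - t u)) else if x = v then (1 + g) * (r / (r - t v))
    else if x = w then g ^ 3 else if x \<in> e1 then g else 1)" for x
  have Xuv: "X u * X v = r"
  proof -
    have "X u * X v = (1 + g)\<^sup>2 * r * r / ((r - t u) * (r - t v))"
      using D(5) by (simp add: X_def power2_eq_square)
    also have "(1 + g)\<^sup>2 * r * r / ((r - t u) * (r - t v)) = r"
      unfolding g_def eq using t by simp
    finally show ?thesis .
  qed
  have e: "(\<Prod>x\<in>e. X x) = X u * X v * (\<Prod>x\<in>e - {u, v}. X x)" if "e \<in> {e1, e2}" for e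
  proof -
    have "finite e" "u \<in> e" "v \<in> e" using that D by auto
    then have "(\<Prod>x\<in>e. X x) = (\<Prod>x\<in>e - {u, v}. X x) * (\<Prod>x\<in>{u, v}. X x)"
      by (intro prod.subset_diff) auto
    then show ?thesis using D(5) by simp
  qed
  have "(\<Prod>x\<in>e1 - {u, v}. X x) = X w * (\<Prod>x\<in>e1 - {u, v} - {w}. X x)"
    by (rule prod.remove) (use D w in auto)
  also have "(\<Prod>x\<in>e1 - {u, v} - {w}. X x) = (\<Prod>x\<in>e1 - {u, v, w}. g)"
    by (rule prod.cong) (auto simp: X_def)
  also have "\<dots> = g ^ (k - 3)"
  proof -
    have "card (e1 - {u, v, w}) = k - 3" using card_Diff_subset[OF _ sub] three D(9) by simp
    then show ?thesis by simp
  qed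
  also have "X w = g ^ 3" using w by (auto simp: X_def)
  also have "g ^ 3 * g ^ (k - 3) = g ^ k" using k by (simp flip: power_add)
  finally have e1: "(\<Prod>x\<in>e1. X x) = r * Y e1 ^ k" using e[of e1] Xuv by (simp add: Y_def)
  have "(\<Prod>x\<in>e2 - {u, v}. X x) = (\<Prod>x\<in>e2 - {u, v}. 1)"
  proof (rule prod.cong[OF refl])
    fix x assume "x \<in> e2 - {u, v}"
    then have "x \<notin> e1" "x \<noteq> u" "x \<noteq> v" using D(11) by auto
    then show "X x = 1" using w by (auto simp: X_def)
  qed
  then have e2: "(\<Prod>x\<in>e2. X x) = r * Y e2 ^ k" using e[of e2] Xuv D(6) by (simp add: Y_def)
  have inc: "(\<Sum>e\<in>incident (e1 \<union> e2, {e1, e2}) x. Y e) = (if x \<in> {u, v} then g + 1 else if x \<in> e1 then g else 1)"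
    if x: "x \<in> e1 \<union> e2" for x
  proof (cases "x \<in> {u, v}")
    case True
    then have "incident (e1 \<union> e2, {e1, e2}) x = {e1, e2}" using D by (auto simp: incident_def)
    then show ?thesis using True D(6) by (simp add: Y_def)
  next
    case False
    then have "x \<notin> e1 \<inter> e2" using D(11) by blast
    then have "incident (e1 \<union> e2, {e1, e2}) x = {if x \<in> e1 then e1 else e2}"
      using x unfolding incident_def by (cases "x \<in> e1") auto
    then show ?thesis using False D(6) by (simp add: Y_def)
  qed
  have "0 < X x \<and> X x * (1 - t x / r) = (\<Sum>e\<in>incident (e1 \<union> e2, {e1, e2}) x. Y e)"
    if x: "x \<in> e1 \<union> e2" for x
  proof -
    have cancel: "y * (r / (r - s)) * (1 - s / r) = y" if "s < r" for y s
    proof -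
      have "r / (r - s) * (1 - s / r) = 1" using that r by (simp add: field_simps)
      then show ?thesis by (simp only: mult.assoc mult_1_right)
    qed
    consider "x = u" | "x = v" | "x = w" "x \<noteq> u" "x \<noteq> v" | "x \<notin> {u, v, w}" by blast
    then show ?thesis
    proof cases
      case 1
      have "X u = (1 + g) * (r / (r - t u))" by (simp add: X_def)
      then show ?thesis unfolding inc[OF x] using 1 cancel[OF t(1), of "1 + g"] g t r by simp
    next
      case 2
      have "X v = (1 + g) * (r / (r - t v))" using D(5) by (simp add: X_def)
      then show ?thesis unfolding inc[OF x] using 2 cancel[OF t(2), of "1 + g"] g t r by simp
    next
      case 3
      have "X w = g * (r / (r - t w))"
        using 3 by (simp add: X_def power3_eq_cube g(2)[symmetric] power2_eq_square)
      then show ?thesis unfolding inc[OF x] using 3 w cancel[OF t(3), of g] g t r by simp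
    next
      case 4
      then have "t x = 0" using t(4) x by blast
      then show ?thesis unfolding inc[OF x] using 4 g by (simp add: X_def)
    qed
  qed
  moreover have "Y e > 0" for e using g by (simp add: Y_def)
  ultimately show ?thesis
    unfolding normal_def using e1 e2 by (intro exI[of _ X] exI[of _ Y]) auto
qed

lemma two_cycle_third_vertex:
  assumes "two_cycle k u v e1 e2" "k \<ge> 3"
  shows "\<exists>w. w \<in> e1 - {u, v}"
proof (rule ccontr)
  note D = two_cycleD[OF assms(1)]
  assume "\<not> ?thesis"
  then have "e1 \<subseteq> {u, v}" by blast
  then have "card e1 \<le> card {u, v}" by (intro card_mono) auto
  then show False using D assms(2) by (simp add: card_insert_if)
qed

lemma normal_U2_at:
  fixes t :: "'a \<Rightarrow> real"
  assumes U: "U2_at k a b u v e1 e2 H" and k: "k \<ge> 3" and r: "r > 0"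
    and t: "\<And>x. x \<notin> e1 \<union> e2 \<Longrightarrow> t x = 0"
    and n: "normal r k (e1 \<union> e2, {e1, e2}) (t(u := t u + a, v := t v + b))"
  shows "normal r k H t" "kgraph k H" "e1 \<union> e2 \<subseteq> verts H"
proof -
  let ?C = "(e1 \<union> e2, {e1, e2})"
  have k2: "k \<ge> 2" using k by simp
  obtain H1 where H1: "(attach_pendent k u ^^ a) ?C H1" "(attach_pendent k v ^^ b) H1 H"
    and c: "two_cycle k u v e1 e2" using U U2_at_two_cycle by metis
  note D = two_cycleD[OF c]
  have kC: "kgraph k ?C" by (rule kgraph_two_cycle[OF c])
  note P1 = attach_pendent_pow[OF kC k2 H1(1)]
  note P = attach_pendent_pow[OF P1(1) k2 H1(2)]
  show "kgraph k H" "e1 \<union> e2 \<subseteq> verts H" using P P1 by auto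
  show "normal r k H t"
  proof (rule normal_attach_pow[OF P1(1) k2 r _ H1(2)])
    show "v \<in> verts H1" using P1(2) D by auto
    show "t x = 0" if "x \<in> verts H - verts H1" for x using t that P1(2) by auto
    show "normal r k H1 (t(v := t v + b))"
    proof (rule normal_attach_pow[OF kC k2 r _ H1(1)])
      show "u \<in> verts ?C" using D by simp
      show "(t(v := t v + b)) x = 0" if "x \<in> verts H1 - verts ?C" for x using t that D by auto
      show "normal r k ?C ((t(v := t v + b))(u := (t(v := t v + b)) u + a))"
        by (rule normal_cong[OF n]) (use D(5) in auto)
    qed
  qed
qed

lemma spectral_radius_U2:
  fixes r :: real
  assumes H: "H \<in> U2 k a b" and k: "k \<ge> 3" and r: "r > a" "r > b" "(r - a) * (r - b) = 4 * r"
  shows "spectral_radius k H = root k r"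
proof -
  obtain u v e1 e2 where U: "U2_at k a b u v e1 e2 H" using H unfolding U2_def by blast
  have c: "two_cycle k u v e1 e2" using U U2_at_two_cycle by metis
  note D = two_cycleD[OF c]
  \<comment> \<open>Any third vertex of \<open>e1\<close> serves, with weight 0; the square root in
    \<open>normal_two_cycle\<close> is then 1 and the condition becomes
    \<open>4 * r = (r - a) * (r - b)\<close>.\<close>
  obtain w where w: "w \<in> e1 - {u, v}" using two_cycle_third_vertex[OF c k] by blast
  have r0: "r > 0" using r by linarith
  let ?t = "(\<lambda>_. 0 :: real)(u := 0 + real a, v := 0 + real b)"
  have "normal r k (e1 \<union> e2, {e1, e2}) ?t"
  proof (rule normal_two_cycle[OF c w r0])
    have tw: "?t w = 0" "?t u = a" "?t v = b" using w D(5) by auto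
    show "?t u < r" "?t v < r" "?t w < r" unfolding tw using r r0 by auto
    show "(1 + sqrt (r / (r - ?t w)))\<^sup>2 * r = (r - ?t u) * (r - ?t v)"
      unfolding tw using r r0 by simp
  qed auto
  then have "normal r k H (\<lambda>_. 0)" "kgraph k H"
    using normal_U2_at[OF U k r0, of "\<lambda>_. 0"] by auto
  then show ?thesis using k by (intro spectral_radius_eq r0) auto
qed

text \<open>The pendent edge at \<open>w\<close> becomes a weight 1 there; with nothing at
  \<open>v\<close>, a factor \<open>r\<close> cancels from the cycle equation.\<close>

lemma spectral_radius_U3_1:
  fixes r :: real
  assumes H: "H \<in> U3_1 k a 0 1" and k: "k \<ge> 3" and r: "r > a" "r > 1"
    "r - a = (1 + sqrt (r / (r - 1)))\<^sup>2"
  shows "spectral_radius k H = root k r"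
proof -
  obtain u v e1 e2 H0 w where U: "U2_at k a 0 u v e1 e2 H0" and w: "w \<in> e1 - {u, v}"
    and at: "(attach_pendent k w ^^ 1) H0 H" using H unfolding U3_1_def by blast
  have c: "two_cycle k u v e1 e2" using U U2_at_two_cycle by metis
  note D = two_cycleD[OF c]
  have r0: "r > 0" using r by linarith
  have k2: "k \<ge> 2" using k by simp
  let ?s = "(\<lambda>_. 0 :: real)(w := 1)"
  let ?t = "?s(u := ?s u + real a, v := ?s v + real 0)"
  have n: "normal r k (e1 \<union> e2, {e1, e2}) ?t"
  proof (rule normal_two_cycle[OF c w r0])
    have tw: "?t w = 1" "?t u = a" "?t v = 0" using w D(5) by auto
    show "?t u < r" "?t v < r" "?t w < r" unfolding tw using r r0 by auto
    show "(1 + sqrt (r / (r - ?t w)))\<^sup>2 * r = (r - ?t u) * (r - ?t v)"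
      unfolding tw r(3) by simp
    show "?t x = 0" if "x \<in> e1 \<union> e2 - {u, v, w}" for x using that by auto
  qed
  have s0: "?s x = 0" if "x \<notin> e1 \<union> e2" for x using that w by auto
  note N = normal_U2_at[where t = ?s, OF U k r0 s0 n]
  have n0: "normal r k H0 ?s" by (rule N(1))
  have k0: "kgraph k H0" by (rule N(2))
  have V: "e1 \<union> e2 \<subseteq> verts H0" by (rule N(3))
  have wV: "w \<in> verts H0" using w V by auto
  have "normal r k H (\<lambda>_. 0)"
  proof (rule normal_attach_pow[OF k0 k2 r0 wV at])
    show "normal r k H0 ((\<lambda>_. 0)(w := 0 + real 1))" by (rule normal_cong[OF n0]) simp
  qed simp
  moreover have "kgraph k H" by (rule attach_pendent_pow(1)[OF k0 k2 at])
  ultimately show ?thesis using spectral_radius_eq[OF _ k2 r0] by blast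
qed

text \<open>\<open>U3_2\<close> describes a pendent edge only as one different from
  \<open>e1\<close> and \<open>e2\<close>; this shows that its vertices other than \<open>u\<close>
  are new.\<close>

lemma attach_pendent_pow_new_edge:
  assumes "kgraph k H" "k \<ge> 2" "(attach_pendent k x ^^ a) H H'" "f \<in> edges H' - edges H"
  shows "f \<inter> verts H \<subseteq> {x}" "f \<subseteq> verts H'"
proof -
  show "f \<subseteq> verts H'"
    using kgraphD(5)[OF attach_pendent_pow(1)[OF assms(1-3)]] assms(4) by blast
  show "f \<inter> verts H \<subseteq> {x}"
    using assms(3,4)
  proof (induction a arbitrary: H')
    case 0
    then show ?case by auto
  next
    case (Suc a)
    then obtain H1 where H1: "(attach_pendent k x ^^ a) H H1" "attach_pendent k x H1 H'" by auto
    note P = attach_pendent_pow[OF assms(1,2) H1(1)]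
    obtain N where "pendent_edge k H1 H' x N" using attach_pendentE[OF H1(2) P(1) assms(2)] .
    then interpret pendent_edge k H1 H' x N .
    show ?case
    proof (cases "f = insert x N")
      case True
      then show ?thesis using N P(2) by auto
    next
      case False
      then have "f \<in> edges H1 - edges H" using Suc.prems(2) by (simp add: H')
      then show ?thesis using Suc.IH[OF H1(1)] by blast
    qed
  qed
qed

text \<open>The outermost edge raises the cost of its carrier at \<open>u\<close> from 1 to
  \<open>r / (r - 1)\<close>; the equation of the two-edge cycle then loses a common factor
  \<open>r\<close>.\<close>

lemma spectral_radius_U3_2:
  fixes r :: real
  assumes H: "H \<in> U3_2 k a 0 1" and k: "k \<ge> 3" and r: "r > 1" "r - (a + r / (r - 1)) = 4"
  shows "spectral_radius k H = root k r"
proof -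
  obtain u v e1 e2 H0 f w where U: "U2_at k (a + 1) 0 u v e1 e2 H0" and f: "f \<in> edges H0 - {e1, e2}"
    "u \<in> f" "w \<in> f - {u}" and at: "(attach_pendent k w ^^ 1) H0 H" using H unfolding U3_2_def by blast
  let ?C = "(e1 \<union> e2, {e1, e2})"
  have c: "two_cycle k u v e1 e2" and H0: "(attach_pendent k u ^^ Suc a) ?C H0"
    using U by (auto simp: U2_at_two_cycle)
  note D = two_cycleD[OF c]
  have kC: "kgraph k ?C" by (rule kgraph_two_cycle[OF c])
  have r0: "r > 0" using r by linarith
  have k2: "k \<ge> 2" using k by simp
  obtain z where z: "z \<in> e1 - {u, v}" using two_cycle_third_vertex[OF c k] by blast
  have "f \<in> edges H0 - edges ?C" using f by simp
  note F = attach_pendent_pow_new_edge[OF kC k2 H0 this]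
  have w: "w \<in> verts H0 - verts ?C" using F f by auto
  have "normal r k H0 ((\<lambda>_. 0 :: real)(w := 1))"
  proof (rule normal_attach_pow_weighted[OF kC k2 r(1) _ H0 _ w])
    show "u \<in> verts ?C" using D by simp
    let ?t = "(\<lambda>_. 0 :: real)(u := 0 + (real (Suc a) - 1) + r / (r - 1))"
    show "normal r k ?C ?t"
    proof (rule normal_two_cycle[OF c z r0])
      have tw: "?t z = 0" "?t u = a + r / (r - 1)" "?t v = 0" using z D(5) by auto
      show "?t u < r" "?t v < r" "?t z < r" unfolding tw using r r0 by auto
      show "(1 + sqrt (r / (r - ?t z)))\<^sup>2 * r = (r - ?t u) * (r - ?t v)"
        unfolding tw r(2) using r0 by simp
    qed auto
  qed simp
  moreover have k0: "kgraph k H0" by (rule attach_pendent_pow(1)[OF kC k2 H0])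
  moreover have wV: "w \<in> verts H0" using w by simp
  ultimately have "normal r k H (\<lambda>_. 0)"
    by (intro normal_attach_pow[OF k0 k2 r0 wV at]) auto
  moreover have "kgraph k H" by (rule attach_pendent_pow(1)[OF k0 k2 at])
  ultimately show ?thesis using spectral_radius_eq[OF _ k2 r0] by blast
qed

section \<open>Locating and comparing the roots\<close>

lemma quadratic_root_ex:
  fixes A B c :: real
  assumes "B \<le> A" "c > 0"
  shows "\<exists>r>A. (r - A) * (r - B) = c"
proof -
  define d where "d = sqrt ((A - B)\<^sup>2 + 4 * c)"
  have d2: "d\<^sup>2 = (A - B)\<^sup>2 + 4 * c" using assms by (simp add: d_def)
  have "A - B < d" unfolding d_def using assms by (intro real_less_rsqrt) simp
  then have "A < (A + B + d) / 2" by simp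
  moreover have "((A + B + d) / 2 - A) * ((A + B + d) / 2 - B) = (d\<^sup>2 - (A - B)\<^sup>2) / 4"
    by (simp add: field_simps power2_eq_square)
  then have "((A + B + d) / 2 - A) * ((A + B + d) / 2 - B) = c" using d2 by simp
  ultimately show ?thesis by blast
qed

text \<open>To the right of \<open>A\<close> the quadratic increases, so values can be compared
  instead of arguments.\<close>

lemma quadratic_root_less:
  fixes A B r r' :: real
  assumes "(r - A) * (r - B) < (r' - A) * (r' - B)" "B \<le> A" "A < r'"
  shows "r < r'"
proof (rule ccontr)
  assume "\<not> r < r'"
  then have "(r' - A) * (r' - B) \<le> (r - A) * (r - B)" using assms by (intro mult_mono) auto
  then show False using assms by simp
qed

text \<open>Intermediate value theorem between \<open>m + 1\<close> and \<open>m + 2\<close>: the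
  left side of the equation rises from 4 to 5, while the right side is above 4 at the start and
  below 5 at the end.\<close>

lemma U3_1_root_ex:
  assumes "m \<ge> 8"
  shows "\<exists>r. real m + 1 < r \<and> r - (real m - 3) = (1 + sqrt (r / (r - 1)))\<^sup>2"
proof -
  define F where "F r = r - (real m - 3) - (1 + sqrt (r / (r - 1)))\<^sup>2" for r
  have cont: "continuous_on {real m + 1..real m + 2} F"
    unfolding F_def using assms by (intro continuous_intros) auto
  have "1 < sqrt ((real m + 1) / (real m + 1 - 1))"
    using assms by (simp add: field_simps)
  then have "2\<^sup>2 < (1 + sqrt ((real m + 1) / (real m + 1 - 1)))\<^sup>2"
    by (intro power_strict_mono) auto
  then have F1: "F (real m + 1) < 0" by (simp add: F_def)
  define g where "g = sqrt ((real m + 2) / (real m + 2 - 1))"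
  define i where "i = 1 / (real m + 1)"
  have g2: "g\<^sup>2 = 1 + i" unfolding g_def i_def by (simp add: field_simps)
  have "i \<le> 1 / 9" unfolding i_def using assms by (intro divide_left_mono) auto
  then have "2 * (1 + g\<^sup>2) < 5" unfolding g2 by simp
  moreover have "(1 + g)\<^sup>2 \<le> 2 * (1 + g\<^sup>2)"
    using sum_squares_bound[of 1 g] by (simp add: power2_sum)
  ultimately have "(1 + g)\<^sup>2 < 5" by (rule le_less_trans[rotated])
  then have F2: "F (real m + 2) > 0" by (simp add: F_def g_def)
  obtain r where r: "real m + 1 \<le> r" "F r = 0"
    using IVT'[of F "real m + 1" 0 "real m + 2", OF _ _ _ cont] F1 F2 by auto
  moreover have "r \<noteq> real m + 1" using r F1 by auto
  ultimately show ?thesis by (intro exI[of _ r]) (auto simp: F_def)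
qed

theorem theorem3p6:
  fixes k m :: nat
    and G20 G21 G22 G31 G32 :: "'a hgraph"
  assumes "k \<ge> 3" and "m \<ge> 8"
    and "G20 \<in> U2 k (m - 2) 0"
    and "G21 \<in> U2 k (m - 3) 1"
    and "G22 \<in> U2 k (m - 4) 2"
    and "G31 \<in> U3_1 k (m - 3) 0 1"
    and "G32 \<in> U3_2 k (m - 4) 0 1"
  shows "(spectral_radius k G22 \<le> spectral_radius k G32 \<and>
          spectral_radius k G32 < spectral_radius k G31 \<and>
          spectral_radius k G31 < spectral_radius k G21 \<and>
          spectral_radius k G21 < spectral_radius k G20 \<and>
          (spectral_radius k G22 = spectral_radius k G32 \<longrightarrow> m = 8)) \<and>
         (\<forall>H :: 'b hgraph. H \<in> unicyclics k m \<and>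
            H \<notin> U2 k (m - 2) 0 \<union> U2 k (m - 3) 1 \<union> U2 k (m - 4) 2
                \<union> U3_1 k (m - 3) 0 1 \<union> U3_2 k (m - 4) 0 1
            \<longrightarrow> spectral_radius k H < spectral_radius k G22)"
proof -
  note k = assms(1) and m = assms(2)
  have m8: "real m \<ge> 8" using m by simp
  have nat_m: "real (m - 2) = real m - 2" "real (m - 3) = real m - 3" "real (m - 4) = real m - 4"
    using m by (auto simp: of_nat_diff)
  have root_less: "root k x < root k y \<longleftrightarrow> x < y" "root k x \<le> root k y \<longleftrightarrow> x \<le> y"
    "root k x = root k y \<longleftrightarrow> x = y" for x y using k by auto
  \<comment> \<open>Apart from \<open>r22\<close>, the roots are compared through
    \<open>(r - (m + 1)) * (r - 1)\<close>: its value is 1 at \<open>r32\<close>, 4 at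
    \<open>r21\<close> and \<open>m + 1\<close> at \<open>m + 2\<close>, and at \<open>r31\<close>
    it lies strictly between 1 and 4.\<close>
  obtain r22 where r22: "r22 > real m" "(r22 - m) * (r22 - 2) = 8"
    using quadratic_root_ex[of 2 "real m" 8] m8 by auto
  obtain r32 where r32: "r32 > real m + 1" "(r32 - (real m + 1)) * (r32 - 1) = 1"
    using quadratic_root_ex[of 1 "real m + 1" 1] by auto
  obtain r21 where r21: "r21 > real m + 1" "(r21 - (real m + 1)) * (r21 - 1) = 4"
    using quadratic_root_ex[of 1 "real m + 1" 4] by auto
  obtain r31 where r31: "r31 > real m + 1" "r31 - (real m - 3) = (1 + sqrt (r31 / (r31 - 1)))\<^sup>2"
    using U3_1_root_ex[OF m] by auto
  have rho20: "spectral_radius k G20 = root k (real m + 2)"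
    by (rule spectral_radius_U2[OF assms(3) k]) (use m in \<open>auto simp: nat_m\<close>)
  have rho21: "spectral_radius k G21 = root k r21"
  proof (rule spectral_radius_U2[OF assms(4) k])
    show "(r21 - real (m - 3)) * (r21 - real 1) = 4 * r21"
      using r21(2) by (simp add: nat_m algebra_simps)
  qed (use r21 m8 in \<open>auto simp: nat_m\<close>)
  have rho22: "spectral_radius k G22 = root k r22"
  proof (rule spectral_radius_U2[OF assms(5) k])
    show "(r22 - real (m - 4)) * (r22 - real 2) = 4 * r22"
      using r22(2) by (simp add: nat_m algebra_simps)
  qed (use r22 m8 in \<open>auto simp: nat_m\<close>)
  have rho31: "spectral_radius k G31 = root k r31"
    by (rule spectral_radius_U3_1[OF assms(6) k]) (use r31 m8 in \<open>auto simp: nat_m\<close>)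
  have r32': "r32 / (r32 - 1) = r32 - m"
    using r32 m8 by (simp add: field_simps)
  have rho32: "spectral_radius k G32 = root k r32"
    by (rule spectral_radius_U3_2[OF assms(7) k]) (use r32 r32' m8 in \<open>auto simp: nat_m\<close>)
  have le22: "r22 \<le> r32 \<and> (r22 = r32 \<longrightarrow> m = 8)"
  proof (cases "m = 8")
    case True
    \<comment> \<open>For \<open>m = 8\<close> both equations read
      \<open>r^2 - 10 * r + 8 = 0\<close>, hence the possible equality.\<close>
    have "(r32 - m) * (r32 - 2) = 8" using r32(2) True by (simp add: algebra_simps)
    then have "\<not> r32 < r22"
      using r22 r32(1) m8 mult_strict_mono[of "r32 - m" "r22 - m" "r32 - 2" "r22 - 2"] by auto
    then show ?thesis using True by simp
  next
    case False
    then have "real m \<ge> 9" using m by simp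
    then have "r32 > 10" using r32 by linarith
    \<comment> \<open>The goal \<open>8 < (r32 - m) * (r32 - 2)\<close> is multiplied by
      \<open>r32 - 1\<close>; this identity turns it into
      \<open>8 * (r32 - 1) < r32 * (r32 - 2)\<close>, which holds for
      \<open>r32 > 10\<close>.\<close>
    have "(r32 - m) * (r32 - 1) = r32" using r32(2) by (simp add: algebra_simps)
    then have "(r32 - m) * (r32 - 2) * (r32 - 1) = r32 * (r32 - 2)" by (simp add: mult_ac)
    moreover have "8 * (r32 - 1) < r32 * (r32 - 2)"
    proof -
      have "0 < r32 * (r32 - 10)" using \<open>r32 > 10\<close> by simp
      then show ?thesis by (simp add: algebra_simps)
    qed
    ultimately have "8 * (r32 - 1) < (r32 - m) * (r32 - 2) * (r32 - 1)" by (simp only:)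
    then have "8 < (r32 - m) * (r32 - 2)"
      by (rule mult_right_less_imp_less) (use \<open>r32 > 10\<close> in simp)
    then have "(r22 - m) * (r22 - 2) < (r32 - m) * (r32 - 2)" unfolding r22(2) .
    then have "r22 < r32"
      by (rule quadratic_root_less) (use r22 r32 m8 in auto)
    then show ?thesis by simp
  qed
  define g where "g = sqrt (r31 / (r31 - 1))"
  have g: "g > 1" "g\<^sup>2 = 1 + 1 / (r31 - 1)"
    using r31(1) m8 by (auto simp: g_def field_simps)
  \<comment> \<open>As \<open>g^2 - 1 = 1 / (r31 - 1)\<close>, this difference lies between
    \<open>g^2 - 1\<close> and \<open>2 * (g^2 - 1)\<close>: the lower bound uses
    \<open>g > 1\<close>, the upper one \<open>(g - 1)^2 > 0\<close>.\<close>
  have r31': "r31 - (real m + 1) = 2 * g + g\<^sup>2 - 3"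
    using r31(2) by (simp add: g_def[symmetric] power2_sum)
  have inv: "1 / (r31 - 1) * (r31 - 1) = 1" using r31(1) m8 by simp
  have "1 / (r31 - 1) < r31 - (real m + 1)" unfolding r31' using g by simp
  then have "1 / (r31 - 1) * (r31 - 1) < (r31 - (real m + 1)) * (r31 - 1)"
    using r31(1) m8 by (intro mult_strict_right_mono) auto
  then have "(r32 - (real m + 1)) * (r32 - 1) < (r31 - (real m + 1)) * (r31 - 1)"
    unfolding inv r32(2) .
  then have "r32 < r31"
    by (rule quadratic_root_less) (use r31(1) r32 inv in simp_all)
  have "0 < (g - 1)\<^sup>2" using g by simp
  then have "2 * g < 1 + g\<^sup>2" by (simp add: power2_diff)
  then have "r31 - (real m + 1) < 4 * (1 / (r31 - 1))" unfolding r31' using g r31(1) m8 by simp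
  then have "(r31 - (real m + 1)) * (r31 - 1) < 4 * (1 / (r31 - 1)) * (r31 - 1)"
    using r31(1) m8 by (intro mult_strict_right_mono) auto
  then have "(r31 - (real m + 1)) * (r31 - 1) < (r21 - (real m + 1)) * (r21 - 1)"
    unfolding mult.assoc[of 4] inv r21(2) by simp
  then have "r31 < r21"
    by (rule quadratic_root_less) (use r31(1) r21 inv in simp_all)
  have "(r21 - (real m + 1)) * (r21 - 1) < (real m + 2 - (real m + 1)) * (real m + 2 - 1)"
    unfolding r21(2) using m8 by simp
  then have "r21 < real m + 2"
    by (rule quadratic_root_less) (use r21 m8 in simp_all)
  have "spectral_radius k H < spectral_radius k G22"
    if "H \<in> unicyclics k m" "H \<notin> U2 k (m - 2) 0 \<union> U2 k (m - 3) 1 \<union> U2 k (m - 4) 2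
        \<union> U3_1 k (m - 3) 0 1 \<union> U3_2 k (m - 4) 0 1" for H :: "'b hgraph"
    unfolding rho22 by (rule unicyclic_spectral_radius_less[OF r22(2,1) m k that])
  then show ?thesis
    unfolding rho20 rho21 rho22 rho31 rho32 root_less
    using le22 \<open>r32 < r31\<close> \<open>r31 < r21\<close> \<open>r21 < real m + 2\<close> by blast
qed

end
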